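(* The minimal boundary of the chain $\{\mathbb{G}_N,\Lambda^{N+1}_N\}$ coincides with its Martin boundary (both viewed as subsets of $\varprojlim\mathcal{M}(\mathbb{G}_N)$), and hence can be identified with $\mathbb{G}_\infty$ via $X\mapsto M^{(X)}$. Moreover, under this identification the Borel structure of the minimal boundary (inherited from $\varprojlim\mathcal{M}(\mathbb{G}_N)$) coincides with the natural Borel structure of the space $\mathbb{G}_\infty$.
   Context: Fix $q\in(0,1)$, $\zeta_-<0$, $\zeta_+>0$, and let $\mathfrak{L}=\{\zeta_-q^m:m\in\mathbb{Z}\}\sqcup\{\zeta_+q^n:n\in\mathbb{Z}\}\subset\mathbb{R}\setminus\{0\}$. A configuration is a subset of $\mathfrak{L}$; $\mathbb{G}_N$ ($N\ge1$) is the set of $N$-element configurations $X=(x_1<\dots<x_N)$. Interlacing. For $a<b$ in $\mathfrak{L}$ put $I(a,b)=[a,b)\cap\mathfrak{L}$ if $a<b<0$; $I(a,b)=[a,b]\cap\mathfrak{L}$ if $a<0<b$; $I(a,b)=(a,b]\cap\mathfrak{L}$ if $0<a<b$. For $X\in\mathbb{G}_{N+1}$, $Y\in\mathbb{G}_N$ write $Y\prec X$ if $y_i\in I(x_i,x_{i+1})$ for $i=1,\dots,N$. $q$-links. $\Lambda^{N+1}_N$ is the stochastic matrix of format $\mathbb{G}_{N+1}\times\mathbb{G}_N$ with $$\Lambda^{N+1}_N(X,Y)=\prod_{i=1}^N|y_i|\cdot(1-q)\cdots(1-q^N)\cdot\frac{\prod_{1\le i<j\le N}(y_j-y_i)}{\prod_{1\le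 i<j\le N+1}(x_j-x_i)}$$ if $Y\prec X$, and $0$ otherwise. For $N>K$, $\Lambda^N_K=\Lambda^N_{N-1}\cdots\Lambda^{K+1}_K$. Coherent systems and boundaries. $\mathcal{M}(\mathbb{G}_N)$ is the set of probability measures on the discrete set $\mathbb{G}_N$, viewed as row vectors. $\varprojlim\mathcal{M}(\mathbb{G}_N)$ is the set of coherent systems, i.e. sequences $\{M_N\in\mathcal{M}(\mathbb{G}_N)\}_{N\ge1}$ with $M_{N+1}\Lambda^{N+1}_N=M_N$ for all $N$; it is a convex set with the Borel structure inherited from $\prod_N\mathcal{M}(\mathbb{G}_N)$. The minimal boundary is the set of extreme points of $\varprojlim\mathcal{M}(\mathbb{G}_N)$. A sequence $\{X(N)\in\mathbb{G}_N\}$ is regular if for every $K$ the measures $\Lambda^N_K(X(N),\cdot)$ converge weakly as $N\to\infty$ to a probability measure $M_K$ on $\mathbb{G}_K$; then $\{M_K\}$ is a coherent system. The Martin boundary is the set of equivalence classes of regular sequences (two being equivalent if they give the same limits $M_K$ for all $K$); it is viewed as a subset of $\varprojlim\mathcal{M}(\mathbb{G}_N)$ by sending a class to the coherent system $\{M_K\}$. The space $\mathbb{G}_\infty$. It is the set of all infinite configurations contained in a bounded segment of $\mathbb{R}$. For a bounded configuration $X$, its variational series $(x_{(1)},x_{(2)},\dots)$ lists its elements in decreasing order of absolute value (positive element first in case of a tie), completed by $0$'s if $X$ is finite. The injective map $X\mapsto(x_{(1)},x_{(2)},\dots)$ embeds $\mathbb{G}_\infty$ in the product $\bar{\mathfrak{L}}\times\bar{\mathfrak{L}}\times\cdots$,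 where $\bar{\mathfrak{L}}=\mathfrak{L}\cup\{0\}$ has the topology induced from $\mathbb{R}$; $\mathbb{G}_\infty$ carries the induced topology, and its natural Borel structure is the one generated by it. Identification of the Martin boundary. A sequence $\{X(N)\in\mathbb{G}_N\}$ stabilizes to $X\in\mathbb{G}_\infty$ if for each $k$ the $k$-th term of the variational series of $X(N)$ equals $x_{(k)}$ for all large $N$. A sequence is regular if and only if it stabilizes to some $X\in\mathbb{G}_\infty$, and this gives a bijection of the Martin boundary onto $\mathbb{G}_\infty$. For $X\in\mathbb{G}_\infty$, $M^{(X)}=\{M^{(X)}_K\}$ denotes the corresponding coherent system: $M^{(X)}_K=\lim_{N\to\infty}\Lambda^N_K(X(N),\cdot)$ for any $\{X(N)\}$ stabilizing to $X$. *)

theory Defs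
  imports "HOL-Probability.Probability"
begin

text \<open>
  Throughout, \<open>q\<close>, \<open>zm\<close>, \<open>zp\<close> are the parameters $q$, $\zeta_-$, $\zeta_+$. A configuration is a
  set of reals; its elements in increasing order $x_1 < \dots < x_N$ are the entries
  \<open>0, \<dots>, N - 1\<close> of \<open>sorted_list_of_set X\<close>.
\<close>

definition qgrid :: "real \<Rightarrow> real \<Rightarrow> real \<Rightarrow> real set" where
  "qgrid q zm zp = range (\<lambda>m::int. zm * q powi m) \<union> range (\<lambda>n::int. zp * q powi n)"

definition confs :: "real \<Rightarrow> real \<Rightarrow> real \<Rightarrow> nat \<Rightarrow> real set set" where
  "confs q zm zp N = {X. X \<subseteq> qgrid q zm zp \<and> finite X \<and> card X = N}"

subsection \<open>Interlacing and the q-links\<close>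

definition qinterval :: "real \<Rightarrow> real \<Rightarrow> real \<Rightarrow> real \<Rightarrow> real \<Rightarrow> real set" where
  "qinterval q zm zp a b =
     (if b < 0 then {a..<b} else if 0 < a then {a<..b} else {a..b}) \<inter> qgrid q zm zp"

definition interlaces :: "real \<Rightarrow> real \<Rightarrow> real \<Rightarrow> real set \<Rightarrow> real set \<Rightarrow> bool" where
  "interlaces q zm zp Y X \<longleftrightarrow>
     (\<forall>i<card Y. sorted_list_of_set Y ! i \<in>
        qinterval q zm zp (sorted_list_of_set X ! i) (sorted_list_of_set X ! Suc i))"

definition vandermonde :: "real set \<Rightarrow> real" where
  "vandermonde X =
     (\<Prod>j<card X. \<Prod>i<j. sorted_list_of_set X ! j - sorted_list_of_set X ! i)"

text \<open>\<open>qlink q zm zp N\<close> is the matrix $\Lambda^{N+1}_N$; it is only meaningful for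
  \<open>X \<in> confs q zm zp (Suc N)\<close> and \<open>Y \<in> confs q zm zp N\<close>.\<close>

definition qlink :: "real \<Rightarrow> real \<Rightarrow> real \<Rightarrow> nat \<Rightarrow> real set \<Rightarrow> real set \<Rightarrow> real" where
  "qlink q zm zp N X Y =
     (if interlaces q zm zp Y X
      then (\<Prod>y\<in>Y. \<bar>y\<bar>) * (\<Prod>i=1..N. 1 - q ^ i) * (vandermonde Y / vandermonde X)
      else 0)"

text \<open>\<open>qlinks q zm zp K N\<close> is $\Lambda^N_K = \Lambda^N_{N-1}\cdots\Lambda^{K+1}_K$ for \<open>N > K\<close>, and the
  identity matrix for \<open>N \<le> K\<close>. The matrix products are infinite sums.\<close>

primrec qlinks :: "real \<Rightarrow> real \<Rightarrow> real \<Rightarrow> nat \<Rightarrow> nat \<Rightarrow> real set \<Rightarrow> real set \<Rightarrow> real" where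
  "qlinks q zm zp K 0 = (\<lambda>X Y. of_bool (X = Y))"
| "qlinks q zm zp K (Suc N) = (\<lambda>X Y.
     if K \<le> N then (\<Sum>\<^sub>\<infinity>Z\<in>confs q zm zp N. qlink q zm zp N X Z * qlinks q zm zp K N Z Y)
     else of_bool (X = Y))"

definition qlinks_row :: "real \<Rightarrow> real \<Rightarrow> real \<Rightarrow> nat \<Rightarrow> nat \<Rightarrow> real set \<Rightarrow> real set measure" where
  "qlinks_row q zm zp K N X = point_measure (confs q zm zp K) (\<lambda>Y. ennreal (qlinks q zm zp K N X Y))"

subsection \<open>Coherent systems and the minimal boundary\<close>

text \<open>The product of the spaces of probability measures on the discrete sets of \<open>N\<close>-element
  configurations, \<open>N \<ge> 1\<close>. The \<open>\<sigma>\<close>-algebra of \<open>prob_algebra\<close> is generated by the maps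
  \<open>\<mu> \<mapsto> \<mu> A\<close>; as the underlying sets are countable and discrete, it is the Borel \<open>\<sigma>\<close>-algebra of
  the weak topology.\<close>

definition prob_systems :: "real \<Rightarrow> real \<Rightarrow> real \<Rightarrow> (nat \<Rightarrow> real set measure) measure" where
  "prob_systems q zm zp = (\<Pi>\<^sub>M N\<in>{1..}. prob_algebra (count_space (confs q zm zp N)))"

definition coherent_systems :: "real \<Rightarrow> real \<Rightarrow> real \<Rightarrow> (nat \<Rightarrow> real set measure) set" where
  "coherent_systems q zm zp =
     {M \<in> space (prob_systems q zm zp). \<forall>N\<ge>1. \<forall>Y\<in>confs q zm zp N.
        (\<Sum>\<^sub>\<infinity>X\<in>confs q zm zp (Suc N). measure (M (Suc N)) {X} * qlink q zm zp N X Y)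
          = measure (M N) {Y}}"

text \<open>Extreme points are spelled out because the type of measures is not a vector space.\<close>

definition minimal_boundary :: "real \<Rightarrow> real \<Rightarrow> real \<Rightarrow> (nat \<Rightarrow> real set measure) set" where
  "minimal_boundary q zm zp =
     {M \<in> coherent_systems q zm zp.
        \<forall>A\<in>coherent_systems q zm zp. \<forall>B\<in>coherent_systems q zm zp. \<forall>t. 0 < t \<and> t < 1 \<and>
          (\<forall>N\<ge>1. \<forall>Y\<in>confs q zm zp N.
             measure (M N) {Y} = (1 - t) * measure (A N) {Y} + t * measure (B N) {Y})
          \<longrightarrow> A = B}"

subsection \<open>The Martin boundary\<close>

text \<open>On a discrete space every function is continuous, so weak convergence is tested on all
  bounded functions.\<close>

definition weak_conv_discrete :: "(nat \<Rightarrow> 'a measure) \<Rightarrow> 'a measure \<Rightarrow> bool" where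
  "weak_conv_discrete \<mu> \<nu> \<longleftrightarrow>
     (\<forall>f :: 'a \<Rightarrow> real. bounded (f ` space \<nu>) \<longrightarrow>
        (\<lambda>N. \<integral>x. f x \<partial>\<mu> N) \<longlonglongrightarrow> (\<integral>x. f x \<partial>\<nu>))"

definition conf_seqs :: "real \<Rightarrow> real \<Rightarrow> real \<Rightarrow> (nat \<Rightarrow> real set) set" where
  "conf_seqs q zm zp = (\<Pi> N\<in>{1..}. confs q zm zp N)"

definition limit_system ::
    "real \<Rightarrow> real \<Rightarrow> real \<Rightarrow> (nat \<Rightarrow> real set) \<Rightarrow> (nat \<Rightarrow> real set measure) \<Rightarrow> bool" where
  "limit_system q zm zp Xs M \<longleftrightarrow> M \<in> space (prob_systems q zm zp) \<and>
     (\<forall>K\<ge>1. weak_conv_discrete (\<lambda>N. qlinks_row q zm zp K N (Xs N)) (M K))"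

definition regular_seqs :: "real \<Rightarrow> real \<Rightarrow> real \<Rightarrow> (nat \<Rightarrow> real set) set" where
  "regular_seqs q zm zp = {Xs \<in> conf_seqs q zm zp. \<exists>M. limit_system q zm zp Xs M}"

definition martin_equiv :: "real \<Rightarrow> real \<Rightarrow> real \<Rightarrow> ((nat \<Rightarrow> real set) \<times> (nat \<Rightarrow> real set)) set" where
  "martin_equiv q zm zp =
     {(Xs, Xs'). Xs \<in> regular_seqs q zm zp \<and> Xs' \<in> regular_seqs q zm zp \<and>
        (\<exists>M. limit_system q zm zp Xs M \<and> limit_system q zm zp Xs' M)}"

definition martin_classes :: "real \<Rightarrow> real \<Rightarrow> real \<Rightarrow> (nat \<Rightarrow> real set) set set" where
  "martin_classes q zm zp = regular_seqs q zm zp // martin_equiv q zm zp"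

definition class_system ::
    "real \<Rightarrow> real \<Rightarrow> real \<Rightarrow> (nat \<Rightarrow> real set) set \<Rightarrow> (nat \<Rightarrow> real set measure)" where
  "class_system q zm zp c = (THE M. \<forall>Xs\<in>c. limit_system q zm zp Xs M)"

definition martin_boundary :: "real \<Rightarrow> real \<Rightarrow> real \<Rightarrow> (nat \<Rightarrow> real set measure) set" where
  "martin_boundary q zm zp = class_system q zm zp ` martin_classes q zm zp"

subsection \<open>The space of infinite bounded configurations\<close>

definition inf_confs :: "real \<Rightarrow> real \<Rightarrow> real \<Rightarrow> real set set" where
  "inf_confs q zm zp = {X. X \<subseteq> qgrid q zm zp \<and> infinite X \<and> bounded X}"

definition precedes :: "real \<Rightarrow> real \<Rightarrow> bool" where
  "precedes x y \<longleftrightarrow> \<bar>y\<bar> < \<bar>x\<bar> \<or> \<bar>x\<bar> = \<bar>y\<bar> \<and> y < x"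

text \<open>Counted from 0: \<open>variational X k\<close> is $x_{(k+1)}$, the element of \<open>X\<close> with exactly \<open>k\<close>
  predecessors. In a bounded configuration every element has finitely many predecessors.\<close>

definition variational :: "real set \<Rightarrow> nat \<Rightarrow> real" where
  "variational X k =
     (if finite X \<and> card X \<le> k then 0
      else THE x. x \<in> X \<and> card {y \<in> X. precedes y x} = k)"

definition inf_confs_topology :: "real \<Rightarrow> real \<Rightarrow> real \<Rightarrow> real set topology" where
  "inf_confs_topology q zm zp =
     pullback_topology (inf_confs q zm zp) variational
       (product_topology (\<lambda>_::nat. top_of_set (insert 0 (qgrid q zm zp))) UNIV)"

definition inf_confs_borel :: "real \<Rightarrow> real \<Rightarrow> real \<Rightarrow> real set measure" where
  "inf_confs_borel q zm zp =
     sigma (inf_confs q zm zp) {U. openin (inf_confs_topology q zm zp) U}"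

definition stabilizes :: "(nat \<Rightarrow> real set) \<Rightarrow> real set \<Rightarrow> bool" where
  "stabilizes Xs X \<longleftrightarrow> (\<forall>k. \<forall>\<^sub>F N in sequentially. variational (Xs N) k = variational X k)"

text \<open>The system $M^{(X)}$. The description is proper for \<open>X \<in> inf_confs q zm zp\<close>: the sequence
  formed by the first \<open>N\<close> elements of the variational series stabilizes to \<open>X\<close>, and all
  sequences stabilizing to \<open>X\<close> have the same limit.\<close>

definition conf_system ::
    "real \<Rightarrow> real \<Rightarrow> real \<Rightarrow> real set \<Rightarrow> (nat \<Rightarrow> real set measure)" where
  "conf_system q zm zp X =
     (THE M. \<forall>Xs\<in>conf_seqs q zm zp. stabilizes Xs X \<longrightarrow> limit_system q zm zp Xs M)"

end

theory Submission
  imports Defs "Jordan_Normal_Form.Determinant"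
begin

text \<open>
  The weights of a link are, up to a constant, the integrand of a determinantal Jackson integral:
  an interlacing configuration is an independent choice of one point in each slot of \<open>X\<close>, and the
  weight \<open>\<bar>y\<bar>\<close> turns the sum of $y^p$ over a slot into a difference of values of a multiple of
  $x^{p+1}$. Expanding alternants by the Leibniz formula shows that a link maps a ratio of an alternant
  and the Vandermonde determinant to a multiple of such a ratio, with exponents shifted by one
  (\<open>moment_has_sum\<close>, \<open>links_moment\<close>). Trivial exponents show that the links are stochastic.

  The second ingredient is an exchange argument. If a point of \<open>Y\<close> does not sit at the outer end of
  its slot, moving it there multiplies the weight by a ratio of products over the other points of \<open>Y\<close>.
  All but boundedly many factors are at least $1 / \rho$, where $\rho = (1 + q) / 2 < 1$. Hence the first \<open>k\<close>
  terms of the variational series survive the descent from any level \<open>N\<close> down to level \<open>M\<close> with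
  probability at least $1 - C \rho^M$, where \<open>C\<close> depends on \<open>k\<close> only (\<open>links_stable\<close>). A cruder version
  prevents the points of \<open>Y\<close> from approaching 0 (\<open>links_large_points\<close>).

  Existence of the limits: if configurations \<open>Z\<close> of growing size stabilize to \<open>X\<close>, the Jacobi--Trudi
  formula expresses the relevant ratios of alternants at \<open>Z\<close> through determinants of fixed size in
  complete homogeneous functions of the points of \<open>Z\<close>, which converge (\<open>moment_tendsto\<close>). Nonzero
  grid points are isolated, so by the Weierstrass theorem indicators of configurations are uniform
  limits of linear combinations of these ratios (\<open>indicator_approx\<close>). Thus the weights of the rows
  converge, and tightness makes the limits \<open>limit_law X\<close> probability weights.

  Identification of the boundary: in \<open>limit_law X\<close> each term of the variational series converges in
  probability to the corresponding term of \<open>X\<close>, and this concentration property determines a coherent family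
  (\<open>concentrates_unique\<close>). Components of a mixture inherit concentration, so the family is
  extreme (\<open>limit_law_extreme\<close>). Conversely, events given by one term of the variational series are
  asymptotically invariant, so conditioning on them decomposes a coherent family. An extreme family
  therefore obeys a zero-one law (\<open>zero_one_law\<close>) and concentrates on some \<open>X\<close>. For the same reason the terms
  of a regular sequence are eventually constant (\<open>regular_stabilizes\<close>). Both boundaries are
  therefore the image of the injective map \<open>X \<mapsto> limit_law X\<close>.

  The Borel structures agree because both are generated by the same sets: fixing finitely many
  terms of the variational series is an open condition on \<open>X\<close>, and the terms can be read off
  from countably many probabilities of the system.
\<close>

section \<open>Alternants and Newton interpolation\<close>

definition alternant :: "nat \<Rightarrow> (nat \<Rightarrow> real) \<Rightarrow> (nat \<Rightarrow> nat) \<Rightarrow> real" where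
  "alternant n x p = Determinant.det (mat n n (\<lambda>(i, j). x i ^ p j))"

text \<open>\<open>hsum x r k\<close> is the complete homogeneous symmetric polynomial $h_r(x_0, \dots, x_k)$.\<close>

primrec hsum :: "(nat \<Rightarrow> real) \<Rightarrow> nat \<Rightarrow> nat \<Rightarrow> real" where
  "hsum x 0 = (\<lambda>k. 1)"
| "hsum x (Suc r) = (\<lambda>k. \<Sum>s\<le>k. x s * hsum x r s)"

text \<open>The divided difference of $t \mapsto t^m$ at the nodes $x_0, \dots, x_k$.\<close>

definition newton :: "(nat \<Rightarrow> real) \<Rightarrow> nat \<Rightarrow> nat \<Rightarrow> real" where
  "newton x m k = (if k \<le> m then hsum x (m - k) k else 0)"

lemma newton_Suc_0: "newton x (Suc m) 0 = x 0 * newton x m 0"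
  by (simp add: newton_def)

lemma newton_Suc_Suc: "newton x (Suc m) (Suc k) = newton x m k + x (Suc k) * newton x m (Suc k)"
proof (cases "k < m")
  case True
  then obtain r where r: "m - k = Suc r" "m - Suc k = r" by (metis Suc_diff_Suc)
  then show ?thesis using True by (simp add: newton_def)
next
  case False
  then show ?thesis by (auto simp add: newton_def)
qed

text \<open>Newton interpolation at the nodes $x_0, \dots, x_{n-1}$ is exact at each node, because the
  remainder contains the factor $\prod_{l<n} (t - x_l)$.\<close>

lemma newton_interpolation:
  assumes "i < n"
  shows "x i ^ m = (\<Sum>k<n. (\<Prod>l<k. x i - x l) * newton x m k)"
proof (induction m)
  case 0
  have "(\<Sum>k<n. (\<Prod>l<k. x i - x l) * newton x 0 k) = (\<Sum>k<n. if k = 0 then 1 else 0)"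
    by (intro sum.cong) (auto simp: newton_def)
  also have "\<dots> = 1" using assms by (subst sum.delta) auto
  finally show ?case by simp
next
  case (Suc m)
  let ?w = "\<lambda>k. \<Prod>l<k. x i - x l"
  obtain n' where n: "n = Suc n'" using assms by (cases n) auto
  have w0: "?w (Suc n') = 0" using assms n by (intro prod_zero) (auto intro!: bexI[of _ i])
  have "(\<Sum>k<n. ?w k * newton x (Suc m) k)
      = ?w 0 * newton x (Suc m) 0 + (\<Sum>k<n'. ?w (Suc k) * newton x (Suc m) (Suc k))"
    unfolding n by (rule sum.lessThan_Suc_shift)
  also have "(\<Sum>k<n'. ?w (Suc k) * newton x (Suc m) (Suc k))
      = (\<Sum>k<n'. ?w (Suc k) * x (Suc k) * newton x m (Suc k)) + (\<Sum>k<n'. ?w (Suc k) * newton x m k)"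
    unfolding newton_Suc_Suc distrib_left sum.distrib by (simp add: mult.assoc)
  also have "?w 0 * newton x (Suc m) 0 + \<dots>
      = (x 0 * newton x m 0 + (\<Sum>k<n'. ?w (Suc k) * x (Suc k) * newton x m (Suc k)))
      + (\<Sum>k<n'. ?w (Suc k) * newton x m k)"
    by (simp add: newton_Suc_0)
  also have "x 0 * newton x m 0 + (\<Sum>k<n'. ?w (Suc k) * x (Suc k) * newton x m (Suc k))
      = (\<Sum>k<n. ?w k * x k * newton x m k)"
    unfolding n by (subst sum.lessThan_Suc_shift) simp
  also have "(\<Sum>k<n'. ?w (Suc k) * newton x m k) = (\<Sum>k<n. ?w (Suc k) * newton x m k)"
    unfolding n using w0 by simp
  also have "(\<Sum>k<n. ?w k * x k * newton x m k) + \<dots> = x i * (\<Sum>k<n. ?w k * newton x m k)"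
    unfolding sum.distrib[symmetric] sum_distrib_left
    by (rule sum.cong) (auto simp: algebra_simps)
  finally show ?case using Suc by simp
qed

lemma prod_list_diag_mat: "prod_list (diag_mat (mat n n f)) = (\<Prod>i<n. f (i, i))"
proof -
  have "prod_list (diag_mat (mat n n f)) = (\<Prod>i = 0..<n. map (\<lambda>i. mat n n f $$ (i, i)) [0..<n] ! i)"
    unfolding diag_mat_def by (subst prod.list_conv_set_nth) simp
  also have "\<dots> = (\<Prod>i<n. f (i, i))"
    unfolding atLeast0LessThan[symmetric] by (rule prod.cong) auto
  finally show ?thesis .
qed

text \<open>Newton interpolation factors the alternant matrix into the triangular matrix of the products
  $\prod_{l<k} (x_i - x_l)$, whose determinant is the Vandermonde product, and a matrix of divided
  differences.\<close>

lemma alternant_newton: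
  "alternant n x p = (\<Prod>j<n. \<Prod>i<j. x j - x i)
     * Determinant.det (mat n n (\<lambda>(k, j). newton x (p j) k))"
proof -
  define W where "W = mat n n (\<lambda>(i, k). \<Prod>l<k. x i - x l)"
  define D where "D = mat n n (\<lambda>(k, j). newton x (p j) k)"
  have W: "W \<in> carrier_mat n n" and D: "D \<in> carrier_mat n n" by (auto simp: W_def D_def)
  have "mat n n (\<lambda>(i, j). x i ^ p j) = W * D"
  proof (rule eq_matI)
    fix i j assume "i < dim_row (W * D)" "j < dim_col (W * D)"
    then have i: "i < n" and j: "j < n" using W D by auto
    have "(W * D) $$ (i, j) = (\<Sum>k = 0..<n. W $$ (i, k) * D $$ (k, j))"
      using i j W D by (simp add: scalar_prod_def)
    also have "\<dots> = (\<Sum>k<n. (\<Prod>l<k. x i - x l) * newton x (p j) k)"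
      using i j by (intro sum.cong) (auto simp: W_def D_def)
    finally show "mat n n (\<lambda>(i, j). x i ^ p j) $$ (i, j) = (W * D) $$ (i, j)"
      using newton_interpolation[OF i, of x "p j"] i j by simp
  qed (use W D in auto)
  then have "alternant n x p = Determinant.det W * Determinant.det D"
    unfolding alternant_def using det_mult[OF W D] by simp
  also have "Determinant.det W = prod_list (diag_mat W)"
    by (rule det_lower_triangular[OF _ W]) (auto simp: W_def)
  also have "\<dots> = (\<Prod>j<n. \<Prod>i<j. x j - x i)"
    by (simp add: W_def prod_list_diag_mat)
  finally show ?thesis unfolding D_def .
qed

lemma alternant_id: "alternant n x (\<lambda>j. j) = (\<Prod>j<n. \<Prod>i<j. x j - x i)"
proof -
  let ?D = "mat n n (\<lambda>(k, j). newton x j k)"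
  have "Determinant.det ?D = prod_list (diag_mat ?D)"
    by (rule det_upper_triangular) (auto simp: upper_triangular_def newton_def)
  also have "\<dots> = 1"
    by (simp add: prod_list_diag_mat newton_def)
  finally show ?thesis by (simp add: alternant_newton)
qed

lemma alternant_permute:
  assumes "s permutes {0..<n}"
  shows "alternant n (\<lambda>i. x (s i)) p = of_int (sign s) * alternant n x p"
proof -
  have "mat n n (\<lambda>(i, j). x (s i) ^ p j)
      = mat n n (\<lambda>(i, j). mat n n (\<lambda>(i, j). x i ^ p j) $$ (s i, j))"
    using permutes_in_image[OF assms] by (intro eq_matI) auto
  then show ?thesis
    unfolding alternant_def using det_permute_rows[OF _ assms, of "mat n n (\<lambda>(i, j). x i ^ p j)"]
    by simp
qed

text \<open>Two enumerations of the same set differ by a permutation; its sign is the factor \<open>e\<close>, the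
  same for all exponent sequences.\<close>

lemma alternant_reorder:
  assumes "bij_betw x {..<n} X" "bij_betw z {..<n} X"
  obtains e where "\<bar>e\<bar> = 1" "\<And>p. alternant n z p = e * alternant n x p"
proof -
  define s where "s = (\<lambda>i. if i < n then the_inv_into {..<n} x (z i) else i)"
  have "bij_betw (the_inv_into {..<n} x \<circ> z) {..<n} {..<n}"
    using bij_betw_trans[OF assms(2) bij_betw_the_inv_into[OF assms(1)]] .
  moreover have "bij_betw s {..<n} {..<n}
      = bij_betw (the_inv_into {..<n} x \<circ> z) {..<n} {..<n}"
    by (rule bij_betw_cong) (auto simp: s_def)
  ultimately have "bij_betw s {..<n} {..<n}" by simp
  then have perm: "s permutes {0..<n}"
    unfolding atLeast0LessThan by (rule bij_imp_permutes) (auto simp: s_def)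
  have zx: "z i = x (s i)" if "i < n" for i
  proof -
    have "z i \<in> X" using that assms(2) by (auto simp: bij_betw_def)
    then show ?thesis using f_the_inv_into_f_bij_betw[OF assms(1)] that by (simp add: s_def)
  qed
  have eq: "alternant n z p' = of_int (sign s) * alternant n x p'" for p'
  proof -
    have "alternant n z p' = alternant n (\<lambda>i. x (s i)) p'"
      unfolding alternant_def
      by (rule arg_cong[of _ _ Determinant.det], rule eq_matI) (auto simp: zx)
    then show ?thesis using alternant_permute[OF perm] by simp
  qed
  have "\<bar>of_int (sign s) :: real\<bar> = 1" by (auto simp: sign_def)
  then show thesis using eq that by blast
qed

text \<open>Permuting the variables multiplies numerator and denominator by the same sign, so the
  quotient of two alternants depends on the set of the variables only.\<close>

lemma alternant_ratio_cong:
  assumes "bij_betw x {..<n} X" "bij_betw z {..<n} X"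
  shows "alternant n x p / alternant n x r = alternant n z p / alternant n z r"
proof -
  obtain e where e: "\<bar>e\<bar> = 1" "\<And>p. alternant n z p = e * alternant n x p"
    using alternant_reorder[OF assms] by blast
  have "e \<noteq> 0" using e(1) by auto
  then show ?thesis unfolding e(2) by simp
qed

text \<open>\<open>pad m p\<close> is the exponent sequence $0, 1, \dots, m - 1, m + p_0, m + p_1, \dots$\<close>

definition pad :: "nat \<Rightarrow> (nat \<Rightarrow> nat) \<Rightarrow> nat \<Rightarrow> nat" where
  "pad m p j = (if j < m then j else m + p (j - m))"

lemma pad_id: "pad m (\<lambda>j. j) = (\<lambda>j. j)"
  by (auto simp: pad_def fun_eq_iff)

text \<open>After Newton interpolation the first \<open>m\<close> columns of the alternant with padded exponents are
  those of a unitriangular matrix. What remains is a determinant whose size does not grow with the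
  number of variables; this is the Jacobi--Trudi formula.\<close>

lemma alternant_pad:
  "alternant (m + K) x (pad m p) = (\<Prod>j<m + K. \<Prod>i<j. x j - x i)
     * Determinant.det (mat K K (\<lambda>(i, j). newton x (m + p j) (m + i)))"
proof -
  let ?A = "mat m m (\<lambda>(k, j). newton x j k)"
  let ?B = "mat m K (\<lambda>(k, j). newton x (m + p j) k)"
  let ?D = "mat K K (\<lambda>(i, j). newton x (m + p j) (m + i))"
  have block: "mat (m + K) (m + K) (\<lambda>(k, j). newton x (pad m p j) k)
      = four_block_mat ?A ?B (0\<^sub>m K m) ?D"
    by (rule eq_matI) (auto simp: pad_def newton_def)
  have "Determinant.det (four_block_mat ?A ?B (0\<^sub>m K m) ?D)
      = Determinant.det ?A * Determinant.det ?D"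
    by (rule det_four_block_mat_lower_left_zero) auto
  moreover have "Determinant.det ?A = prod_list (diag_mat ?A)"
    by (rule det_upper_triangular) (auto simp: upper_triangular_def newton_def)
  moreover have "prod_list (diag_mat ?A) = 1"
    by (simp add: prod_list_diag_mat newton_def)
  ultimately show ?thesis by (simp only: alternant_newton block mult_1)
qed

text \<open>Passing to differences of consecutive rows removes a column of ones.\<close>

lemma det_differences:
  fixes F :: "nat \<Rightarrow> nat \<Rightarrow> real"
  shows "Determinant.det (mat N N (\<lambda>(i, j). F j (Suc i) - F j i))
    = Determinant.det (mat (Suc N) (Suc N) (\<lambda>(i, j). if j = 0 then 1 else F (j - 1) i))"
proof -
  define D where "D = mat (Suc N) (Suc N)
    (\<lambda>(i, k). if k = i then 1 else if Suc k = i then - 1 else (0 :: real))"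
  define B where "B = mat (Suc N) (Suc N) (\<lambda>(i, j). if j = 0 then 1 else F (j - 1) i)"
  have D: "D \<in> carrier_mat (Suc N) (Suc N)" and B: "B \<in> carrier_mat (Suc N) (Suc N)"
    by (auto simp: D_def B_def)
  let ?E = "mat N N (\<lambda>(i, j). F j (Suc i) - F j i)"
  have DB: "(D * B) $$ (i, j) = (if i = 0 then B $$ (0, j) else B $$ (i, j) - B $$ (i - 1, j))"
    if i: "i < Suc N" and j: "j < Suc N" for i j
  proof -
    have "(D * B) $$ (i, j) = (\<Sum>k = 0..<Suc N. D $$ (i, k) * B $$ (k, j))"
      using i j D B by (simp add: scalar_prod_def)
    also have "\<dots> = (\<Sum>k = 0..<Suc N. (if k = i then B $$ (k, j) else 0)
        + (if Suc k = i then - B $$ (k, j) else 0))"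
      using i j by (intro sum.cong) (auto simp: D_def)
    also have "\<dots> = B $$ (i, j) + (\<Sum>k = 0..<Suc N. if Suc k = i then - B $$ (k, j) else 0)"
      using i by (simp add: sum.distrib)
    also have "(\<Sum>k = 0..<Suc N. if Suc k = i then - B $$ (k, j) else 0)
        = (if i = 0 then 0 else - B $$ (i - 1, j))"
    proof (cases i)
      case (Suc i')
      then show ?thesis using i by simp
    qed simp
    finally show ?thesis by auto
  qed
  have "D * B = four_block_mat (1\<^sub>m 1) (mat 1 N (\<lambda>(i, j). F j 0)) (0\<^sub>m N 1) ?E"
  proof (rule eq_matI)
    fix i j assume "i < dim_row (four_block_mat (1\<^sub>m 1) (mat 1 N (\<lambda>(i, j). F j 0)) (0\<^sub>m N 1) ?E)"
      "j < dim_col (four_block_mat (1\<^sub>m 1) (mat 1 N (\<lambda>(i, j). F j 0)) (0\<^sub>m N 1) ?E)"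
    then have "i < Suc N" "j < Suc N" by auto
    then show "(D * B) $$ (i, j)
        = four_block_mat (1\<^sub>m 1) (mat 1 N (\<lambda>(i, j). F j 0)) (0\<^sub>m N 1) ?E $$ (i, j)"
      unfolding DB[OF \<open>i < Suc N\<close> \<open>j < Suc N\<close>] by (cases i; cases j) (auto simp: B_def)
  qed (use D B in auto)
  then have "Determinant.det (D * B) = Determinant.det (four_block_mat (1\<^sub>m 1)
      (mat 1 N (\<lambda>(i, j). F j 0)) (0\<^sub>m N 1) ?E)" by (rule arg_cong)
  also have "\<dots> = Determinant.det (1\<^sub>m 1 :: real mat) * Determinant.det ?E"
    by (rule det_four_block_mat_lower_left_zero_col) auto
  finally have "Determinant.det (D * B) = Determinant.det ?E" by simp
  moreover have "Determinant.det D = prod_list (diag_mat D)"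
    by (rule det_lower_triangular[OF _ D]) (auto simp: D_def)
  moreover have "prod_list (diag_mat D) = 1"
    by (simp add: prod_list_diag_mat D_def)
  ultimately show ?thesis using det_mult[OF D B] by (simp add: B_def)
qed

lemma det_scale_columns:
  fixes a :: "nat \<Rightarrow> nat \<Rightarrow> real"
  shows "Determinant.det (mat n n (\<lambda>(i, j). a i j * d j))
    = Determinant.det (mat n n (\<lambda>(i, j). a i j)) * (\<Prod>j<n. d j)"
proof -
  let ?D = "mat n n (\<lambda>(i, j). if i = j then d j else 0)"
  have "mat n n (\<lambda>(i, j). a i j * d j) = mat n n (\<lambda>(i, j). a i j) * ?D"
  proof (rule eq_matI)
    fix i j assume "i < dim_row (mat n n (\<lambda>(i, j). a i j) * ?D)"
      "j < dim_col (mat n n (\<lambda>(i, j). a i j) * ?D)"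
    then have i: "i < n" and j: "j < n" by auto
    have "(mat n n (\<lambda>(i, j). a i j) * ?D) $$ (i, j)
        = (\<Sum>k = 0..<n. a i k * (if k = j then d j else 0))"
      using i j by (simp add: scalar_prod_def)
    also have "\<dots> = (\<Sum>k = 0..<n. if k = j then a i j * d j else 0)"
      by (rule sum.cong) auto
    also have "\<dots> = a i j * d j" using j by simp
    finally show "mat n n (\<lambda>(i, j). a i j * d j) $$ (i, j)
        = (mat n n (\<lambda>(i, j). a i j) * ?D) $$ (i, j)"
      using i j by simp
  qed auto
  moreover have "Determinant.det ?D = prod_list (diag_mat ?D)"
    by (rule det_lower_triangular[of n]) auto
  moreover have "prod_list (diag_mat ?D) = (\<Prod>j<n. d j)"
    by (simp add: prod_list_diag_mat)
  ultimately show ?thesis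
    using det_mult[of "mat n n (\<lambda>(i, j). a i j)" n ?D] by simp
qed

lemma det_leibniz:
  "Determinant.det (mat n n (\<lambda>(i, j). a i j :: real))
    = (\<Sum>s | s permutes {0..<n}. of_int (sign s) * (\<Prod>i<n. a i (s i)))"
proof -
  have "(\<Prod>i = 0..<n. mat n n (\<lambda>(i, j). a i j) $$ (i, s i)) = (\<Prod>i<n. a i (s i))"
    if "s permutes {0..<n}" for s
    unfolding atLeast0LessThan[symmetric]
    using permutes_in_image[OF that] by (intro prod.cong) auto
  then show ?thesis by (subst det_def'[of _ n]) auto
qed

section \<open>The geometry of the two-sided grid\<close>

locale qlattice =
  fixes q zm zp :: real
  assumes q0: "0 < q" and q1: "q < 1" and zm: "zm < 0" and zp: "0 < zp"
begin

abbreviation "L \<equiv> qgrid q zm zp"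
abbreviation "G \<equiv> confs q zm zp"

lemma L_nz: "x \<in> L \<Longrightarrow> x \<noteq> 0"
  using q0 zm zp by (auto simp: qgrid_def)

lemma countable_L: "countable L"
  by (auto simp: qgrid_def)

lemma same_sign_cases:
  assumes "x \<in> L" "y \<in> L" "sgn x = sgn y"
  obtains k where "x = y * q ^ k" | k where "y = x * q ^ k"
proof -
  have qp: "0 < q powi m" for m using q0 by simp
  have sg: "sgn (z * q powi m) = sgn z" for z m using qp[of m] by (simp only: sgn_mult sgn_pos mult_1_right)
  obtain z m n where xy: "x = z * q powi m" "y = z * q powi n"
    using assms zm zp by (auto simp: qgrid_def sg)
  have add: "q powi (a + int k) = q powi a * q ^ k" for a k
    using q0 by (simp add: power_int_add)
  show thesis
  proof (cases "m \<ge> n")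
    case True
    then obtain k where "m = n + int k" using zle_iff_zadd by auto
    then show thesis using that(1)[of k] xy add[of n k] by simp
  next
    case False
    then obtain k where "n = m + int k" using zle_iff_zadd[of m n] by auto
    then show thesis using that(2)[of k] xy add[of m k] by simp
  qed
qed

lemma q_mult_L: "x \<in> L \<Longrightarrow> x * q ^ k \<in> L"
proof -
  have add: "q powi (a + int k) = q powi a * q ^ k" for a
    using q0 by (simp add: power_int_add)
  assume "x \<in> L"
  then consider m where "x = zm * q powi m" | n where "x = zp * q powi n"
    by (auto simp: qgrid_def)
  then show ?thesis
  proof cases
    case 1
    then have "x * q ^ k = zm * q powi (m + int k)" using add by simp
    then show ?thesis by (auto simp: qgrid_def)
  next
    case 2
    then have "x * q ^ k = zp * q powi (n + int k)" using add by simp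
    then show ?thesis by (auto simp: qgrid_def)
  qed
qed

text \<open>Points of one sign form a geometric progression, so neighbours differ by the factor \<open>q\<close>.\<close>

lemma L_gap:
  assumes "x \<in> L" "y \<in> L" "sgn x = sgn y" "\<bar>x\<bar> < \<bar>y\<bar>"
  shows "\<bar>x\<bar> \<le> q * \<bar>y\<bar>"
proof -
  have pl: "q ^ k \<le> 1" for k using q0 q1 by (simp add: power_le_one)
  from assms(1-3) show ?thesis
  proof (cases rule: same_sign_cases)
    case (1 k)
    then obtain k' where "k = Suc k'" using assms(4) by (cases k) auto
    then have "\<bar>x\<bar> = q * \<bar>y\<bar> * q ^ k'" using 1 q0 by (simp add: abs_mult)
    then show ?thesis using pl[of k'] q0 by (simp add: mult_left_le)
  next
    case (2 k)
    then have "\<bar>y\<bar> = \<bar>x\<bar> * q ^ k" using q0 by (simp add: abs_mult)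
    then show ?thesis using pl[of k] assms(4) mult_left_le[of "q ^ k" "\<bar>x\<bar>"] by simp
  qed
qed

lemma sgn_L: "x \<in> L \<Longrightarrow> sgn x = 1 \<or> sgn x = - 1"
  using L_nz by (auto simp: sgn_if)

text \<open>The grid is sparse relative to the size of its points: the worst case are neighbours of the same
  sign.\<close>

lemma L_dist:
  assumes "x \<in> L" "y \<in> L" "x \<noteq> y"
  shows "(1 - q) * \<bar>y\<bar> \<le> \<bar>x - y\<bar>"
proof (cases "sgn x = sgn y")
  case False
  then have "\<bar>x - y\<bar> = \<bar>x\<bar> + \<bar>y\<bar>"
    using sgn_L[OF assms(1)] sgn_L[OF assms(2)] by (auto simp: sgn_if split: if_splits)
  moreover have "(1 - q) * \<bar>y\<bar> \<le> 1 * \<bar>y\<bar>" using q0 by (intro mult_right_mono) auto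
  ultimately show ?thesis by simp
next
  case True
  have ne: "\<bar>x\<bar> \<noteq> \<bar>y\<bar>" and d: "\<bar>x - y\<bar> = \<bar>\<bar>x\<bar> - \<bar>y\<bar>\<bar>"
    using True assms(3) sgn_L[OF assms(1)] by (auto simp: sgn_if split: if_splits)
  consider "\<bar>x\<bar> < \<bar>y\<bar>" | "\<bar>y\<bar> < \<bar>x\<bar>" using ne by linarith
  then show ?thesis
  proof cases
    case 1
    then show ?thesis using L_gap[OF assms(1,2) True 1] d by (simp add: algebra_simps)
  next
    case 2
    then have "(1 - q) * \<bar>y\<bar> \<le> (1 - q) * \<bar>x\<bar>" using q1 by (intro mult_left_mono) auto
    moreover have "\<bar>x - y\<bar> = \<bar>x\<bar> - \<bar>y\<bar>" using d 2 by simp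
    ultimately show ?thesis
      using L_gap[OF assms(2,1) True[symmetric] 2] by (simp add: algebra_simps)
  qed
qed

subsection \<open>Sums over the grid\<close>

text \<open>The part of the grid between 0 and \<open>x\<close>, a geometric progression. The intervals that define
  interlacing are differences or unions of two such sets.\<close>

definition tail :: "real \<Rightarrow> real set" where
  "tail x = {y \<in> L. sgn y = sgn x \<and> \<bar>y\<bar> \<le> \<bar>x\<bar>}"

lemma tail_eq:
  assumes "x \<in> L"
  shows "tail x = range (\<lambda>k. x * q ^ k)"
proof (intro equalityI subsetI)
  fix y assume "y \<in> tail x"
  then have y: "y \<in> L" "sgn y = sgn x" "\<bar>y\<bar> \<le> \<bar>x\<bar>" by (auto simp: tail_def)
  from y(1) assms y(2) show "y \<in> range (\<lambda>k. x * q ^ k)"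
  proof (cases rule: same_sign_cases)
    case (2 k)
    have "\<bar>x\<bar> = \<bar>y\<bar> * q ^ k" using 2 q0 by (simp add: abs_mult)
    moreover have "\<bar>y\<bar> * q ^ k \<le> \<bar>y\<bar>" using q0 q1 by (intro mult_left_le) (auto simp: power_le_one)
    ultimately have "\<bar>x\<bar> = \<bar>y\<bar>" using y(3) by linarith
    then have "x = y" using y(2) L_nz[OF assms] by (auto simp: sgn_if split: if_splits)
    then show ?thesis by (auto intro!: image_eqI[of _ _ 0])
  qed auto
next
  fix y assume "y \<in> range (\<lambda>k. x * q ^ k)"
  then obtain k where k: "y = x * q ^ k" by auto
  have "0 < q ^ k" "q ^ k \<le> 1" using q0 q1 by (auto simp: power_le_one)
  then show "y \<in> tail x"
    using q_mult_L[OF assms, of k] k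
    unfolding tail_def mem_Collect_eq k sgn_mult sgn_pos[OF \<open>0 < q ^ k\<close>]
    by (auto simp: abs_mult intro!: mult_left_le)
qed

lemma tail_inj: "x \<in> L \<Longrightarrow> inj (\<lambda>k. x * q ^ k)"
  using q0 q1 L_nz by (auto intro!: injI simp: power_inject_exp')

lemma tail_has_sum:
  assumes "x \<in> L"
  shows "((\<lambda>y. y ^ Suc n) has_sum (x ^ Suc n / (1 - q ^ Suc n))) (tail x)"
    and "(\<lambda>y. norm (y ^ Suc n)) summable_on tail x"
proof -
  have qn: "0 < q ^ Suc n" "q ^ Suc n < 1"
    using q0 q1 by (auto simp del: power_Suc simp: power_Suc_less_one)
  have "((\<lambda>k. (q ^ Suc n) ^ k) has_sum (1 / (1 - q ^ Suc n))) UNIV"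
    using qn by (intro sums_nonneg_imp_has_sum geometric_sums) auto
  then have "((\<lambda>k. x ^ Suc n * (q ^ Suc n) ^ k) has_sum (x ^ Suc n * (1 / (1 - q ^ Suc n)))) UNIV"
    by (rule has_sum_cmult_right)
  moreover have "(\<lambda>k. x ^ Suc n * (q ^ Suc n) ^ k) = (\<lambda>k. (x * q ^ k) ^ Suc n)"
    by (simp only: power_mult_distrib power_mult[symmetric] mult.commute[of "Suc n"])
  ultimately have hs: "((\<lambda>k. (x * q ^ k) ^ Suc n) has_sum (x ^ Suc n / (1 - q ^ Suc n))) UNIV"
    by (simp only: times_divide_eq_right mult_1_right)
  then show "((\<lambda>y. y ^ Suc n) has_sum (x ^ Suc n / (1 - q ^ Suc n))) (tail x)"
    unfolding tail_eq[OF assms]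
    by (subst has_sum_reindex[OF tail_inj[OF assms]]) (simp add: o_def)
  then have "(\<lambda>y. y ^ Suc n) summable_on tail x" by (rule has_sum_imp_summable)
  then show "(\<lambda>y. norm (y ^ Suc n)) summable_on tail x"
    by (rule summable_on_iff_abs_summable_on_real[THEN iffD1])
qed

lemma finite_sum_tail:
  assumes "finite F" "F \<subseteq> L" "\<And>s. s \<in> F \<Longrightarrow> sgn s = e" "\<And>s. s \<in> F \<Longrightarrow> \<bar>s\<bar> \<le> r" "0 \<le> r"
  shows "(\<Sum>s\<in>F. \<bar>s\<bar>) \<le> r / (1 - q)"
proof (cases "F = {}")
  case True
  then show ?thesis using assms(5) q1 by simp
next
  case False
  have "Max (abs ` F) \<in> abs ` F" using assms(1) False by (intro Max_in) auto
  then obtain b where bF: "b \<in> F" and bM: "Max (abs ` F) = \<bar>b\<bar>" by auto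
  have bmax: "\<bar>s\<bar> \<le> \<bar>b\<bar>" if "s \<in> F" for s
    unfolding bM[symmetric] using assms(1) that by (intro Max_ge) auto
  note b = bF bmax
  have bL: "b \<in> L" using b(1) assms(2) by auto
  have sub: "F \<subseteq> tail b" using assms(2,3) b by (auto simp: tail_def)
  have "(\<Sum>s\<in>F. \<bar>s\<bar>) \<le> (\<Sum>\<^sub>\<infinity>s\<in>tail b. \<bar>s\<bar>)"
    using tail_has_sum(2)[OF bL, of 0] assms(1) sub by (intro finite_sum_le_infsum) auto
  also have "\<dots> = \<bar>b\<bar> / (1 - q)"
  proof -
    have e: "\<bar>s\<bar> = sgn b * s" if "s \<in> tail b" for s
      using that by (auto simp: tail_def abs_sgn mult.commute)
    have "(\<Sum>\<^sub>\<infinity>s\<in>tail b. \<bar>s\<bar>) = (\<Sum>\<^sub>\<infinity>s\<in>tail b. sgn b * s)"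
      by (rule infsum_cong) (rule e)
    also have "\<dots> = sgn b * (b / (1 - q))"
      using has_sum_cmult_right[OF tail_has_sum(1)[OF bL, of 0], of "sgn b"]
      by (intro infsumI) simp
    finally show ?thesis by (simp add: abs_sgn mult.commute)
  qed
  also have "\<dots> \<le> r / (1 - q)" using assms(4)[OF b(1)] q1 by (intro divide_right_mono) auto
  finally show ?thesis .
qed

text \<open>Each of the two sides of the grid is contained in a geometric progression that starts at most at
  \<open>r\<close>. The bound controls the sums over tails of a variational series.\<close>

lemma finite_sum_L:
  assumes "finite F" "F \<subseteq> L" "\<And>s. s \<in> F \<Longrightarrow> \<bar>s\<bar> \<le> r" "0 \<le> r"
  shows "(\<Sum>s\<in>F. \<bar>s\<bar>) \<le> 2 * r / (1 - q)"
proof -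
  let ?P = "{s \<in> F. sgn s = 1}" and ?N = "{s \<in> F. sgn s = - 1}"
  have F: "F = ?P \<union> ?N" using assms(2) sgn_L by auto
  have "(\<Sum>s\<in>F. \<bar>s\<bar>) = (\<Sum>s\<in>?P. \<bar>s\<bar>) + (\<Sum>s\<in>?N. \<bar>s\<bar>)"
    by (subst F, rule sum.union_disjoint) (use assms(1) in auto)
  moreover have "(\<Sum>s\<in>?P. \<bar>s\<bar>) \<le> r / (1 - q)"
    by (rule finite_sum_tail[where e = 1]) (use assms in auto)
  moreover have "(\<Sum>s\<in>?N. \<bar>s\<bar>) \<le> r / (1 - q)"
    by (rule finite_sum_tail[where e = "- 1"]) (use assms in auto)
  ultimately show ?thesis by simp
qed

lemma finite_annulus:
  assumes "0 < d"
  shows "finite {y \<in> L. d \<le> \<bar>y\<bar> \<and> \<bar>y\<bar> \<le> R}"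
proof (cases "0 \<le> R")
  case True
  let ?A = "{y \<in> L. d \<le> \<bar>y\<bar> \<and> \<bar>y\<bar> \<le> R}"
  show ?thesis
  proof (rule ccontr)
    assume "infinite ?A"
    define c where "c = 2 * R / (1 - q)"
    obtain F where F: "finite F \<and> card F = Suc (nat \<lceil>c / d\<rceil>) \<and> F \<subseteq> ?A"
      using infinite_arbitrarily_large[OF \<open>infinite ?A\<close>] by blast
    have "c / d < real (card F)" using F real_nat_ceiling_ge[of "c / d"] by simp
    then have "2 * R / (1 - q) < (\<Sum>s\<in>F. d)"
      using assms unfolding c_def[symmetric] by (simp add: divide_less_eq)
    also have "\<dots> \<le> (\<Sum>s\<in>F. \<bar>s\<bar>)" using F by (intro sum_mono) auto
    also have "\<dots> \<le> 2 * R / (1 - q)" using F True by (intro finite_sum_L) auto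
    finally show False by simp
  qed
next
  case False
  then have "{y \<in> L. d \<le> \<bar>y\<bar> \<and> \<bar>y\<bar> \<le> R} = {}" using assms by force
  then show ?thesis by (simp only: finite.emptyI)
qed

lemma countable_G: "countable (G N)"
proof -
  have "G N \<subseteq> {X. X \<subseteq> L \<and> finite X}" by (auto simp: confs_def)
  moreover have "countable {X. X \<subseteq> L \<and> finite X}"
    using countable_Collect_finite_subset[OF countable_L] by (simp add: conj_commute)
  ultimately show ?thesis by (rule countable_subset)
qed

lemma confsD: "X \<in> G N \<Longrightarrow> X \<subseteq> L" "X \<in> G N \<Longrightarrow> finite X" "X \<in> G N \<Longrightarrow> card X = N"
  by (auto simp: confs_def)

section \<open>Interlacing and slots\<close>

abbreviation nth_el :: "real set \<Rightarrow> nat \<Rightarrow> real" where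
  "nth_el X i \<equiv> sorted_list_of_set X ! i"

lemma nth_el_in: "X \<in> G N \<Longrightarrow> i < N \<Longrightarrow> nth_el X i \<in> X"
  using confsD nth_mem[of i "sorted_list_of_set X"] by auto

lemma nth_el_less: "X \<in> G N \<Longrightarrow> i < j \<Longrightarrow> j < N \<Longrightarrow> nth_el X i < nth_el X j"
  using confsD[of X N] strict_sorted_list_of_set[of X] sorted_wrt_nth_less[of "(<)" "sorted_list_of_set X"]
  by auto

lemma nth_el_bij: "X \<in> G N \<Longrightarrow> bij_betw (nth_el X) {..<N} X"
  using bij_betw_nth[of "sorted_list_of_set X" "{..<N}" X] confsD[of X N] by auto

text \<open>The set of positions that interlacing allows for the \<open>i\<close>-th point.\<close>

definition slot :: "real set \<Rightarrow> nat \<Rightarrow> real set" where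
  "slot X i = qinterval q zm zp (nth_el X i) (nth_el X (Suc i))"

lemma slot_L: "slot X i \<subseteq> L"
  by (auto simp: slot_def qinterval_def)

lemma slot_bounds: "s \<in> slot X i \<Longrightarrow> nth_el X i \<le> s \<and> s \<le> nth_el X (Suc i)"
  by (auto simp: slot_def qinterval_def split: if_splits)

lemma slot_less:
  assumes X: "X \<in> G (Suc N)" and ij: "i < j" "j < N" and s: "s \<in> slot X i" and t: "t \<in> slot X j"
  shows "s < t"
proof -
  let ?x = "nth_el X"
  have le: "?x (Suc i) \<le> ?x j"
    using nth_el_less[OF X, of "Suc i" j] ij by (cases "Suc i = j") auto
  have "?x (Suc i) \<in> L" using nth_el_in[OF X, of "Suc i"] ij confsD(1)[OF X] by auto
  then have nz: "?x (Suc i) \<noteq> 0" using L_nz by auto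
  show ?thesis
    using s t le nz slot_bounds[OF s] slot_bounds[OF t]
    by (auto simp: slot_def qinterval_def split: if_splits)
qed

lemma tuple_mono:
  assumes "X \<in> G (Suc N)" "y \<in> PiE {..<N} (slot X)" "i < j" "j < N"
  shows "y i < y j"
  using slot_less[OF assms(1,3,4)] assms by (auto simp: PiE_iff)

lemma tuple_inj: "X \<in> G (Suc N) \<Longrightarrow> y \<in> PiE {..<N} (slot X) \<Longrightarrow> inj_on y {..<N}"
proof (rule inj_onI)
  fix i j assume *: "X \<in> G (Suc N)" "y \<in> PiE {..<N} (slot X)" "i \<in> {..<N}" "j \<in> {..<N}" "y i = y j"
  show "i = j"
    using tuple_mono[OF *(1,2), of i j] tuple_mono[OF *(1,2), of j i] *(3-5)
    by (cases i j rule: linorder_cases) auto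
qed

lemma tuple_G: "X \<in> G (Suc N) \<Longrightarrow> y \<in> PiE {..<N} (slot X) \<Longrightarrow> y ` {..<N} \<in> G N"
  using tuple_inj slot_L PiE_mem[of y "{..<N}" "slot X"]
  by (auto simp: confs_def card_image simp del: PiE_iff intro: subsetD[OF slot_L])

lemma tuple_sorted:
  assumes "X \<in> G (Suc N)" "y \<in> PiE {..<N} (slot X)"
  shows "sorted_list_of_set (y ` {..<N}) = map y [0..<N]"
proof -
  have "sorted_wrt (<) (map y [0..<N])"
    unfolding sorted_wrt_iff_nth_less using tuple_mono[OF assms] by auto
  then have "sorted_list_of_set (set (map y [0..<N])) = map y [0..<N]"
    by (intro sorted_list_of_set.idem_if_sorted_distinct) (auto simp: strict_sorted_iff)
  then show ?thesis by (simp add: atLeast0LessThan)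
qed

text \<open>Consecutive slots are disjoint and ordered, so a configuration interlacing \<open>X\<close> is the same
  as an independent choice of one point in each slot.\<close>

lemma tuple_bij:
  assumes X: "X \<in> G (Suc N)"
  shows "bij_betw (\<lambda>y. y ` {..<N}) (PiE {..<N} (slot X)) {Y \<in> G N. interlaces q zm zp Y X}"
proof (rule bij_betw_byWitness[where f' = "\<lambda>Y. restrict (nth_el Y) {..<N}"])
  show "\<forall>y\<in>PiE {..<N} (slot X). restrict (nth_el (y ` {..<N})) {..<N} = y"
  proof
    fix y assume y: "y \<in> PiE {..<N} (slot X)"
    show "restrict (nth_el (y ` {..<N})) {..<N} = y"
      using y by (auto simp: tuple_sorted[OF X y] fun_eq_iff PiE_iff extensional_def)
  qed
  show "\<forall>Y\<in>{Y \<in> G N. interlaces q zm zp Y X}. restrict (nth_el Y) {..<N} ` {..<N} = Y"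
    using nth_el_bij by (auto simp: bij_betw_def)
  show "(\<lambda>y. y ` {..<N}) ` PiE {..<N} (slot X) \<subseteq> {Y \<in> G N. interlaces q zm zp Y X}"
  proof (rule image_subsetI)
    fix y assume y: "y \<in> PiE {..<N} (slot X)"
    have "interlaces q zm zp (y ` {..<N}) X"
      using y confsD(3)[OF tuple_G[OF X y]]
      by (auto simp: interlaces_def tuple_sorted[OF X y] slot_def PiE_iff)
    then show "y ` {..<N} \<in> {Y \<in> G N. interlaces q zm zp Y X}" using tuple_G[OF X y] by simp
  qed
  show "(\<lambda>Y. restrict (nth_el Y) {..<N}) ` {Y \<in> G N. interlaces q zm zp Y X}
      \<subseteq> PiE {..<N} (slot X)"
  proof (rule image_subsetI)
    fix Y assume "Y \<in> {Y \<in> G N. interlaces q zm zp Y X}"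
    then show "restrict (nth_el Y) {..<N} \<in> PiE {..<N} (slot X)"
      using confsD(3)[of Y N] by (intro restrict_PiE[THEN iffD2]) (auto simp: interlaces_def slot_def)
  qed
qed

subsection \<open>Sums over a slot\<close>

text \<open>A telescoping geometric series. The half-open convention for slots on one side of 0 makes a
  slot the difference of two tails; a slot that contains 0 in its interior is their union, with the
  weight \<open>\<bar>y\<bar>\<close> supplying the sign.\<close>

lemma slot_has_sum:
  assumes X: "X \<in> G (Suc N)" and i: "i < N"
  shows "((\<lambda>y. \<bar>y\<bar> * y ^ n) has_sum
      ((nth_el X (Suc i) ^ Suc n - nth_el X i ^ Suc n) / (1 - q ^ Suc n))) (slot X i)"
    and "(\<lambda>y. norm (\<bar>y\<bar> * y ^ n)) summable_on slot X i"
proof -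
  let ?a = "nth_el X i" and ?b = "nth_el X (Suc i)"
  let ?S = "\<lambda>x. x ^ Suc n / (1 - q ^ Suc n)"
  have a: "?a \<in> L" and b: "?b \<in> L" using nth_el_in[OF X] confsD(1)[OF X] i by auto
  have ab: "?a < ?b" using nth_el_less[OF X, of i "Suc i"] i by simp
  note nz = L_nz[OF a] L_nz[OF b]
  have "((\<lambda>y. \<bar>y\<bar> * y ^ n) has_sum (?S ?b - ?S ?a)) (slot X i)"
  proof -
    consider "0 < ?a" | "?b < 0" | "?a < 0" "0 < ?b" using nz ab by linarith
    then show ?thesis
    proof cases
      case 1
      have eq: "slot X i = tail ?b - tail ?a" and sub: "tail ?a \<subseteq> tail ?b"
        using 1 ab by (auto simp: slot_def qinterval_def tail_def sgn_if split: if_splits)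
      have "((\<lambda>y. y ^ Suc n) has_sum (?S ?b - ?S ?a)) (slot X i)"
        unfolding eq by (intro has_sum_Diff tail_has_sum a b sub)
      moreover have "((\<lambda>y. \<bar>y\<bar> * y ^ n) has_sum (?S ?b - ?S ?a)) (slot X i)
          = ((\<lambda>y. y ^ Suc n) has_sum (?S ?b - ?S ?a)) (slot X i)"
        by (rule has_sum_cong) (use 1 in \<open>auto simp: slot_def qinterval_def split: if_splits\<close>)
      ultimately show ?thesis by (simp only:)
    next
      case 2
      have eq: "slot X i = tail ?a - tail ?b" and sub: "tail ?b \<subseteq> tail ?a"
        using 2 ab by (auto simp: slot_def qinterval_def tail_def sgn_if split: if_splits)
      have "((\<lambda>y. y ^ Suc n) has_sum (?S ?a - ?S ?b)) (slot X i)"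
        unfolding eq by (intro has_sum_Diff tail_has_sum a b sub)
      then have "((\<lambda>y. - (y ^ Suc n)) has_sum - (?S ?a - ?S ?b)) (slot X i)"
        unfolding has_sum_uminus minus_minus .
      then have "((\<lambda>y. - (y ^ Suc n)) has_sum (?S ?b - ?S ?a)) (slot X i)"
        by (simp only: minus_diff_eq)
      moreover have "((\<lambda>y. \<bar>y\<bar> * y ^ n) has_sum (?S ?b - ?S ?a)) (slot X i)
          = ((\<lambda>y. - (y ^ Suc n)) has_sum (?S ?b - ?S ?a)) (slot X i)"
        by (rule has_sum_cong) (use 2 in \<open>auto simp: slot_def qinterval_def split: if_splits\<close>)
      ultimately show ?thesis by (simp only:)
    next
      case 3
      have eq: "slot X i = tail ?b \<union> tail ?a" and dis: "tail ?b \<inter> tail ?a = {}"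
        using 3 L_nz by (auto simp: slot_def qinterval_def tail_def sgn_if split: if_splits)
      have "((\<lambda>y. \<bar>y\<bar> * y ^ n) has_sum ?S ?b) (tail ?b)
          = ((\<lambda>y. y ^ Suc n) has_sum ?S ?b) (tail ?b)"
        by (rule has_sum_cong) (use 3 in \<open>auto simp: tail_def sgn_if split: if_splits\<close>)
      then have 1: "((\<lambda>y. \<bar>y\<bar> * y ^ n) has_sum ?S ?b) (tail ?b)"
        using tail_has_sum(1)[OF b] by (simp only:)
      have "((\<lambda>y. - (y ^ Suc n)) has_sum - ?S ?a) (tail ?a)"
        unfolding has_sum_uminus minus_minus by (rule tail_has_sum(1)[OF a])
      moreover have "((\<lambda>y. \<bar>y\<bar> * y ^ n) has_sum - ?S ?a) (tail ?a)
          = ((\<lambda>y. - (y ^ Suc n)) has_sum - ?S ?a) (tail ?a)"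
        by (rule has_sum_cong) (use 3 in \<open>auto simp: tail_def sgn_if split: if_splits\<close>)
      ultimately have 2: "((\<lambda>y. \<bar>y\<bar> * y ^ n) has_sum - ?S ?a) (tail ?a)" by (simp only:)
      have "?S ?b - ?S ?a = ?S ?b + - ?S ?a" by (rule diff_conv_add_uminus)
      then show ?thesis using has_sum_Un_disjoint[OF 1 2 dis] unfolding eq by (simp only:)
    qed
  qed
  then show hs: "((\<lambda>y. \<bar>y\<bar> * y ^ n) has_sum
      ((nth_el X (Suc i) ^ Suc n - nth_el X i ^ Suc n) / (1 - q ^ Suc n))) (slot X i)"
    by (simp add: diff_divide_distrib)
  show "(\<lambda>y. norm (\<bar>y\<bar> * y ^ n)) summable_on slot X i"
    using has_sum_imp_summable[OF hs] by (rule summable_on_iff_abs_summable_on_real[THEN iffD1])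
qed

end

section \<open>Discrete probability\<close>

lemma expectation_has_sum:
  fixes f :: "'a \<Rightarrow> real"
  assumes "((\<lambda>x. pmf p x * f x) has_sum s) UNIV"
  shows "measure_pmf.expectation p f = s"
proof -
  have "(\<lambda>x. pmf p x * f x) summable_on UNIV" using assms by (rule has_sum_imp_summable)
  then have "(\<lambda>x. norm (pmf p x * f x)) summable_on UNIV"
    by (rule summable_on_iff_abs_summable_on_real[THEN iffD1])
  then have "Infinite_Set_Sum.abs_summable_on (\<lambda>x. pmf p x * f x) UNIV"
    by (rule abs_summable_equivalent[THEN iffD1])
  then show ?thesis
    unfolding pmf_expectation_eq_infsetsum using infsetsum_infsum infsumI[OF assms] by metis
qed

lemma expectation_cong:
  fixes f g :: "'a \<Rightarrow> real"
  assumes "\<And>x. x \<in> set_pmf p \<Longrightarrow> f x = g x"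
  shows "measure_pmf.expectation p f = measure_pmf.expectation p g"
  by (rule integral_cong_AE) (use assms in \<open>auto simp: AE_measure_pmf_iff\<close>)

lemma integrable_bounded_pmf:
  fixes f :: "'a \<Rightarrow> real"
  assumes "\<And>x. x \<in> set_pmf p \<Longrightarrow> \<bar>f x\<bar> \<le> B"
  shows "integrable (measure_pmf p) f"
  by (rule measure_pmf.integrable_const_bound[of _ B]) (use assms in \<open>auto simp: AE_measure_pmf_iff\<close>)

lemma expectation_abs_le:
  fixes f :: "'a \<Rightarrow> real"
  assumes "\<And>x. x \<in> set_pmf p \<Longrightarrow> \<bar>f x\<bar> \<le> B"
  shows "\<bar>measure_pmf.expectation p f\<bar> \<le> B"
proof -
  have i: "integrable (measure_pmf p) f" using assms by (rule integrable_bounded_pmf)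
  have "\<bar>measure_pmf.expectation p f\<bar> \<le> measure_pmf.expectation p (\<lambda>x. \<bar>f x\<bar>)"
    using integral_norm_bound[of "measure_pmf p" f] by simp
  also have "\<dots> \<le> B"
    by (rule measure_pmf.integral_le_const) (use i assms in \<open>auto simp: AE_measure_pmf_iff\<close>)
  finally show ?thesis .
qed

lemma expectation_mono:
  fixes f g :: "'a \<Rightarrow> real"
  assumes "\<And>x. x \<in> set_pmf p \<Longrightarrow> f x \<le> g x"
    and "\<And>x. x \<in> set_pmf p \<Longrightarrow> \<bar>f x\<bar> \<le> B" "\<And>x. x \<in> set_pmf p \<Longrightarrow> \<bar>g x\<bar> \<le> C"
  shows "measure_pmf.expectation p f \<le> measure_pmf.expectation p g"
  by (rule integral_mono_AE)
    (use assms integrable_bounded_pmf[of p f B] integrable_bounded_pmf[of p g C]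
      in \<open>auto simp: AE_measure_pmf_iff\<close>)

lemma expectation_diff_le:
  fixes f g :: "'a \<Rightarrow> real"
  assumes "\<And>x. x \<in> set_pmf p \<Longrightarrow> \<bar>f x - g x\<bar> \<le> e"
    and "\<And>x. x \<in> set_pmf p \<Longrightarrow> \<bar>f x\<bar> \<le> B" "\<And>x. x \<in> set_pmf p \<Longrightarrow> \<bar>g x\<bar> \<le> C"
  shows "\<bar>measure_pmf.expectation p f - measure_pmf.expectation p g\<bar> \<le> e"
proof -
  have "measure_pmf.expectation p f - measure_pmf.expectation p g
      = measure_pmf.expectation p (\<lambda>x. f x - g x)"
    using integrable_bounded_pmf[of p f B] integrable_bounded_pmf[of p g C] assms by simp
  then show ?thesis using expectation_abs_le[of p "\<lambda>x. f x - g x" e] assms(1) by simp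
qed

lemma expectation_bind:
  fixes f :: "'b \<Rightarrow> real"
  assumes B: "\<And>y. y \<in> set_pmf (bind_pmf p k) \<Longrightarrow> \<bar>f y\<bar> \<le> B"
  shows "measure_pmf.expectation (bind_pmf p k) f
    = measure_pmf.expectation p (\<lambda>x. measure_pmf.expectation (k x) f)"
proof -
  define g where "g y = (if y \<in> set_pmf (bind_pmf p k) then f y else 0)" for y
  have g: "\<bar>g y\<bar> \<le> \<bar>B\<bar>" for y using B[of y] by (auto simp del: set_bind_pmf simp: g_def)
  have "measure_pmf.expectation (bind_pmf p k) f = measure_pmf.expectation (bind_pmf p k) g"
    by (rule expectation_cong) (auto simp: g_def)
  also have "\<dots> = measure_pmf.expectation p (\<lambda>x. measure_pmf.expectation (k x) g)"
    unfolding measure_pmf_bind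
    by (rule integral_bind[where B = "\<bar>B\<bar>" and B' = 1 and K = "count_space UNIV"])
      (use g in \<open>auto simp: measure_pmf.emeasure_space_1 measure_pmf_in_subprob_algebra\<close>)
  also have "\<dots> = measure_pmf.expectation p (\<lambda>x. measure_pmf.expectation (k x) f)"
    by (intro expectation_cong) (auto simp: g_def set_bind_pmf)
  finally show ?thesis .
qed

lemma prob_eq_expectation:
  "measure_pmf.prob p A = measure_pmf.expectation p (indicator A :: 'a \<Rightarrow> real)"
  by simp

lemma prob_bind:
  "measure_pmf.prob (bind_pmf p k) A = measure_pmf.expectation p (\<lambda>x. measure_pmf.prob (k x) A)"
  unfolding prob_eq_expectation by (rule expectation_bind[of _ _ _ 1]) (simp add: indicator_def)

lemma prob_compl: "measure_pmf.prob p (- A) = 1 - measure_pmf.prob p A"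
  using measure_pmf.prob_compl[of A p] by (simp add: Compl_eq_Diff_UNIV)

lemma prob_mono_pmf: "(\<And>x. x \<in> set_pmf p \<Longrightarrow> x \<in> A \<Longrightarrow> x \<in> B) \<Longrightarrow>
    measure_pmf.prob p A \<le> measure_pmf.prob p B"
  by (rule measure_pmf.finite_measure_mono_AE) (auto simp: AE_measure_pmf_iff)

lemma pmf_has_sum: "(pmf p has_sum measure_pmf.prob p A) A"
proof -
  have abs: "Infinite_Set_Sum.abs_summable_on (pmf p) A" by (rule pmf_abs_summable)
  then have "(\<lambda>x. norm (pmf p x)) summable_on A" by (rule abs_summable_equivalent[THEN iffD2])
  then have "pmf p summable_on A" by (rule summable_on_iff_abs_summable_on_real[THEN iffD2])
  then have "(pmf p has_sum infsum (pmf p) A) A" by (rule has_sum_infsum)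
  then show ?thesis by (simp only: measure_pmf_conv_infsetsum infsetsum_infsum[OF abs])
qed

lemma has_sum_finite_sum:
  fixes f :: "'i \<Rightarrow> 'a \<Rightarrow> real"
  assumes "finite I" "\<And>i. i \<in> I \<Longrightarrow> (f i has_sum s i) A"
  shows "((\<lambda>x. \<Sum>i\<in>I. f i x) has_sum (\<Sum>i\<in>I. s i)) A"
  using assms
proof (induction rule: finite_induct)
  case (insert j J)
  then show ?case using has_sum_add[of "f j" A "s j" "\<lambda>x. \<Sum>i\<in>J. f i x" "\<Sum>i\<in>J. s i"] by simp
qed (simp add: has_sum_0)

text \<open>Bounds for infinite sums of weights are reduced to finite subsums, for which the exchange
  argument below can be carried out injectively.\<close>

lemma prob_le_finite:
  assumes "\<And>F. finite F \<Longrightarrow> F \<subseteq> A \<Longrightarrow> (\<Sum>x\<in>F. pmf p x) \<le> c"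
  shows "measure_pmf.prob p A \<le> c"
proof -
  show ?thesis
    using has_sum_le_finite_sums[OF pmf_has_sum, of A p c] assms by auto
qed

lemma finite_prob_approx:
  assumes "0 < e"
  obtains F where "finite F" "F \<subseteq> set_pmf p" "1 - e < measure_pmf.prob p F"
proof -
  have "(pmf p has_sum 1) UNIV"
    using pmf_has_sum[of p UNIV] by simp
  then have "\<forall>\<^sub>F F in finite_subsets_at_top UNIV. dist (sum (pmf p) F) 1 < e"
    using assms by (auto simp: has_sum_def tendsto_iff)
  then obtain F where F: "finite F" "dist (sum (pmf p) F) 1 < e"
    by (auto simp: eventually_finite_subsets_at_top)
  have "measure_pmf.prob p (F \<inter> set_pmf p) = measure_pmf.prob p F"
    by (rule measure_pmf.finite_measure_eq_AE) (auto simp: AE_measure_pmf_iff)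
  then have "1 - e < measure_pmf.prob p (F \<inter> set_pmf p)"
    using F by (simp add: measure_measure_pmf_finite dist_real_def)
  then show thesis using F(1) that[of "F \<inter> set_pmf p"] by auto
qed

text \<open>If probability weights converge pointwise to probability weights, no mass can escape, and
  expectations of bounded functions converge: Scheffe's lemma along a filter.\<close>

lemma pmf_tendsto_expectation:
  fixes f :: "'a \<Rightarrow> real" and P :: "'b \<Rightarrow> 'a pmf"
  assumes lim: "\<And>x. ((\<lambda>i. pmf (P i) x) \<longlongrightarrow> pmf Q x) F" and B: "\<And>x. \<bar>f x\<bar> \<le> B"
  shows "((\<lambda>i. measure_pmf.expectation (P i) f) \<longlongrightarrow> measure_pmf.expectation Q f) F"
proof (rule tendstoI)
  fix e :: real assume e: "0 < e"
  have B0: "0 \<le> B" using B[of undefined] by linarith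
  define d where "d = e / (4 * (B + 1))"
  have d: "0 < d" using e B0 by (simp add: d_def)
  obtain A where A: "finite A" "1 - d < measure_pmf.prob Q A"
    using finite_prob_approx[OF d] by metis
  let ?h = "\<lambda>x. indicator A x * f x"
  have split: "\<bar>measure_pmf.expectation R f - (\<Sum>x\<in>A. pmf R x * f x)\<bar>
      \<le> B * (1 - measure_pmf.prob R A)" for R
  proof -
    have hb: "\<bar>?h x\<bar> \<le> B" for x using B[of x] B0 by (simp add: indicator_def)
    have "measure_pmf.expectation R ?h = (\<Sum>x\<in>A. pmf R x * ?h x)"
      by (subst integral_measure_pmf[OF A(1)]) (auto simp: indicator_def split: if_splits)
    also have "\<dots> = (\<Sum>x\<in>A. pmf R x * f x)" by (rule sum.cong) auto
    finally have h: "measure_pmf.expectation R ?h = (\<Sum>x\<in>A. pmf R x * f x)" .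
    have "measure_pmf.expectation R f - measure_pmf.expectation R ?h
        = measure_pmf.expectation R (\<lambda>x. f x - ?h x)"
      using integrable_bounded_pmf[of R f B] integrable_bounded_pmf[of R ?h B] B hb by simp
    moreover have "\<bar>measure_pmf.expectation R (\<lambda>x. f x - ?h x)\<bar>
        \<le> measure_pmf.expectation R (\<lambda>x. \<bar>f x - ?h x\<bar>)"
      using integral_norm_bound[of "measure_pmf R" "\<lambda>x. f x - ?h x"] by simp
    moreover have "\<dots> \<le> measure_pmf.expectation R (\<lambda>x. B * indicator (- A) x)"
      by (rule expectation_mono[where B = B and C = B])
        (use B B0 in \<open>auto simp: indicator_def\<close>)
    moreover have "\<dots> = B * (1 - measure_pmf.prob R A)" by (simp add: prob_compl)
    ultimately show ?thesis using h by linarith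
  qed
  have "((\<lambda>i. \<Sum>x\<in>A. pmf (P i) x * f x) \<longlongrightarrow> (\<Sum>x\<in>A. pmf Q x * f x)) F"
    by (intro tendsto_intros lim)
  then have 1: "\<forall>\<^sub>F i in F. \<bar>(\<Sum>x\<in>A. pmf (P i) x * f x) - (\<Sum>x\<in>A. pmf Q x * f x)\<bar> < e / 4"
    using e by (simp only: tendsto_iff dist_real_def)
  have "((\<lambda>i. \<Sum>x\<in>A. pmf (P i) x) \<longlongrightarrow> (\<Sum>x\<in>A. pmf Q x)) F"
    by (intro tendsto_intros lim)
  then have "((\<lambda>i. measure_pmf.prob (P i) A) \<longlongrightarrow> measure_pmf.prob Q A) F"
    using A(1) by (simp add: measure_measure_pmf_finite)
  then have 2: "\<forall>\<^sub>F i in F. 1 - d < measure_pmf.prob (P i) A"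
    using A(2) order_tendstoD(1) by fastforce
  show "\<forall>\<^sub>F i in F. dist (measure_pmf.expectation (P i) f) (measure_pmf.expectation Q f) < e"
    using 1 2
  proof eventually_elim
    case (elim i)
    have Bd: "B * d \<le> e / 4" using e B0 by (simp add: d_def field_simps)
    have "B * (1 - measure_pmf.prob (P i) A) \<le> B * d" "B * (1 - measure_pmf.prob Q A) \<le> B * d"
      using elim A(2) B0 by (auto intro!: mult_left_mono)
    then show ?case
      using split[of "P i"] split[of Q] elim(1) Bd e unfolding dist_real_def by linarith
  qed
qed

lemma pmf_tendsto_prob:
  assumes "\<And>x. ((\<lambda>i. pmf (P i) x) \<longlongrightarrow> pmf Q x) F"
  shows "((\<lambda>i. measure_pmf.prob (P i) A) \<longlongrightarrow> measure_pmf.prob Q A) F"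
  unfolding prob_eq_expectation
  by (rule pmf_tendsto_expectation[OF assms, of _ 1]) (simp add: indicator_def)

text \<open>Fubini for a product of absolutely convergent real sums.\<close>

lemma has_sum_prod_PiE:
  fixes f :: "'i \<Rightarrow> 'a \<Rightarrow> real"
  assumes I: "finite I" and B: "\<And>i. i \<in> I \<Longrightarrow> countable (B i)"
    and hs: "\<And>i. i \<in> I \<Longrightarrow> (f i has_sum s i) (B i)"
  shows "((\<lambda>g. \<Prod>i\<in>I. f i (g i)) has_sum (\<Prod>i\<in>I. s i)) (PiE I B)"
proof -
  have abs: "(\<lambda>x. norm (f i x)) summable_on B i" if "i \<in> I" for i
    using has_sum_imp_summable[OF hs[OF that]]
    by (rule summable_on_iff_abs_summable_on_real[THEN iffD1])
  have "Infinite_Set_Sum.abs_summable_on (\<lambda>g. \<Prod>i\<in>I. f i (g i)) (PiE I B)"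
    by (rule abs_summable_on_prod_PiE[OF I B abs_summable_equivalent[THEN iffD1, OF abs]])
  then have "(\<lambda>g. norm (\<Prod>i\<in>I. f i (g i))) summable_on PiE I B"
    by (rule abs_summable_equivalent[THEN iffD2])
  then have "(\<lambda>g. \<Prod>i\<in>I. f i (g i)) summable_on PiE I B"
    by (rule summable_on_iff_abs_summable_on_real[THEN iffD2])
  then have "((\<lambda>g. \<Prod>i\<in>I. f i (g i)) has_sum infsum (\<lambda>g. \<Prod>i\<in>I. f i (g i)) (PiE I B)) (PiE I B)"
    by (rule has_sum_infsum)
  moreover have "infsum (\<lambda>g. \<Prod>i\<in>I. f i (g i)) (PiE I B) = (\<Prod>i\<in>I. infsum (f i) (B i))"
    by (rule infsum_prod_PiE_abs[OF I abs])
  moreover have "\<dots> = (\<Prod>i\<in>I. s i)"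
    by (rule prod.cong) (auto intro: infsumI hs)
  ultimately show ?thesis by simp
qed

section \<open>The links act on ratios of alternants\<close>

text \<open>The ratio of an alternant and the Vandermonde determinant: up to the order of the
  exponents, a Schur polynomial in the points of the configuration.\<close>

definition bialt :: "(nat \<Rightarrow> nat) \<Rightarrow> real set \<Rightarrow> real" where
  "bialt p Z = alternant (card Z) (\<lambda>i. sorted_list_of_set Z ! i) p / vandermonde Z"

lemma vandermonde_alternant:
  "vandermonde Z = alternant (card Z) (\<lambda>i. sorted_list_of_set Z ! i) (\<lambda>j. j)"
  by (simp add: vandermonde_def alternant_id)

context qlattice
begin

lemma vandermonde_pos: "Z \<in> G N \<Longrightarrow> 0 < vandermonde Z"
  unfolding vandermonde_def using confsD(3)[of Z N] nth_el_less[of Z N]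
  by (intro prod_pos) auto

lemma bialt_id: "Z \<in> G N \<Longrightarrow> bialt (\<lambda>j. j) Z = 1"
  using vandermonde_pos[of Z N] by (simp add: bialt_def vandermonde_alternant[symmetric])

text \<open>Expanding the alternant by the Leibniz formula turns the sum over interlacing
  configurations into products of one-dimensional sums. Each of these is a difference of two values
  of $x^{p+1} / (1 - q^{p+1})$, the Jackson integral of $x^p$, so the result is again an alternant.\<close>

lemma moment_has_sum:
  assumes X: "X \<in> G (Suc N)"
  shows "((\<lambda>Y. qlink q zm zp N X Y * bialt p Y) has_sum
      (\<Prod>j<N. (1 - q ^ Suc j) / (1 - q ^ Suc (p j))) * bialt (pad 1 p) X)
      {Y \<in> G N. interlaces q zm zp Y X}"
proof -
  let ?x = "nth_el X"
  let ?V = "vandermonde X"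
  let ?c = "\<Prod>i = 1..N. 1 - q ^ i"
  let ?T = "PiE {..<N} (slot X)"
  let ?d = "\<lambda>j. 1 / (1 - q ^ Suc (p j))"
  let ?F = "\<lambda>j i. ?x i ^ Suc (p j)"
  have cl: "countable (slot X i)" for i
    using slot_L countable_L by (rule countable_subset)
  \<comment> \<open>One term of the Leibniz expansion, summed over all choices of one point per slot.\<close>
  have summand: "((\<lambda>y. \<Prod>i<N. \<bar>y i\<bar> * y i ^ p (s i)) has_sum
      (\<Prod>i<N. (?F (s i) (Suc i) - ?F (s i) i) * ?d (s i))) ?T" for s :: "nat \<Rightarrow> nat"
    using slot_has_sum(1)[OF X]
    by (intro has_sum_prod_PiE[where f = "\<lambda>i y. \<bar>y\<bar> * y ^ p (s i)"] cl) auto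
  have leib: "(\<Prod>i<N. \<bar>y i\<bar>) * alternant N y p = (\<Sum>s | s permutes {0..<N}.
      of_int (sign s) * (\<Prod>i<N. \<bar>y i\<bar> * y i ^ p (s i)))" for y
    unfolding alternant_def det_leibniz sum_distrib_left
    by (rule sum.cong) (simp_all add: prod.distrib algebra_simps)
  have "((\<lambda>y. (\<Prod>i<N. \<bar>y i\<bar>) * alternant N y p) has_sum (\<Sum>s | s permutes {0..<N}.
      of_int (sign s) * (\<Prod>i<N. (?F (s i) (Suc i) - ?F (s i) i) * ?d (s i)))) ?T"
    unfolding leib by (intro has_sum_finite_sum has_sum_cmult_right summand) (simp add: finite_permutations)
  moreover have "(\<Sum>s | s permutes {0..<N}.
      of_int (sign s) * (\<Prod>i<N. (?F (s i) (Suc i) - ?F (s i) i) * ?d (s i)))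
      = Determinant.det (mat N N (\<lambda>(i, j). (?F j (Suc i) - ?F j i) * ?d j))"
    by (rule det_leibniz[symmetric, where n = N and a = "\<lambda>i j. (?F j (Suc i) - ?F j i) * ?d j"])
  moreover have "\<dots> = Determinant.det (mat N N (\<lambda>(i, j). ?F j (Suc i) - ?F j i)) * (\<Prod>j<N. ?d j)"
    by (rule det_scale_columns[of N "\<lambda>i j. ?F j (Suc i) - ?F j i" ?d])
  moreover have "Determinant.det (mat N N (\<lambda>(i, j). ?F j (Suc i) - ?F j i))
      = alternant (Suc N) ?x (pad 1 p)"
    unfolding det_differences[of N ?F] alternant_def
    by (rule arg_cong[of _ _ Determinant.det], rule eq_matI) (auto simp: pad_def)
  ultimately have hs: "((\<lambda>y. (\<Prod>i<N. \<bar>y i\<bar>) * alternant N y p) has_sum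
      alternant (Suc N) ?x (pad 1 p) * (\<Prod>j<N. ?d j)) ?T" by (simp only:)
  have eq: "?c / ?V * ((\<Prod>i<N. \<bar>y i\<bar>) * alternant N y p)
      = qlink q zm zp N X (y ` {..<N}) * bialt p (y ` {..<N})" if y: "y \<in> ?T" for y
  proof -
    let ?Y = "y ` {..<N}"
    have Y: "?Y \<in> G N" "interlaces q zm zp ?Y X"
      using bij_betwE[OF tuple_bij[OF X]] y by auto
    have pr: "(\<Prod>t\<in>?Y. \<bar>t\<bar>) = (\<Prod>i<N. \<bar>y i\<bar>)"
      using prod.reindex[OF tuple_inj[OF X y], of abs] by (simp add: o_def)
    have al: "alternant N (\<lambda>i. sorted_list_of_set ?Y ! i) p = alternant N y p"
      unfolding alternant_def tuple_sorted[OF X y]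
      by (rule arg_cong[of _ _ Determinant.det], rule eq_matI) auto
    show ?thesis
      unfolding qlink_def bialt_def confsD(3)[OF Y(1)] al pr using Y(2) vandermonde_pos[OF Y(1)] by simp
  qed
  have "((\<lambda>y. qlink q zm zp N X (y ` {..<N}) * bialt p (y ` {..<N})) has_sum
      ?c / ?V * (alternant (Suc N) ?x (pad 1 p) * (\<Prod>j<N. ?d j))) ?T
    = ((\<lambda>y. ?c / ?V * ((\<Prod>i<N. \<bar>y i\<bar>) * alternant N y p)) has_sum
      ?c / ?V * (alternant (Suc N) ?x (pad 1 p) * (\<Prod>j<N. ?d j))) ?T"
    by (rule has_sum_cong) (simp only: eq)
  then have "((\<lambda>y. qlink q zm zp N X (y ` {..<N}) * bialt p (y ` {..<N})) has_sum
      ?c / ?V * (alternant (Suc N) ?x (pad 1 p) * (\<Prod>j<N. ?d j))) ?T"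
    using has_sum_cmult_right[OF hs, of "?c / ?V"] by (simp only:)
  moreover have "?c / ?V * (alternant (Suc N) ?x (pad 1 p) * (\<Prod>j<N. ?d j))
      = (\<Prod>j<N. (1 - q ^ Suc j) / (1 - q ^ Suc (p j))) * bialt (pad 1 p) X"
  proof -
    have "?c = (\<Prod>j<N. 1 - q ^ Suc j)"
      unfolding One_nat_def lessThan_atLeast0 atLeastLessThanSuc_atLeastAtMost[symmetric]
      by (rule prod.shift_bounds_Suc_ivl)
    then show ?thesis
      unfolding bialt_def confsD(3)[OF X] by (simp add: prod_dividef)
  qed
  ultimately show ?thesis
    using has_sum_reindex_bij_betw[OF tuple_bij[OF X], of "\<lambda>Y. qlink q zm zp N X Y * bialt p Y"]
    by (simp only:)
qed

lemma qlink_nonneg: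
  assumes "X \<in> G (Suc N)" "Y \<in> G N"
  shows "0 \<le> qlink q zm zp N X Y"
proof -
  have "0 \<le> 1 - q ^ i" for i using q0 q1 by (simp add: power_le_one)
  then show ?thesis
    unfolding qlink_def using vandermonde_pos[OF assms(1)] vandermonde_pos[OF assms(2)]
    by (auto intro!: mult_nonneg_nonneg divide_nonneg_pos prod_nonneg)
qed

subsection \<open>The links as probability mass functions\<close>

text \<open>The row of the link at \<open>X\<close>. That its weights sum up to 1 is the case of trivial exponents of
  the moment formula.\<close>

definition link :: "nat \<Rightarrow> real set \<Rightarrow> real set pmf" where
  "link N X = (if X \<in> G (Suc N)
    then embed_pmf (\<lambda>Y. if Y \<in> G N then qlink q zm zp N X Y else 0) else return_pmf X)"

lemma qlink_extend:
  assumes "((\<lambda>Y. qlink q zm zp N X Y * f Y) has_sum s) {Y \<in> G N. interlaces q zm zp Y X}"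
  shows "((\<lambda>Y. (if Y \<in> G N then qlink q zm zp N X Y else 0) * f Y) has_sum s) UNIV"
proof -
  have "((\<lambda>Y. (if Y \<in> G N then qlink q zm zp N X Y else 0) * f Y) has_sum s) UNIV
      = ((\<lambda>Y. qlink q zm zp N X Y * f Y) has_sum s) {Y \<in> G N. interlaces q zm zp Y X}"
    by (rule has_sum_cong_neutral) (auto simp: qlink_def)
  then show ?thesis using assms by simp
qed

lemma pmf_link:
  assumes X: "X \<in> G (Suc N)"
  shows "pmf (link N X) Y = (if Y \<in> G N then qlink q zm zp N X Y else 0)"
proof -
  let ?f = "\<lambda>Y. if Y \<in> G N then qlink q zm zp N X Y else 0"
  have nn: "0 \<le> ?f Y" for Y using qlink_nonneg[OF X] by auto
  have qp: "1 - q ^ Suc j \<noteq> 0" for j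
    using q0 q1 power_Suc_less_one[of q j] by auto
  have "((\<lambda>Y. qlink q zm zp N X Y * bialt (\<lambda>j. j) Y) has_sum 1)
      {Y \<in> G N. interlaces q zm zp Y X}"
    using moment_has_sum[OF X, of "\<lambda>j. j"] qp bialt_id[OF X] unfolding pad_id
    by (simp del: power_Suc)
  then have "((\<lambda>Y. ?f Y * bialt (\<lambda>j. j) Y) has_sum 1) UNIV"
    by (rule qlink_extend)
  moreover have "(\<lambda>Y. ?f Y * bialt (\<lambda>j. j) Y) = ?f" using bialt_id by fastforce
  ultimately have hs: "(?f has_sum 1) UNIV" by simp
  have "?f summable_on UNIV" using hs by (rule has_sum_imp_summable)
  then have "(\<lambda>Y. norm (?f Y)) summable_on UNIV"
    by (rule summable_on_iff_abs_summable_on_real[THEN iffD1])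
  then have abs: "Infinite_Set_Sum.abs_summable_on ?f UNIV"
    by (rule abs_summable_equivalent[THEN iffD1])
  have "(\<integral>\<^sup>+Y. ennreal (?f Y) \<partial>count_space UNIV) = ennreal (infsetsum ?f UNIV)"
    by (rule nn_integral_conv_infsetsum[OF abs nn])
  also have "\<dots> = 1" using infsetsum_infsum[OF abs] infsumI[OF hs] by simp
  finally have "(\<integral>\<^sup>+Y. ennreal (?f Y) \<partial>count_space UNIV) = 1" .
  then show ?thesis
    using pmf_embed_pmf[of ?f Y] nn X by (simp add: link_def)
qed

lemma set_link:
  assumes "X \<in> G (Suc N)"
  shows "set_pmf (link N X) \<subseteq> {Y \<in> G N. interlaces q zm zp Y X}"
  using assms by (auto simp: set_pmf_eq pmf_link qlink_def split: if_splits)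

lemma link_moment:
  assumes X: "X \<in> G (Suc N)"
  shows "measure_pmf.expectation (link N X) (bialt p)
    = (\<Prod>j<N. (1 - q ^ Suc j) / (1 - q ^ Suc (p j))) * bialt (pad 1 p) X"
  by (rule expectation_has_sum, unfold pmf_link[OF X]) (rule qlink_extend[OF moment_has_sum[OF X]])

end

section \<open>Variational series\<close>

lemma precedes_irrefl: "\<not> precedes x x"
  by (auto simp: precedes_def)

lemma precedes_trans: "precedes x y \<Longrightarrow> precedes y z \<Longrightarrow> precedes x z"
  by (auto simp: precedes_def)

lemma precedes_total: "x \<noteq> y \<Longrightarrow> precedes x y \<or> precedes y x"
  by (auto simp: precedes_def)

lemma precedes_abs: "precedes x y \<Longrightarrow> \<bar>y\<bar> \<le> \<bar>x\<bar>"
  by (auto simp: precedes_def)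

text \<open>The inverse of the variational series: the index at which \<open>x\<close> is listed.\<close>

definition place :: "real set \<Rightarrow> real \<Rightarrow> nat" where
  "place X x = card {y \<in> X. precedes y x}"

text \<open>A position of the variational series that is not padded by zeros.\<close>

definition valid :: "real set \<Rightarrow> nat \<Rightarrow> bool" where
  "valid X k \<longleftrightarrow> infinite X \<or> k < card X"

definition agree :: "nat \<Rightarrow> real set \<Rightarrow> real set \<Rightarrow> bool" where
  "agree k X Y \<longleftrightarrow> (\<forall>i<k. variational X i = variational Y i)"

context qlattice
begin

abbreviation "Ginf \<equiv> inf_confs q zm zp"

text \<open>The common ground of finite and infinite configurations. Boundedness makes the variational
  series proper, because the grid accumulates only at 0.\<close>

definition bconf :: "real set \<Rightarrow> bool" where
  "bconf X \<longleftrightarrow> X \<subseteq> L \<and> bounded X"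

lemma G_bconf: "X \<in> G N \<Longrightarrow> bconf X"
  using confsD by (auto simp: bconf_def finite_imp_bounded)

lemma Ginf_bconf: "X \<in> Ginf \<Longrightarrow> bconf X"
  by (auto simp: bconf_def inf_confs_def)

lemma G_valid: "X \<in> G N \<Longrightarrow> valid X k \<longleftrightarrow> k < N"
  using confsD by (auto simp: valid_def)

lemma Ginf_valid: "X \<in> Ginf \<Longrightarrow> valid X k"
  by (auto simp: valid_def inf_confs_def)

lemma finite_preds:
  assumes "bconf X" "x \<noteq> 0"
  shows "finite {y \<in> X. precedes y x}"
proof -
  obtain R where "\<And>y. y \<in> X \<Longrightarrow> \<bar>y\<bar> \<le> R"
    using assms(1) by (auto simp: bconf_def bounded_iff)
  then have "{y \<in> X. precedes y x} \<subseteq> {y \<in> L. \<bar>x\<bar> \<le> \<bar>y\<bar> \<and> \<bar>y\<bar> \<le> R}"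
    using assms(1) precedes_abs by (auto simp: bconf_def)
  moreover have "finite {y \<in> L. \<bar>x\<bar> \<le> \<bar>y\<bar> \<and> \<bar>y\<bar> \<le> R}"
    using assms(2) by (intro finite_annulus) simp
  ultimately show ?thesis by (rule finite_subset)
qed

lemma bconf_nz: "bconf X \<Longrightarrow> x \<in> X \<Longrightarrow> x \<noteq> 0"
  using L_nz by (auto simp: bconf_def)

lemma place_less:
  assumes "bconf X" "x \<in> X" "y \<in> X" "precedes x y"
  shows "place X x < place X y"
  unfolding place_def
proof (rule psubset_card_mono)
  show "finite {z \<in> X. precedes z y}" using assms bconf_nz by (intro finite_preds) auto
  show "{z \<in> X. precedes z x} \<subset> {z \<in> X. precedes z y}"
    using assms precedes_trans precedes_irrefl by blast
qed

lemma place_inj: "bconf X \<Longrightarrow> inj_on (place X) X"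
proof (rule inj_onI)
  fix x y assume *: "bconf X" "x \<in> X" "y \<in> X" "place X x = place X y"
  show "x = y"
    using place_less[OF *(1,2,3)] place_less[OF *(1,3,2)] precedes_total[of x y] *(4) by auto
qed

lemma place_image_preds:
  assumes X: "bconf X" and x: "x \<in> X"
  shows "place X ` {y \<in> X. precedes y x} = {..<place X x}"
proof (rule card_subset_eq)
  show "place X ` {y \<in> X. precedes y x} \<subseteq> {..<place X x}"
    using place_less[OF X] x by auto
  show "card (place X ` {y \<in> X. precedes y x}) = card {..<place X x}"
    using card_image[OF inj_on_subset[OF place_inj[OF X]], of "{y \<in> X. precedes y x}"]
    by (auto simp: place_def)
qed simp

lemma place_less_card:
  assumes X: "bconf X" and x: "x \<in> X"
  shows "valid X (place X x)"
proof (cases "finite X")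
  case True
  have "{y \<in> X. precedes y x} \<subset> X" using x precedes_irrefl by auto
  then show ?thesis using psubset_card_mono[OF True] by (simp add: valid_def place_def)
qed (simp add: valid_def)

lemma variational_place:
  assumes X: "bconf X" and x: "x \<in> X"
  shows "variational X (place X x) = x"
proof -
  have "(THE z. z \<in> X \<and> card {y \<in> X. precedes y z} = place X x) = x"
    using x inj_onD[OF place_inj[OF X]] by (intro the_equality) (auto simp: place_def)
  then show ?thesis
    using place_less_card[OF X x] by (auto simp: variational_def valid_def)
qed

lemma ex_place:
  assumes X: "bconf X" and k: "valid X k"
  shows "\<exists>x\<in>X. place X x = k"
proof (rule ccontr)
  assume none: "\<not> (\<exists>x\<in>X. place X x = k)"
  have "place X ` X \<subseteq> {..<k}"
  proof (rule image_subsetI, rule ccontr)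
    fix x assume x: "x \<in> X" "place X x \<notin> {..<k}"
    then have "k \<in> {..<place X x}" using none by (cases "place X x = k") auto
    then have "k \<in> place X ` {y \<in> X. precedes y x}" unfolding place_image_preds[OF X x(1)] .
    then show False using none by auto
  qed
  then have "finite (place X ` X)" "card (place X ` X) \<le> k"
    using finite_subset[of _ "{..<k}"] card_mono[of "{..<k}"] by auto
  then have "finite X" "card X \<le> k"
    using place_inj[OF X] by (auto simp: card_image dest: finite_imageD)
  then show False using k by (simp add: valid_def)
qed

lemma variational_in:
  assumes "bconf X" "valid X k"
  shows "variational X k \<in> X" "place X (variational X k) = k"
  using ex_place[OF assms] variational_place[OF assms(1)] by auto

lemma variational_invalid: "\<not> valid X k \<Longrightarrow> variational X k = 0"
  by (simp add: variational_def valid_def)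

lemma valid_mono: "valid X j \<Longrightarrow> i \<le> j \<Longrightarrow> valid X i"
  by (auto simp: valid_def)

lemma variational_nz: "bconf X \<Longrightarrow> variational X k \<noteq> 0 \<longleftrightarrow> valid X k"
  using variational_in bconf_nz variational_invalid by blast

lemma variational_precedes:
  assumes X: "bconf X" and j: "valid X j" and ij: "i < j"
  shows "precedes (variational X i) (variational X j)"
proof -
  have i: "valid X i" using valid_mono[OF j] ij by simp
  note vi = variational_in[OF X i] and vj = variational_in[OF X j]
  have "variational X i \<noteq> variational X j" using vi vj ij by auto
  then show ?thesis
    using precedes_total place_less[OF X vj(1) vi(1)] vi vj ij by fastforce
qed

lemma variational_abs_mono:
  assumes X: "bconf X" and ij: "i \<le> j"
  shows "\<bar>variational X j\<bar> \<le> \<bar>variational X i\<bar>"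
proof (cases "valid X j \<and> i < j")
  case True
  then show ?thesis using variational_precedes[OF X] precedes_abs by blast
next
  case False
  then show ?thesis using variational_invalid ij by (cases "i = j") auto
qed

lemma variational_inj:
  assumes "bconf X"
  shows "inj_on (variational X) {k. valid X k}"
  by (rule inj_on_inverseI[of _ "place X"]) (use variational_in(2)[OF assms] in auto)

lemma variational_surj:
  assumes "bconf X" "x \<in> X"
  obtains k where "valid X k" "variational X k = x" "k = place X x"
  using variational_place[OF assms] place_less_card[OF assms] by blast

lemma variational_bij: "X \<in> G N \<Longrightarrow> bij_betw (variational X) {..<N} X"
proof (rule bij_betw_byWitness[where f' = "place X"])
  assume X: "X \<in> G N"
  note b = G_bconf[OF X] and v = G_valid[OF X]
  show "\<forall>k\<in>{..<N}. place X (variational X k) = k" using variational_in(2)[OF b] v by simp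
  show "\<forall>x\<in>X. variational X (place X x) = x" using variational_place[OF b] by simp
  show "variational X ` {..<N} \<subseteq> X" using variational_in(1)[OF b] v by auto
  show "place X ` X \<subseteq> {..<N}" using place_less_card[OF b] v by auto
qed

lemma variational_sum_le:
  assumes X: "bconf X" and S: "finite S" "\<And>s. s \<in> S \<Longrightarrow> l \<le> s"
  shows "(\<Sum>s\<in>S. \<bar>variational X s\<bar>) \<le> 2 * \<bar>variational X l\<bar> / (1 - q)"
proof -
  let ?S = "{s \<in> S. valid X s}"
  have "(\<Sum>s\<in>S. \<bar>variational X s\<bar>) = (\<Sum>s\<in>?S. \<bar>variational X s\<bar>)"
    using S(1) variational_invalid by (intro sum.mono_neutral_right) auto
  also have "\<dots> = (\<Sum>x\<in>variational X ` ?S. \<bar>x\<bar>)"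
    using inj_on_subset[OF variational_inj[OF X], of ?S]
    by (subst sum.reindex) (auto simp: o_def)
  also have "\<dots> \<le> 2 * \<bar>variational X l\<bar> / (1 - q)"
    using S variational_in(1)[OF X] X variational_abs_mono[OF X]
    by (intro finite_sum_L) (auto simp: bconf_def)
  finally show ?thesis .
qed

text \<open>A sequence that decreases in the order of precedence is its own variational series.\<close>

lemma variational_image:
  assumes v: "\<And>i j. i < j \<Longrightarrow> j \<in> I \<Longrightarrow> precedes (v i) (v j)"
    and I: "\<And>i j. i < j \<Longrightarrow> j \<in> I \<Longrightarrow> i \<in> I"
    and b: "bconf (v ` I)" and k: "k \<in> I"
  shows "variational (v ` I) k = v k"
proof -
  have inj: "inj_on v I"
  proof (rule inj_onI)
    fix i j assume "i \<in> I" "j \<in> I" "v i = v j"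
    then show "i = j" using v[of i j] v[of j i] precedes_irrefl by (cases i j rule: linorder_cases) auto
  qed
  have "{y \<in> v ` I. precedes y (v k)} = v ` {..<k}"
  proof (intro equalityI subsetI)
    fix y assume "y \<in> {y \<in> v ` I. precedes y (v k)}"
    then obtain i where i: "i \<in> I" "y = v i" "precedes (v i) (v k)" by auto
    have "i < k"
      using v[of k i] i precedes_trans precedes_irrefl by (metis linorder_neqE_nat)
    then show "y \<in> v ` {..<k}" using i by auto
  qed (use v I k in auto)
  then have "place (v ` I) (v k) = k"
    unfolding place_def using card_image[OF inj_on_subset[OF inj, of "{..<k}"]] I[OF _ k] by auto
  then show ?thesis using variational_place[OF b, of "v k"] k by auto
qed

lemma initial_segment:
  assumes X: "X \<in> Ginf"
  shows "variational X ` {..<N} \<in> G N" "agree N (variational X ` {..<N}) X"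
proof -
  note bX = Ginf_bconf[OF X] and vX = Ginf_valid[OF X]
  have inj: "inj_on (variational X) {..<N}"
    using inj_on_subset[OF variational_inj[OF bX]] vX by auto
  show G: "variational X ` {..<N} \<in> G N"
    using variational_in(1)[OF bX vX] bX inj by (auto simp: confs_def bconf_def card_image)
  show "agree N (variational X ` {..<N}) X"
    unfolding agree_def
    using variational_image[of "{..<N}" "variational X"] variational_precedes[OF bX vX] G_bconf[OF G]
    by auto
qed

text \<open>Order of precedence and membership in the grid involve only two terms, respectively one term, of
  the series. Hence they pass from finite configurations with prescribed initial terms to the limit.\<close>

lemma limit_configuration:
  assumes "\<And>k. \<exists>N\<ge>k. \<exists>Z\<in>G N. \<forall>i<k. variational Z i = v i"
  obtains X where "X \<in> Ginf" "\<And>i. variational X i = v i"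
proof -
  have vL: "v i \<in> L" for i
  proof -
    obtain N Z where Z: "N \<ge> Suc i" "Z \<in> G N" "\<forall>j<Suc i. variational Z j = v j"
      using assms by blast
    have "variational Z i \<in> Z"
      using variational_in(1)[OF G_bconf[OF Z(2)]] G_valid[OF Z(2)] Z(1) by simp
    moreover have "variational Z i = v i" using Z(3) by blast
    ultimately show ?thesis using confsD(1)[OF Z(2)] by auto
  qed
  have pr: "precedes (v i) (v j)" if "i < j" for i j
  proof -
    obtain N Z where Z: "N \<ge> Suc j" "Z \<in> G N" "\<forall>i<Suc j. variational Z i = v i"
      using assms by blast
    then show ?thesis
      using variational_precedes[OF G_bconf[OF Z(2)], of j i] G_valid[OF Z(2)] that by simp
  qed
  have inj: "inj v"
  proof (rule injI)
    fix i j assume "v i = v j"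
    then show "i = j" using pr[of i j] pr[of j i] precedes_irrefl by (cases i j rule: linorder_cases) auto
  qed
  have ab: "\<bar>v i\<bar> \<le> \<bar>v 0\<bar>" for i using precedes_abs[OF pr[of 0 i]] by (cases i) auto
  have "range v \<in> Ginf"
    using vL range_inj_infinite[OF inj] ab by (auto simp: inf_confs_def bounded_iff)
  moreover from this have "variational (range v) i = v i" for i
    using variational_image[of UNIV v i] pr Ginf_bconf by auto
  ultimately show thesis using that by blast
qed

lemma variational_tendsto_0:
  assumes X: "X \<in> Ginf"
  shows "variational X \<longlonglongrightarrow> 0"
proof (rule tendstoI)
  fix e :: real assume e: "0 < e"
  note bX = Ginf_bconf[OF X] and vX = Ginf_valid[OF X]
  obtain R where R: "\<And>y. y \<in> X \<Longrightarrow> \<bar>y\<bar> \<le> R" using bX by (auto simp: bconf_def bounded_iff)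
  have "finite (variational X ` {k. e \<le> \<bar>variational X k\<bar>})"
    by (rule finite_subset[OF _ finite_annulus[OF e, of R]])
      (use variational_in(1)[OF bX vX] bX R in \<open>auto simp: bconf_def\<close>)
  then have "finite {k. e \<le> \<bar>variational X k\<bar>}"
    using inj_on_subset[OF variational_inj[OF bX]] vX by (auto dest: finite_imageD)
  then have "\<forall>\<^sub>F k in sequentially. k \<notin> {k. e \<le> \<bar>variational X k\<bar>}"
    unfolding cofinite_eq_sequentially[symmetric] eventually_cofinite by simp
  then show "\<forall>\<^sub>F k in sequentially. dist (variational X k) 0 < e"
    by eventually_elim auto
qed

lemma Ginf_eqI:
  assumes "X \<in> Ginf" "Y \<in> Ginf" "\<And>i. variational X i = variational Y i"
  shows "X = Y"
proof -
  have eq: "range (variational Z) = Z" if Z: "Z \<in> Ginf" for Z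
  proof (intro equalityI subsetI)
    fix x assume "x \<in> Z"
    then obtain k where "variational Z k = x" using variational_surj[OF Ginf_bconf[OF Z]] by blast
    then show "x \<in> range (variational Z)" by auto
  qed (use variational_in(1)[OF Ginf_bconf[OF Z] Ginf_valid[OF Z]] in auto)
  have "variational X = variational Y" using assms(3) by (rule ext)
  then have "range (variational X) = range (variational Y)" by (rule arg_cong)
  then show ?thesis unfolding eq[OF assms(1)] eq[OF assms(2)] .
qed

end

section \<open>Exchanging one point of an interlacing configuration\<close>

lemma nth_sorted_bij:
  "finite Z \<Longrightarrow> bij_betw (\<lambda>i. sorted_list_of_set Z ! i) {..<card Z} Z"
  using bij_betw_nth[of "sorted_list_of_set Z" "{..<card Z}" Z] by auto

text \<open>Up to sign the Vandermonde determinant may be evaluated with the new point listed last.\<close>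

lemma vandermonde_insert:
  assumes W: "finite W" and s: "s \<notin> W"
  shows "\<bar>vandermonde (insert s W)\<bar> = \<bar>vandermonde W\<bar> * (\<Prod>w\<in>W. \<bar>s - w\<bar>)"
proof -
  let ?n = "card W" and ?w = "\<lambda>i. sorted_list_of_set W ! i"
  let ?x = "\<lambda>i. if i < ?n then ?w i else s"
  have bw: "bij_betw ?w {..<?n} W"
    by (rule nth_sorted_bij[OF W])
  have "bij_betw ?x ({..<?n} \<union> {?n}) (W \<union> {s})"
  proof (rule bij_betw_combine)
    show "bij_betw ?x {..<?n} W"
      using bw by (subst bij_betw_cong[of _ _ ?w]) auto
  qed (use s in auto)
  moreover have "{..<?n} \<union> {?n} = {..<Suc ?n}" "W \<union> {s} = insert s W" by auto
  ultimately have bx: "bij_betw ?x {..<Suc ?n} (insert s W)" by simp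
  have c: "card (insert s W) = Suc ?n" using W s by simp
  have bn: "bij_betw (\<lambda>i. sorted_list_of_set (insert s W) ! i) {..<Suc ?n} (insert s W)"
    using nth_sorted_bij[of "insert s W"] W c by (simp only: finite_insert)
  obtain e where e: "\<bar>e\<bar> = 1"
    "\<And>p. alternant (Suc ?n) (\<lambda>i. sorted_list_of_set (insert s W) ! i) p = e * alternant (Suc ?n) ?x p"
    using alternant_reorder[OF bx bn] by blast
  have "\<bar>vandermonde (insert s W)\<bar> = \<bar>alternant (Suc ?n) ?x (\<lambda>j. j)\<bar>"
    unfolding vandermonde_alternant c e(2) abs_mult e(1) by simp
  also have "alternant (Suc ?n) ?x (\<lambda>j. j)
      = (\<Prod>j<?n. \<Prod>i<j. ?w j - ?w i) * (\<Prod>i<?n. s - ?w i)"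
    unfolding alternant_id prod.lessThan_Suc by (intro arg_cong2[of _ _ _ _ "(*)"] prod.cong) auto
  also have "(\<Prod>j<?n. \<Prod>i<j. ?w j - ?w i) = vandermonde W"
    by (simp add: vandermonde_def)
  also have "\<bar>vandermonde W * (\<Prod>i<?n. s - ?w i)\<bar>
      = \<bar>vandermonde W\<bar> * (\<Prod>i<?n. \<bar>s - ?w i\<bar>)"
    by (simp add: abs_mult abs_prod)
  also have "(\<Prod>i<?n. \<bar>s - ?w i\<bar>) = (\<Prod>w\<in>W. \<bar>s - w\<bar>)"
    by (rule prod.reindex_bij_betw[OF bw])
  finally show ?thesis .
qed

context qlattice
begin

text \<open>\<open>Y\<close> interlaces \<open>X\<close>, with the type information that makes sense of it.\<close>

definition below :: "nat \<Rightarrow> real set \<Rightarrow> real set \<Rightarrow> bool" where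
  "below N Y X \<longleftrightarrow> X \<in> G (Suc N) \<and> Y \<in> G N \<and> interlaces q zm zp Y X"

lemma below_tuple:
  assumes "below N Y X"
  obtains t where "t \<in> PiE {..<N} (slot X)" "Y = t ` {..<N}"
  using assms tuple_bij[of X N] by (auto simp: below_def bij_betw_def) blast

lemma tuple_below: "X \<in> G (Suc N) \<Longrightarrow> t \<in> PiE {..<N} (slot X) \<Longrightarrow> below N (t ` {..<N}) X"
  using bij_betwE[OF tuple_bij] by (auto simp: below_def)

lemma set_link_below: "X \<in> G (Suc N) \<Longrightarrow> Y \<in> set_pmf (link N X) \<Longrightarrow> below N Y X"
  using set_link by (fastforce simp: below_def)

text \<open>Sending a positive (negative) point to the right (left) end of its slot injects \<open>Y\<close>
  into \<open>X\<close> and does not decrease absolute values.\<close>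

lemma outer_injection:
  assumes "below N Y X"
  obtains f where "inj_on f Y" "f ` Y \<subseteq> X" "\<And>y. y \<in> Y \<Longrightarrow> f y = y \<or> precedes (f y) y"
proof -
  have X: "X \<in> G (Suc N)" using assms by (simp add: below_def)
  obtain t where t: "t \<in> PiE {..<N} (slot X)" "Y = t ` {..<N}" using below_tuple[OF assms] .
  let ?x = "nth_el X"
  define g where "g i = (if 0 < t i then ?x (Suc i) else ?x i)" for i
  have ts: "t i \<in> slot X i" if "i < N" for i using t(1) that by auto
  have inj_t: "inj_on t {..<N}" by (rule tuple_inj[OF X t(1)])
  have lt: "g i < g j" if "i < j" "j < N" for i j
    using nth_el_less[OF X, of i "Suc j"] nth_el_less[OF X, of i j] nth_el_less[OF X, of "Suc i" "Suc j"]
      tuple_mono[OF X t(1) that] that by (auto simp: g_def)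
  have inj: "inj_on g {..<N}"
  proof (rule inj_onI)
    fix i j assume "i \<in> {..<N}" "j \<in> {..<N}" "g i = g j"
    then show "i = j" using lt[of i j] lt[of j i] by (cases i j rule: linorder_cases) auto
  qed
  define f where "f = g \<circ> the_inv_into {..<N} t"
  have f: "f (t i) = g i" if "i < N" for i
    using that the_inv_into_f_f[OF inj_t] by (simp add: f_def)
  show thesis
  proof (rule that)
    show "inj_on f Y"
      unfolding t(2) using inj f by (auto simp: inj_on_def)
    show "f ` Y \<subseteq> X"
      unfolding t(2) using f nth_el_in[OF X] by (auto simp: g_def)
    fix y assume "y \<in> Y"
    then obtain i where i: "i < N" "y = t i" using t(2) by auto
    have "t i \<noteq> 0" using ts[OF i(1)] slot_L L_nz by blast
    then show "f y = y \<or> precedes (f y) y"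
      using slot_bounds[OF ts[OF i(1)]] f[OF i(1)] i(2) by (auto simp: g_def precedes_def)
  qed
qed

text \<open>Outward moves only create predecessors, so descending through a link cannot increase the number
  of points that precede a given one.\<close>

lemma below_preds:
  assumes "below N Y X"
  shows "card {y \<in> Y. precedes y e} \<le> card {x \<in> X. precedes x e}"
proof -
  obtain f where f: "inj_on f Y" "f ` Y \<subseteq> X" "\<And>y. y \<in> Y \<Longrightarrow> f y = y \<or> precedes (f y) y"
    using outer_injection[OF assms] by blast
  have "finite X" using assms confsD(2) by (auto simp: below_def)
  moreover have "f ` {y \<in> Y. precedes y e} \<subseteq> {x \<in> X. precedes x e}"
    using f(2,3) precedes_trans by fastforce
  ultimately show ?thesis
    using inj_on_subset[OF f(1)] by (intro card_inj_on_le[of f]) auto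
qed

lemma below_abs:
  assumes "below N Y X" "y \<in> Y"
  obtains x where "x \<in> X" "\<bar>y\<bar> \<le> \<bar>x\<bar>"
proof -
  obtain f where f: "inj_on f Y" "f ` Y \<subseteq> X" "\<And>y. y \<in> Y \<Longrightarrow> f y = y \<or> precedes (f y) y"
    using outer_injection[OF assms(1)] by blast
  have "f y \<in> X" using f(2) assms(2) by blast
  moreover have "\<bar>y\<bar> \<le> \<bar>f y\<bar>" using f(3)[OF assms(2)] precedes_abs[of "f y" y] by auto
  ultimately show thesis by (rule that)
qed

text \<open>If the first \<open>k\<close> terms of \<open>X\<close> survive in \<open>Y\<close>, no new point of \<open>Y\<close> can come before any of
  them, since the number of predecessors does not increase.\<close>

lemma agree_if_kept:
  assumes XY: "below N Y X" and kept: "\<And>i. i < k \<Longrightarrow> variational X i \<in> Y"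
  shows "agree k Y X"
  unfolding agree_def
proof (intro allI impI)
  fix i assume i: "i < k"
  have X: "X \<in> G (Suc N)" and Y: "Y \<in> G N" using XY by (auto simp: below_def)
  note bX = G_bconf[OF X] and bY = G_bconf[OF Y]
  let ?e = "variational X i"
  have v: "valid X i" using bconf_nz[OF bY kept[OF i]] variational_nz[OF bX] by simp
  have "place Y ?e \<le> i"
    using below_preds[OF XY, of ?e] variational_in(2)[OF bX v] by (simp add: place_def)
  moreover have "i \<le> place Y ?e"
  proof -
    have "variational X ` {..<i} \<subseteq> {y \<in> Y. precedes y ?e}"
    proof (rule image_subsetI)
      fix j assume "j \<in> {..<i}"
      then show "variational X j \<in> {y \<in> Y. precedes y ?e}"
        using kept[of j] i variational_precedes[OF bX v, of j] by simp
    qed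
    moreover have "{..<i} \<subseteq> {k. valid X k}" using valid_mono[OF v] by auto
    then have "card (variational X ` {..<i}) = i"
      using card_image[OF inj_on_subset[OF variational_inj[OF bX]]] by simp
    ultimately show ?thesis
      unfolding place_def
      using card_mono[of "{y \<in> Y. precedes y ?e}" "variational X ` {..<i}"] confsD(2)[OF Y] by simp
  qed
  ultimately have "place Y ?e = i" by simp
  then show "variational Y i = ?e" using variational_place[OF bY kept[OF i]] by simp
qed

text \<open>Moving any other point of the slot to \<open>e\<close> is then an outward move.\<close>

definition top_slot :: "real set \<Rightarrow> real \<Rightarrow> nat \<Rightarrow> bool" where
  "top_slot X e i \<longleftrightarrow> e \<in> slot X i \<and> (\<forall>s\<in>slot X i.
     (s = e \<or> precedes e s) \<and> (if 0 < e then s \<le> e else e \<le> s))"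

lemma top_slotD:
  assumes "top_slot X e i"
  shows "e \<in> slot X i" "s \<in> slot X i \<Longrightarrow> s = e \<or> precedes e s"
    "s \<in> slot X i \<Longrightarrow> (if 0 < e then s \<le> e else e \<le> s)"
  using assms unfolding top_slot_def by simp_all

text \<open>A point of \<open>X\<close> other than the last one of the variational series is an end of a slot all
  of whose other points come after it in the order of precedence.\<close>

lemma slot_of:
  assumes X: "X \<in> G (Suc N)" and e: "e \<in> X" and pl: "place X e < N"
  shows "\<exists>i<N. top_slot X e i"
proof -
  let ?x = "nth_el X"
  have eL: "e \<in> L" using e confsD(1)[OF X] by auto
  obtain z where z: "z \<in> X" "z \<noteq> e" "\<not> precedes z e"
  proof -
    have "{y \<in> X. precedes y e} \<noteq> X - {e}"
    proof
      assume eq: "{y \<in> X. precedes y e} = X - {e}"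
      have "place X e = N" unfolding place_def eq using e confsD[OF X] by simp
      then show False using pl by simp
    qed
    then show thesis using that precedes_irrefl by blast
  qed
  then have ez: "precedes e z" using precedes_total by blast
  have bij: "bij_betw ?x {..<Suc N} X" by (rule nth_el_bij[OF X])
  obtain j where j: "j < Suc N" "e = ?x j" using e bij by (auto simp: bij_betw_def)
  obtain m where m: "m < Suc N" "z = ?x m" using z(1) bij by (auto simp: bij_betw_def)
  show ?thesis
  proof (cases "0 < e")
    case True
    have ze: "z < e" "- e \<le> z" using ez z(2) True by (auto simp: precedes_def)
    then have "m < j" using nth_el_less[OF X, of j m] m j by (cases m j rule: linorder_cases) auto
    then obtain i where i: "j = Suc i" "m \<le> i" by (cases j) auto
    have "?x i < e" using nth_el_less[OF X, of i j] i j by simp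
    moreover have "z \<le> ?x i" using nth_el_less[OF X, of m i] i j m by (cases "m = i") auto
    ultimately have lo: "- e \<le> ?x i" "?x i < e" using ze by auto
    have "top_slot X e i"
      unfolding top_slot_def
    proof (intro conjI ballI)
      show "e \<in> slot X i"
        using lo True eL unfolding slot_def qinterval_def i(1)[symmetric] j(2)[symmetric] by simp
      fix s assume "s \<in> slot X i"
      then have "?x i \<le> s" "s \<le> e" using slot_bounds[of s X i] i(1) j(2) by auto
      then show "s = e \<or> precedes e s" "if 0 < e then s \<le> e else e \<le> s"
        using lo True by (auto simp: precedes_def)
    qed
    then show ?thesis using i j by auto
  next
    case False
    then have en: "e < 0" using L_nz[OF eL] by auto
    have ze: "e < z" "z < - e" using ez z(2) en by (auto simp: precedes_def)
    then have "j < m" using nth_el_less[OF X, of m j] m j by (cases m j rule: linorder_cases) auto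
    then have jN: "j < N" using m by simp
    have "e < ?x (Suc j)" using nth_el_less[OF X, of j "Suc j"] j jN by simp
    moreover have "?x (Suc j) \<le> z"
      using nth_el_less[OF X, of "Suc j" m] \<open>j < m\<close> m by (cases "Suc j = m") auto
    ultimately have hi: "?x (Suc j) < - e" "e < ?x (Suc j)" using ze by auto
    have "top_slot X e j"
      unfolding top_slot_def
    proof (intro conjI ballI)
      show "e \<in> slot X j"
        using hi en eL unfolding slot_def qinterval_def j(2)[symmetric] by simp
      fix s assume "s \<in> slot X j"
      then have "e \<le> s" "s \<le> ?x (Suc j)" using slot_bounds[of s X j] j(2) by auto
      then show "s = e \<or> precedes e s" "if 0 < e then s \<le> e else e \<le> s"
        using hi en by (auto simp: precedes_def)
    qed
    then show ?thesis using jN by blast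
  qed
qed

lemma below_slot:
  assumes XY: "below N Y X" and i: "i < N"
  obtains s where "s \<in> Y" "s \<in> slot X i"
  using below_tuple[OF XY] i by (metis PiE_mem imageI lessThan_iff)

text \<open>Slots are disjoint, so \<open>Y\<close> has exactly one point in each. Replacing it within its slot
  preserves interlacing, and no other point of \<open>Y\<close> lies between the old and the new position.\<close>

lemma exchange_below:
  assumes XY: "below N Y X" and i: "i < N" and s: "s \<in> Y" "s \<in> slot X i" and e: "e \<in> slot X i"
  shows "below N (insert e (Y - {s})) X" and "e \<in> Y \<Longrightarrow> e = s"
    and "w \<in> Y - {s} \<Longrightarrow> (\<forall>u\<in>slot X i. w < u) \<or> (\<forall>u\<in>slot X i. u < w)"
proof -
  have X: "X \<in> G (Suc N)" using XY by (simp add: below_def)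
  obtain t where t: "t \<in> PiE {..<N} (slot X)" "Y = t ` {..<N}" using below_tuple[OF XY] .
  have ts: "t j \<in> slot X j" if "j < N" for j using t(1) that by auto
  have same: "j = i" if "j < N" "t j \<in> slot X i" for j
  proof (cases i j rule: linorder_cases)
    case less
    then show ?thesis using slot_less[OF X less that(1) that(2) ts[OF that(1)]] by simp
  next
    case greater
    then show ?thesis using slot_less[OF X greater i ts[OF that(1)] that(2)] by simp
  qed simp
  have ti: "t i = s" using s t(2) same by auto
  show "e = s" if "e \<in> Y"
    using that t(2) same e ti by auto
  have inj: "inj_on t {..<N}" by (rule tuple_inj[OF X t(1)])
  have Ys: "Y - {s} = t ` ({..<N} - {i})"
    using inj_on_image_set_diff[OF inj, of "{..<N}" "{i}"] i t(2) ti by simp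
  have "t(i := e) \<in> PiE {..<N} (slot X)" using t(1) e i by (auto simp: PiE_iff extensional_def)
  then have "below N ((t(i := e)) ` {..<N}) X" by (rule tuple_below[OF X])
  moreover have "(t(i := e)) ` {..<N} = insert e (Y - {s})"
    unfolding Ys using i by (auto simp: image_iff)
  ultimately show "below N (insert e (Y - {s})) X" by simp
  assume "w \<in> Y - {s}"
  then obtain j where j: "j < N" "j \<noteq> i" "w = t j" using Ys by auto
  then show "(\<forall>u\<in>slot X i. w < u) \<or> (\<forall>u\<in>slot X i. u < w)"
    using slot_less[OF X, of i j] slot_less[OF X, of j i] ts[OF j(1)] i
    by (cases i j rule: linorder_cases) auto
qed

lemma pmf_link_insert:
  assumes b: "below N (insert s W) X" and s: "s \<notin> W"
  shows "pmf (link N X) (insert s W)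
    = (\<Prod>w\<in>W. \<bar>w\<bar>) * (\<Prod>i=1..N. 1 - q ^ i) * (\<bar>vandermonde W\<bar> / vandermonde X)
      * (\<bar>s\<bar> * (\<Prod>w\<in>W. \<bar>s - w\<bar>))"
proof -
  have X: "X \<in> G (Suc N)" and Y: "insert s W \<in> G N" and i: "interlaces q zm zp (insert s W) X"
    using b by (auto simp: below_def)
  have W: "finite W" using confsD(2)[OF Y] by simp
  have "vandermonde (insert s W) = \<bar>vandermonde W\<bar> * (\<Prod>w\<in>W. \<bar>s - w\<bar>)"
    using vandermonde_insert[OF W s] vandermonde_pos[OF Y] by simp
  then show ?thesis using pmf_link[OF X] Y i W s by (simp add: qlink_def)
qed

text \<open>Moving the point of a slot from \<open>s\<close> to \<open>e\<close> is injective and changes the weight by an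
  explicit factor. If that factor is bounded below, the weights at \<open>s\<close> are dominated by
  weights at \<open>e\<close>, whose sum is at most 1.\<close>

lemma exchange:
  assumes X: "X \<in> G (Suc N)" and i: "i < N" and s: "s \<in> slot X i" and e: "e \<in> slot X i"
    and r: "\<And>Y. below N Y X \<Longrightarrow> s \<in> Y \<Longrightarrow>
      \<bar>s\<bar> * (\<Prod>w\<in>Y - {s}. \<bar>s - w\<bar>) \<le> r * (\<bar>e\<bar> * (\<Prod>w\<in>Y - {s}. \<bar>e - w\<bar>))"
    and r0: "0 \<le> r"
  shows "measure_pmf.prob (link N X) {Y. s \<in> Y} \<le> r"
proof (rule prob_le_finite)
  fix F assume F: "finite F" "F \<subseteq> {Y. s \<in> Y}"
  let ?F = "{Y \<in> F. below N Y X}" and ?p = "pmf (link N X)"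
  define \<phi> where "\<phi> Y = insert e (Y - {s})" for Y
  have "(\<Sum>Y\<in>F. ?p Y) = (\<Sum>Y\<in>?F. ?p Y)"
  proof (rule sum.mono_neutral_right)
    show "\<forall>Y\<in>F - ?F. ?p Y = 0" using set_link_below[OF X] by (auto simp: set_pmf_iff)
  qed (use F in auto)
  also have "\<dots> \<le> (\<Sum>Y\<in>?F. r * ?p (\<phi> Y))"
  proof (rule sum_mono)
    fix Y assume "Y \<in> ?F"
    then have Y: "below N Y X" "s \<in> Y" using F by auto
    let ?W = "Y - {s}"
    have ins: "insert s ?W = Y" using Y(2) by auto
    have eW: "e \<notin> ?W" using exchange_below(2)[OF Y(1) i Y(2) s e] by auto
    define c where "c = (\<Prod>w\<in>?W. \<bar>w\<bar>) * (\<Prod>i=1..N. 1 - q ^ i) * (\<bar>vandermonde ?W\<bar> / vandermonde X)"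
    have c: "0 \<le> c"
      unfolding c_def using vandermonde_pos[OF X] q0 q1
      by (intro mult_nonneg_nonneg prod_nonneg divide_nonneg_pos) (auto simp: power_le_one)
    have "?p Y = c * (\<bar>s\<bar> * (\<Prod>w\<in>?W. \<bar>s - w\<bar>))"
      using pmf_link_insert[of N s ?W X] Y(1) ins by (simp add: c_def)
    also have "\<dots> \<le> c * (r * (\<bar>e\<bar> * (\<Prod>w\<in>?W. \<bar>e - w\<bar>)))"
      using r[OF Y] c by (rule mult_left_mono)
    also have "\<dots> = r * ?p (\<phi> Y)"
      using pmf_link_insert[OF exchange_below(1)[OF Y(1) i Y(2) s e] eW] by (simp add: c_def \<phi>_def)
    finally show "?p Y \<le> r * ?p (\<phi> Y)" .
  qed
  also have "\<dots> = r * (\<Sum>Z\<in>\<phi> ` ?F. ?p Z)"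
  proof -
    have "inj_on \<phi> ?F"
    proof (rule inj_on_inverseI[of _ "\<lambda>Z. insert s (Z - {e})"])
      fix Y assume "Y \<in> ?F"
      then have Y: "below N Y X" "s \<in> Y" using F by auto
      show "insert s (\<phi> Y - {e}) = Y"
        using exchange_below(2)[OF Y(1) i Y(2) s e] Y(2) by (auto simp: \<phi>_def)
    qed
    then show ?thesis by (simp add: sum.reindex sum_distrib_left)
  qed
  also have "\<dots> \<le> r * 1"
    using mult_left_mono[OF _ r0, of "\<Sum>Z\<in>\<phi> ` ?F. ?p Z" 1] measure_measure_pmf_finite[of "\<phi> ` ?F" "link N X"] F measure_pmf.prob_le_1[of "link N X" "\<phi> ` ?F"] by simp
  finally show "(\<Sum>Y\<in>F. ?p Y) \<le> r" by simp
qed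

text \<open>Summing the exchange bound over the positions \<open>s\<close> costs only a constant factor
  because the grid is a union of two geometric progressions.\<close>

lemma exchange_set:
  assumes X: "X \<in> G (Suc N)" and i: "i < N" and S: "S \<subseteq> slot X i" and e: "e \<in> slot X i"
    and B: "\<And>Y s. below N Y X \<Longrightarrow> s \<in> Y \<Longrightarrow> s \<in> S \<Longrightarrow>
      (\<Prod>w\<in>Y - {s}. \<bar>s - w\<bar>) \<le> B * (\<Prod>w\<in>Y - {s}. \<bar>e - w\<bar>)"
    and B0: "0 \<le> B" and d: "\<And>s. s \<in> S \<Longrightarrow> \<bar>s\<bar> \<le> d" "0 \<le> d"
  shows "measure_pmf.prob (link N X) {Y. Y \<inter> S \<noteq> {}} \<le> B * (2 * d / (1 - q)) / \<bar>e\<bar>"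
proof (rule prob_le_finite)
  fix F assume F: "finite F" "F \<subseteq> {Y. Y \<inter> S \<noteq> {}}"
  let ?F = "{Y \<in> F. below N Y X}" and ?P = "measure_pmf.prob (link N X)"
  \<comment> \<open>Only finitely many positions matter for the finite family \<open>F\<close>.\<close>
  define T where "T = (\<Union>Y\<in>?F. Y \<inter> S)"
  have e0: "0 < \<bar>e\<bar>" using L_nz[OF subsetD[OF slot_L e]] by simp
  have "finite (Y \<inter> S)" if "Y \<in> ?F" for Y
    using that confsD(2)[of Y N] by (simp add: below_def)
  then have "finite T" unfolding T_def using F(1) by (intro finite_UN_I) auto
  moreover have "T \<subseteq> S" unfolding T_def by blast
  ultimately have T: "finite T" "T \<subseteq> S" by auto
  have "(\<Sum>Y\<in>F. pmf (link N X) Y) = ?P F" using F by (simp add: measure_measure_pmf_finite)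
  also have "\<dots> \<le> ?P (\<Union>s\<in>T. {Y. s \<in> Y})"
  proof (rule prob_mono_pmf)
    fix Y assume Y: "Y \<in> set_pmf (link N X)" "Y \<in> F"
    then obtain s where "s \<in> Y" "s \<in> S" using F by blast
    moreover have "Y \<in> ?F" using Y set_link_below[OF X] by simp
    ultimately show "Y \<in> (\<Union>s\<in>T. {Y. s \<in> Y})" unfolding T_def by blast
  qed
  also have "\<dots> \<le> (\<Sum>s\<in>T. ?P {Y. s \<in> Y})"
    by (rule measure_UNION_le) (use T in auto)
  also have "\<dots> \<le> (\<Sum>s\<in>T. B / \<bar>e\<bar> * \<bar>s\<bar>)"
  proof (rule sum_mono)
    fix s assume "s \<in> T"
    then have s: "s \<in> S" "s \<in> slot X i" using T S by auto
    show "?P {Y. s \<in> Y} \<le> B / \<bar>e\<bar> * \<bar>s\<bar>"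
    proof (rule exchange[OF X i s(2) e])
      fix Y assume Y: "below N Y X" "s \<in> Y"
      show "\<bar>s\<bar> * (\<Prod>w\<in>Y - {s}. \<bar>s - w\<bar>)
          \<le> B / \<bar>e\<bar> * \<bar>s\<bar> * (\<bar>e\<bar> * (\<Prod>w\<in>Y - {s}. \<bar>e - w\<bar>))"
      proof -
        have "B / \<bar>e\<bar> * \<bar>s\<bar> * (\<bar>e\<bar> * (\<Prod>w\<in>Y - {s}. \<bar>e - w\<bar>))
            = \<bar>s\<bar> * (B * (\<Prod>w\<in>Y - {s}. \<bar>e - w\<bar>))" using e0 by simp
        then show ?thesis using mult_left_mono[OF B[OF Y s(1)], of "\<bar>s\<bar>"] by simp
      qed
    qed (use B0 e0 in auto)
  qed
  also have "\<dots> = B / \<bar>e\<bar> * (\<Sum>s\<in>T. \<bar>s\<bar>)" by (simp add: sum_distrib_left)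
  also have "\<dots> \<le> B / \<bar>e\<bar> * (2 * d / (1 - q))"
  proof (rule mult_left_mono)
    have "T \<subseteq> L" using T(2) S slot_L by blast
    then show "(\<Sum>s\<in>T. \<bar>s\<bar>) \<le> 2 * d / (1 - q)"
      using T d by (intro finite_sum_L) auto
  qed (use B0 e0 in auto)
  finally show "(\<Sum>Y\<in>F. pmf (link N X) Y) \<le> B * (2 * d / (1 - q)) / \<bar>e\<bar>"
    by (simp only: times_divide_eq_left)
qed

text \<open>Moving a point of \<open>Y\<close> from \<open>s\<close> outwards to \<open>e\<close> changes its distance to another point \<open>w\<close>.
  \<open>\<rho>\<close> is the gain guaranteed for each \<open>w\<close> that is not farther from 0 than \<open>e\<close>; \<open>\<kappa>\<close> bounds
  the loss for the others.\<close>

definition \<rho> :: real where "\<rho> = (1 + q) / 2"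
definition \<kappa> :: real where "\<kappa> = 2 / (1 - q)"

lemma \<rho>_bounds: "0 < \<rho>" "\<rho> < 1" and \<kappa>_gt: "1 < \<kappa>" "0 < \<kappa>"
  using q0 q1 by (auto simp: \<rho>_def \<kappa>_def field_simps)

text \<open>The extreme case for \<open>\<rho>\<close> is \<open>s = q * e\<close>, \<open>w = - e\<close>. For \<open>w\<close> beyond \<open>e\<close> the numerator is
  at most \<open>2 * \<bar>w\<bar>\<close> and the denominator at least \<open>(1 - q) * \<bar>w\<bar>\<close>. By reflection it suffices to treat
  positive \<open>e\<close>.\<close>

lemma exchange_ratio:
  assumes sL: "s \<in> L" and eL: "e \<in> L" and wL: "w \<in> L" and se: "precedes e s"
    and side: "if 0 < e then s \<le> e else e \<le> s"
    and w: "w < s \<and> w < e \<or> s < w \<and> e < w"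
  shows "\<bar>s - w\<bar> \<le> (if \<bar>w\<bar> \<le> \<bar>e\<bar> then \<rho> else \<kappa>) * \<bar>e - w\<bar>"
proof -
  have main: "\<bar>s - w\<bar> \<le> (if \<bar>w\<bar> \<le> \<bar>e\<bar> then \<rho> else \<kappa>) * \<bar>e - w\<bar>"
    if e: "0 < e" and s: "s \<le> q * e" and as: "\<bar>s\<bar> \<le> e" and we: "e < w \<Longrightarrow> e \<le> q * w"
      and w: "w < s \<and> w < e \<or> s < w \<and> e < w" for e s w :: real
    using w
  proof
    assume w: "w < s \<and> w < e"
    show ?thesis
    proof (cases "\<bar>w\<bar> \<le> \<bar>e\<bar>")
      case True
      have "(\<rho> - q) * e = (1 - \<rho>) * e" by (simp add: \<rho>_def field_simps)
      moreover have "(1 - \<rho>) * (- e) \<le> (1 - \<rho>) * w"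
        using True e \<rho>_bounds by (intro mult_left_mono) auto
      ultimately have "s - w \<le> \<rho> * (e - w)" using s by (simp add: algebra_simps)
      then show ?thesis using True w by simp
    next
      case False
      have "s - w \<le> 1 * (e - w)" using as by auto
      also have "\<dots> \<le> \<kappa> * (e - w)" using w \<kappa>_gt by (intro mult_right_mono) auto
      finally show ?thesis using False w by simp
    qed
  next
    assume w: "s < w \<and> e < w"
    have "w - s \<le> 2 * w" using as w by auto
    also have "\<dots> = \<kappa> * ((1 - q) * w)" using q1 by (simp add: \<kappa>_def)
    also have "\<dots> \<le> \<kappa> * (w - e)"
      using we w \<kappa>_gt by (intro mult_left_mono) (auto simp: algebra_simps)
    finally show ?thesis using w e by simp
  qed
  have sq: "s \<le> q * e" if "0 < e"
  proof (cases "0 < s")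
    case True
    then show ?thesis using L_gap[OF sL eL] se that by (auto simp: precedes_def)
  next
    case False
    then show ?thesis using mult_pos_pos[OF q0 that] by linarith
  qed
  have sq': "- s \<le> q * - e" if "e < 0"
  proof (cases "s < 0")
    case True
    then show ?thesis using L_gap[OF sL eL] se side that by (auto simp: precedes_def)
  next
    case False
    then have "q * e \<le> s" using mult_pos_neg[OF q0 that] by linarith
    then show ?thesis by simp
  qed
  have ae: "\<bar>s\<bar> \<le> \<bar>e\<bar>" using se by (rule precedes_abs)
  show ?thesis
  proof (cases "0 < e")
    case True
    show ?thesis
      by (rule main[OF True sq[OF True]]) (use ae True L_gap[OF eL wL] w in auto)
  next
    case False
    then have en: "e < 0" using L_nz[OF eL] by auto
    have "\<bar>- s - - w\<bar> \<le> (if \<bar>- w\<bar> \<le> \<bar>- e\<bar> then \<rho> else \<kappa>) * \<bar>- e - - w\<bar>"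
      by (rule main[OF _ sq'[OF en]]) (use ae en L_gap[OF eL wL] w in auto)
    moreover have "\<bar>- s - - w\<bar> = \<bar>s - w\<bar>" "\<bar>- e - - w\<bar> = \<bar>e - w\<bar>" by linarith+
    ultimately show ?thesis by (simp only: abs_minus_cancel)
  qed
qed

text \<open>All but \<open>place X e\<close> of the other \<open>N - 1\<close> points of \<open>Y\<close> contribute the factor \<open>\<rho>\<close>, because the
  points beyond \<open>e\<close> are among its predecessors.\<close>

lemma exchange_ratio_prod:
  assumes XY: "below N Y X" and i: "i < N" and s: "s \<in> Y" "s \<in> slot X i" and e: "e \<in> slot X i"
    and es: "precedes e s" and side: "if 0 < e then s \<le> e else e \<le> s"
  shows "(\<Prod>w\<in>Y - {s}. \<bar>s - w\<bar>)
    \<le> (\<kappa> / \<rho>) ^ place X e * \<rho> ^ (N - 1) * (\<Prod>w\<in>Y - {s}. \<bar>e - w\<bar>)"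
proof -
  have Y: "Y \<in> G N" using XY by (simp add: below_def)
  have fin: "finite Y" by (rule confsD(2)[OF Y])
  let ?W = "Y - {s}"
  let ?h = "\<lambda>w. if \<bar>w\<bar> \<le> \<bar>e\<bar> then \<rho> else \<kappa>"
  let ?B = "{w \<in> ?W. \<not> \<bar>w\<bar> \<le> \<bar>e\<bar>}"
  have sL: "s \<in> L" and eL: "e \<in> L" using s(2) e slot_L by auto
  have "(\<Prod>w\<in>?W. \<bar>s - w\<bar>) \<le> (\<Prod>w\<in>?W. ?h w * \<bar>e - w\<bar>)"
  proof (rule prod_mono)
    fix w assume w: "w \<in> ?W"
    have wL: "w \<in> L" using w confsD(1)[OF Y] by auto
    have "w < s \<and> w < e \<or> s < w \<and> e < w" using exchange_below(3)[OF XY i s e w] s(2) e by auto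
    then show "0 \<le> \<bar>s - w\<bar> \<and> \<bar>s - w\<bar> \<le> ?h w * \<bar>e - w\<bar>"
      using exchange_ratio[OF sL eL wL es side] by simp
  qed
  also have "\<dots> = (\<Prod>w\<in>?W. ?h w) * (\<Prod>w\<in>?W. \<bar>e - w\<bar>)" by (rule prod.distrib)
  also have "(\<Prod>w\<in>?W. ?h w) = (\<Prod>w\<in>?W. \<rho> * (if w \<in> ?B then \<kappa> / \<rho> else 1))"
    by (rule prod.cong) (use \<rho>_bounds in auto)
  also have "\<dots> = \<rho> ^ card ?W * (\<kappa> / \<rho>) ^ card ?B"
  proof -
    have "?W \<inter> ?B = ?B" by auto
    then have "(\<Prod>w\<in>?W. if w \<in> ?B then \<kappa> / \<rho> else 1) = (\<kappa> / \<rho>) ^ card ?B"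
      using prod.inter_restrict[of ?W "\<lambda>_. \<kappa> / \<rho>" ?B] fin by simp
    then show ?thesis by (simp only: prod.distrib prod_constant)
  qed
  also have "card ?W = N - 1" using confsD(3)[OF Y] s(1) fin by simp
  also have "\<rho> ^ (N - 1) * (\<kappa> / \<rho>) ^ card ?B * (\<Prod>w\<in>?W. \<bar>e - w\<bar>)
      \<le> \<rho> ^ (N - 1) * (\<kappa> / \<rho>) ^ place X e * (\<Prod>w\<in>?W. \<bar>e - w\<bar>)"
  proof -
    have "card ?B \<le> card {w \<in> Y. precedes w e}"
      using fin by (intro card_mono) (auto simp: precedes_def)
    also have "\<dots> \<le> place X e" unfolding place_def by (rule below_preds[OF XY])
    finally have "(\<kappa> / \<rho>) ^ card ?B \<le> (\<kappa> / \<rho>) ^ place X e"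
      using \<rho>_bounds \<kappa>_gt by (intro power_increasing) auto
    then show ?thesis
      using \<rho>_bounds by (intro mult_right_mono mult_left_mono prod_nonneg) auto
  qed
  finally show ?thesis by (simp add: mult.commute)
qed

subsection \<open>The variational series stabilizes under the links\<close>

text \<open>With overwhelming probability, exponentially close to 1 in \<open>N\<close> and uniformly in
  \<open>X\<close>, a given term of the variational series survives a link: at most \<open>k\<close> points of \<open>Y\<close>
  exceed it in absolute value, and each of the others contributes a factor \<open>\<rho> < 1\<close> to the
  weight ratio.\<close>

lemma link_keeps_term:
  assumes X: "X \<in> G (Suc N)" and k: "k < N"
  shows "measure_pmf.prob (link N X) {Y. variational X k \<notin> Y}
    \<le> (\<kappa> / \<rho>) ^ k * \<rho> ^ (N - 1) * \<kappa>"
proof -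
  let ?e = "variational X k"
  note bX = G_bconf[OF X]
  have v: "valid X k" using k G_valid[OF X] by simp
  note ve = variational_in[OF bX v]
  have pl: "place X ?e < N" using ve(2) k by simp
  obtain i where iN: "i < N" and ts: "top_slot X ?e i" using slot_of[OF X ve(1) pl] by auto
  note i = iN top_slotD[OF ts]
  let ?S = "slot X i - {?e}"
  have e0: "0 < \<bar>?e\<bar>" using bconf_nz[OF bX ve(1)] by simp
  have "measure_pmf.prob (link N X) {Y. ?e \<notin> Y} \<le> measure_pmf.prob (link N X) {Y. Y \<inter> ?S \<noteq> {}}"
  proof (rule prob_mono_pmf)
    fix Y assume Y: "Y \<in> set_pmf (link N X)" "Y \<in> {Y. ?e \<notin> Y}"
    then obtain s where "s \<in> Y" "s \<in> slot X i"
      using below_slot[OF set_link_below[OF X Y(1)] i(1)] by blast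
    then show "Y \<in> {Y. Y \<inter> ?S \<noteq> {}}" using Y(2) by auto
  qed
  also have "\<dots> \<le> (\<kappa> / \<rho>) ^ k * \<rho> ^ (N - 1) * (2 * \<bar>?e\<bar> / (1 - q)) / \<bar>?e\<bar>"
  proof (rule exchange_set[OF X i(1) _ i(2)])
    fix Y s assume Y: "below N Y X" "s \<in> Y" "s \<in> ?S"
    show "(\<Prod>w\<in>Y - {s}. \<bar>s - w\<bar>) \<le> (\<kappa> / \<rho>) ^ k * \<rho> ^ (N - 1) * (\<Prod>w\<in>Y - {s}. \<bar>?e - w\<bar>)"
    proof -
      have s: "s \<in> slot X i" "precedes ?e s" using Y(3) i(3)[of s] by auto
      from exchange_ratio_prod[OF Y(1) i(1) Y(2) s(1) i(2) s(2) i(4)[OF s(1)]]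
      show ?thesis unfolding ve(2) .
    qed
  next
    fix s assume "s \<in> ?S"
    then have "precedes ?e s" using i(3)[of s] by auto
    then show "\<bar>s\<bar> \<le> \<bar>?e\<bar>" by (rule precedes_abs)
  next
    show "0 \<le> (\<kappa> / \<rho>) ^ k * \<rho> ^ (N - 1)"
      using \<rho>_bounds \<kappa>_gt by (intro mult_nonneg_nonneg zero_le_power divide_nonneg_nonneg) simp_all
  qed auto
  also have "\<dots> = (\<kappa> / \<rho>) ^ k * \<rho> ^ (N - 1) * (2 * \<bar>?e\<bar> / (1 - q) / \<bar>?e\<bar>)"
    by (rule times_divide_eq_right[symmetric])
  also have "2 * \<bar>?e\<bar> / (1 - q) / \<bar>?e\<bar> = \<kappa>" using e0 unfolding \<kappa>_def by simp
  finally show ?thesis .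
qed

text \<open>The union bound over the first \<open>k\<close> terms. For \<open>N\<close> up to \<open>k\<close> the constant is so large that
  the claim is trivial.\<close>

lemma link_stable:
  obtains C where "0 \<le> C" "\<And>N X. X \<in> G (Suc N) \<Longrightarrow>
    measure_pmf.prob (link N X) {Y. \<not> agree k Y X} \<le> C * \<rho> ^ N"
proof
  define A where "A = (\<Sum>i<k. (\<kappa> / \<rho>) ^ i * \<kappa> / \<rho>)"
  define C where "C = A + 1 / \<rho> ^ k"
  have A0: "0 \<le> A" unfolding A_def using \<rho>_bounds \<kappa>_gt by (intro sum_nonneg) auto
  then show "0 \<le> C" using \<rho>_bounds by (simp add: C_def)
  fix N X assume X: "X \<in> G (Suc N)"
  let ?P = "measure_pmf.prob (link N X)"
  show "?P {Y. \<not> agree k Y X} \<le> C * \<rho> ^ N"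
  proof (cases "k \<le> N \<and> 0 < N")
    case True
    have "?P {Y. \<not> agree k Y X} \<le> ?P (\<Union>i\<in>{..<k}. {Y. variational X i \<notin> Y})"
    proof (rule prob_mono_pmf)
      fix Y assume Y: "Y \<in> set_pmf (link N X)" "Y \<in> {Y. \<not> agree k Y X}"
      then have "\<exists>i<k. variational X i \<notin> Y"
        using agree_if_kept[OF set_link_below[OF X Y(1)], of k] by blast
      then show "Y \<in> (\<Union>i\<in>{..<k}. {Y. variational X i \<notin> Y})" by auto
    qed
    also have "\<dots> \<le> (\<Sum>i<k. ?P {Y. variational X i \<notin> Y})" by (rule measure_UNION_le) auto
    also have "\<dots> \<le> (\<Sum>i<k. (\<kappa> / \<rho>) ^ i * \<rho> ^ (N - 1) * \<kappa>)"
      using True by (intro sum_mono link_keeps_term[OF X]) auto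
    also have "\<dots> = A * \<rho> ^ N"
    proof -
      have "\<rho> ^ N = \<rho> * \<rho> ^ (N - 1)" using True by (cases N) auto
      then have "A * \<rho> ^ N = (\<Sum>i<k. (\<kappa> / \<rho>) ^ i * \<kappa> / \<rho> * (\<rho> * \<rho> ^ (N - 1)))"
        by (simp only: A_def sum_distrib_right)
      then show ?thesis using \<rho>_bounds by (simp add: algebra_simps)
    qed
    also have "\<dots> \<le> C * \<rho> ^ N" using \<rho>_bounds by (intro mult_right_mono) (auto simp: C_def)
    finally show ?thesis .
  next
    case False
    then have "N \<le> k" by auto
    then have "\<rho> ^ k \<le> \<rho> ^ N" using \<rho>_bounds by (intro power_decreasing) auto
    then have "1 \<le> 1 / \<rho> ^ k * \<rho> ^ N" using \<rho>_bounds by simp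
    also have "\<dots> \<le> C * \<rho> ^ N"
      using \<rho>_bounds A0 by (intro mult_right_mono) (auto simp: C_def)
    finally show ?thesis using measure_pmf.prob_le_1[of "link N X"] by (rule order_trans[rotated])
  qed
qed

text \<open>Similarly a link does not push more points towards 0 than it has to: for each of the first
  \<open>min k N\<close> terms of the variational series, \<open>Y\<close> has a point in a slot of its own which is
  unlikely to be close to 0.\<close>

lemma link_large_points:
  assumes X: "X \<in> G (Suc N)" and \<eta>: "0 < \<eta>" and k: "k \<le> card {x \<in> X. \<eta> \<le> \<bar>x\<bar>}"
    and \<delta>: "0 \<le> \<delta>"
  shows "measure_pmf.prob (link N X) {Y. card {y \<in> Y. \<delta> \<le> \<bar>y\<bar>} < min k N}
    \<le> real k * ((\<kappa> / \<rho>) ^ N * \<kappa> * \<delta> / \<eta>)"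
proof -
  let ?m = "min k N" and ?P = "measure_pmf.prob (link N X)" and ?e = "variational X"
  note bX = G_bconf[OF X]
  have v: "valid X j" if "j < ?m" for j using that G_valid[OF X] by simp
  note ve = variational_in[OF bX v]
  have big: "\<eta> \<le> \<bar>?e j\<bar>" if j: "j < ?m" for j
  proof (rule ccontr)
    assume "\<not> \<eta> \<le> \<bar>?e j\<bar>"
    then have "{x \<in> X. \<eta> \<le> \<bar>x\<bar>} \<subseteq> {x \<in> X. precedes x (?e j)}" by (auto simp: precedes_def)
    then have "card {x \<in> X. \<eta> \<le> \<bar>x\<bar>} \<le> place X (?e j)"
      unfolding place_def using confsD(2)[OF X] by (intro card_mono) auto
    then show False using ve(2)[OF j] j k by simp
  qed
  have "\<forall>j. \<exists>i. j < ?m \<longrightarrow> i < N \<and> top_slot X (?e j) i"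
  proof
    fix j
    show "\<exists>i. j < ?m \<longrightarrow> i < N \<and> top_slot X (?e j) i"
      using slot_of[OF X ve(1)[of j]] ve(2)[of j] by (cases "j < ?m") auto
  qed
  from choice[OF this] obtain \<sigma> where "\<forall>j. j < ?m \<longrightarrow> \<sigma> j < N \<and> top_slot X (?e j) (\<sigma> j)" ..
  then have \<sigma>N: "\<sigma> j < N" and \<sigma>t: "top_slot X (?e j) (\<sigma> j)" if "j < ?m" for j
    using that by simp_all
  note \<sigma> = \<sigma>N top_slotD(1)[OF \<sigma>t] and \<sigma>' = top_slotD(2,3)[OF \<sigma>t]
  have inj: "inj_on \<sigma> {..<?m}"
  proof (rule inj_onI)
    fix i j assume ij: "i \<in> {..<?m}" "j \<in> {..<?m}" "\<sigma> i = \<sigma> j"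
    have i: "i < ?m" and j: "j < ?m" using ij by simp_all
    have "?e j \<in> slot X (\<sigma> i)" using \<sigma>(2)[OF j] ij(3) by simp
    then have 1: "?e j = ?e i \<or> precedes (?e i) (?e j)" by (rule \<sigma>'(1)[OF i])
    have "?e i \<in> slot X (\<sigma> j)" using \<sigma>(2)[OF i] ij(3) by simp
    then have 2: "?e i = ?e j \<or> precedes (?e j) (?e i)" by (rule \<sigma>'(1)[OF j])
    have "?e i = ?e j" using 1 2 precedes_trans[of "?e i" "?e j" "?e i"] precedes_irrefl[of "?e i"] by argo
    then have "place X (?e i) = place X (?e j)" by (rule arg_cong)
    then show "i = j" unfolding ve(2)[OF i] ve(2)[OF j] .
  qed
  let ?S = "\<lambda>j. {s \<in> slot X (\<sigma> j). \<bar>s\<bar> \<le> \<delta>}"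
  have "?P {Y. card {y \<in> Y. \<delta> \<le> \<bar>y\<bar>} < ?m} \<le> ?P (\<Union>j\<in>{..<?m}. {Y. Y \<inter> ?S j \<noteq> {}})"
  proof (rule prob_mono_pmf, rule ccontr)
    fix Y assume Y: "Y \<in> set_pmf (link N X)" "Y \<in> {Y. card {y \<in> Y. \<delta> \<le> \<bar>y\<bar>} < ?m}"
      and none: "Y \<notin> (\<Union>j\<in>{..<?m}. {Y. Y \<inter> ?S j \<noteq> {}})"
    have XY: "below N Y X" by (rule set_link_below[OF X Y(1)])
    have finY: "finite Y" using XY confsD(2)[of Y N] by (simp add: below_def)
    have "\<forall>j. \<exists>s. j < ?m \<longrightarrow> s \<in> Y \<and> s \<in> slot X (\<sigma> j)"
      using below_slot[OF XY \<sigma>(1)] by blast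
    from choice[OF this] obtain t where "\<forall>j. j < ?m \<longrightarrow> t j \<in> Y \<and> t j \<in> slot X (\<sigma> j)" ..
    then have t: "t j \<in> Y \<and> t j \<in> slot X (\<sigma> j)" if "j < ?m" for j using that by blast
    have "t ` {..<?m} \<subseteq> {y \<in> Y. \<delta> \<le> \<bar>y\<bar>}"
    proof (rule image_subsetI)
      fix j assume j: "j \<in> {..<?m}"
      then have "\<not> \<bar>t j\<bar> \<le> \<delta>" using t[of j] none by fast
      then show "t j \<in> {y \<in> Y. \<delta> \<le> \<bar>y\<bar>}" using t[of j] j by simp
    qed
    moreover have "inj_on t {..<?m}"
    proof (rule inj_onI)
      fix i j assume ij: "i \<in> {..<?m}" "j \<in> {..<?m}" "t i = t j"
      have ti: "t i \<in> slot X (\<sigma> i)" "t i \<in> slot X (\<sigma> j)" using t[of i] t[of j] ij by auto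
      have i: "i < ?m" and j: "j < ?m" using ij by simp_all
      have "\<not> \<sigma> i < \<sigma> j" using slot_less[OF X _ \<sigma>(1)[OF j] ti(1) ti(2)] by blast
      moreover have "\<not> \<sigma> j < \<sigma> i" using slot_less[OF X _ \<sigma>(1)[OF i] ti(2) ti(1)] by blast
      ultimately have "\<sigma> i = \<sigma> j" by simp
      then show "i = j" using inj_onD[OF inj _ ij(1) ij(2)] by simp
    qed
    ultimately have "?m \<le> card {y \<in> Y. \<delta> \<le> \<bar>y\<bar>}"
      using card_inj_on_le[of t "{..<?m}" "{y \<in> Y. \<delta> \<le> \<bar>y\<bar>}"] finY by simp
    moreover have "card {y \<in> Y. \<delta> \<le> \<bar>y\<bar>} < ?m" using Y(2) by (rule CollectD)
    ultimately show False by simp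
  qed
  also have "\<dots> \<le> (\<Sum>j<?m. ?P {Y. Y \<inter> ?S j \<noteq> {}})" by (rule measure_UNION_le) auto
  also have "\<dots> \<le> (\<Sum>j<?m. (\<kappa> / \<rho>) ^ N * \<kappa> * \<delta> / \<eta>)"
  proof (rule sum_mono)
    fix j assume "j \<in> {..<?m}"
    then have j: "j < ?m" by simp
    have e0: "0 < \<bar>?e j\<bar>" using bconf_nz[OF bX ve(1)[OF j]] by simp
    have "?P {Y. Y \<inter> ?S j \<noteq> {}} \<le> (\<kappa> / \<rho>) ^ N * (2 * \<delta> / (1 - q)) / \<bar>?e j\<bar>"
    proof (rule exchange_set[OF X \<sigma>(1)[OF j] _ \<sigma>(2)[OF j]])
      fix Y s assume Y: "below N Y X" "s \<in> Y" "s \<in> ?S j"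
      let ?D = "\<Prod>w\<in>Y - {s}. \<bar>?e j - w\<bar>"
      have D0: "0 \<le> ?D" by (rule prod_nonneg) simp
      have kr: "1 \<le> \<kappa> / \<rho>" using \<rho>_bounds \<kappa>_gt by simp
      consider "s = ?e j" | "precedes (?e j) s" using \<sigma>'(1)[OF j, of s] Y(3) by auto
      then show "(\<Prod>w\<in>Y - {s}. \<bar>s - w\<bar>) \<le> (\<kappa> / \<rho>) ^ N * ?D"
      proof cases
        case 1
        have "1 * ?D \<le> (\<kappa> / \<rho>) ^ N * ?D" using D0 kr by (intro mult_right_mono one_le_power)
        then show ?thesis using 1 by simp
      next
        case 2
        have "s \<in> slot X (\<sigma> j)" using Y(3) by simp
        from exchange_ratio_prod[OF Y(1) \<sigma>(1)[OF j] Y(2) this \<sigma>(2)[OF j] 2 \<sigma>'(2)[OF j this]]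
        have "(\<Prod>w\<in>Y - {s}. \<bar>s - w\<bar>) \<le> (\<kappa> / \<rho>) ^ j * \<rho> ^ (N - 1) * ?D"
          using ve(2)[OF j] by simp
        also have "\<dots> \<le> (\<kappa> / \<rho>) ^ N * 1 * ?D"
        proof (rule mult_right_mono[OF mult_mono D0])
          show "(\<kappa> / \<rho>) ^ j \<le> (\<kappa> / \<rho>) ^ N" using kr j by (intro power_increasing) simp_all
          show "\<rho> ^ (N - 1) \<le> 1" using \<rho>_bounds by (intro power_le_one) simp_all
          show "0 \<le> (\<kappa> / \<rho>) ^ N" using kr by (intro zero_le_power) linarith
          show "0 \<le> \<rho> ^ (N - 1)" using \<rho>_bounds by (intro zero_le_power) simp
        qed
        finally show ?thesis by (simp only: mult_1_right)
      qed
    next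
      show "0 \<le> (\<kappa> / \<rho>) ^ N"
        using \<rho>_bounds \<kappa>_gt by (intro zero_le_power divide_nonneg_nonneg) simp_all
    qed (use \<delta> in auto)
    also have "(\<kappa> / \<rho>) ^ N * (2 * \<delta> / (1 - q)) / \<bar>?e j\<bar> = (\<kappa> / \<rho>) ^ N * \<kappa> * \<delta> / \<bar>?e j\<bar>"
    proof -
      have "2 * \<delta> / (1 - q) = \<kappa> * \<delta>" by (simp add: \<kappa>_def)
      then show ?thesis by (simp only: mult.assoc)
    qed
    also have "\<dots> \<le> (\<kappa> / \<rho>) ^ N * \<kappa> * \<delta> / \<eta>"
    proof (rule divide_left_mono)
      show "\<eta> \<le> \<bar>?e j\<bar>" by (rule big[OF j])
      show "0 \<le> (\<kappa> / \<rho>) ^ N * \<kappa> * \<delta>"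
        using \<rho>_bounds \<kappa>_gt \<delta>
        by (intro mult_nonneg_nonneg zero_le_power divide_nonneg_nonneg) simp_all
      show "0 < \<bar>?e j\<bar> * \<eta>" using e0 \<eta> by simp
    qed
    finally show "?P {Y. Y \<inter> ?S j \<noteq> {}} \<le> (\<kappa> / \<rho>) ^ N * \<kappa> * \<delta> / \<eta>" .
  qed
  also have "\<dots> = real ?m * ((\<kappa> / \<rho>) ^ N * \<kappa> * \<delta> / \<eta>)" by simp
  also have "\<dots> \<le> real k * ((\<kappa> / \<rho>) ^ N * \<kappa> * \<delta> / \<eta>)"
  proof (rule mult_right_mono)
    show "0 \<le> (\<kappa> / \<rho>) ^ N * \<kappa> * \<delta> / \<eta>"
      using \<rho>_bounds \<kappa>_gt \<delta> \<eta>
      by (intro mult_nonneg_nonneg zero_le_power divide_nonneg_nonneg) simp_all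
  qed simp
  finally show ?thesis .
qed

end

section \<open>Iterated links\<close>

text \<open>Connects expectations with the infinite sums in the matrix products of the links.\<close>

lemma expectation_infsum:
  fixes f :: "'a \<Rightarrow> real"
  assumes "\<And>x. x \<in> set_pmf p \<Longrightarrow> \<bar>f x\<bar> \<le> B" and A: "set_pmf p \<subseteq> A"
  shows "measure_pmf.expectation p f = (\<Sum>\<^sub>\<infinity>x\<in>A. pmf p x * f x)"
proof -
  have 1: "(\<lambda>x. norm (pmf p x * f x)) summable_on UNIV"
  proof (rule summable_on_comparison_test)
    show "(\<lambda>x. \<bar>B\<bar> * pmf p x) summable_on UNIV"
      using pmf_has_sum[of p UNIV] by (intro summable_on_cmult_right has_sum_imp_summable)
    fix x
    show "norm (pmf p x * f x) \<le> \<bar>B\<bar> * pmf p x"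
    proof (cases "x \<in> set_pmf p")
      case True
      then have "pmf p x * \<bar>f x\<bar> \<le> pmf p x * \<bar>B\<bar>" using assms(1)[OF True] by (intro mult_left_mono) auto
      then show ?thesis by (simp add: abs_mult mult.commute)
    next
      case False
      then show ?thesis by (simp add: set_pmf_iff)
    qed
  qed simp
  have 2: "Infinite_Set_Sum.abs_summable_on (\<lambda>x. pmf p x * f x) UNIV"
    using 1 by (rule abs_summable_equivalent[THEN iffD1])
  have "measure_pmf.expectation p f = (\<Sum>\<^sub>\<infinity>x\<in>UNIV. pmf p x * f x)"
    unfolding pmf_expectation_eq_infsetsum by (rule infsetsum_infsum[OF 2])
  also have "\<dots> = (\<Sum>\<^sub>\<infinity>x\<in>A. pmf p x * f x)"
    by (rule infsum_cong_neutral) (use A in \<open>auto simp: set_pmf_iff\<close>)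
  finally show ?thesis .
qed

context qlattice
begin

primrec links :: "nat \<Rightarrow> nat \<Rightarrow> real set \<Rightarrow> real set pmf" where
  "links K 0 = (\<lambda>X. return_pmf X)"
| "links K (Suc N) = (\<lambda>X. if K \<le> N then bind_pmf (link N X) (links K N) else return_pmf X)"

lemma links_refl: "links N N X = return_pmf X"
  by (cases N) auto

lemma links_Suc: "K \<le> N \<Longrightarrow> links K (Suc N) X = bind_pmf (link N X) (links K N)"
  by simp

lemma set_link_G: "X \<in> G (Suc N) \<Longrightarrow> Y \<in> set_pmf (link N X) \<Longrightarrow> Y \<in> G N"
  using set_link_below by (auto simp: below_def)

lemma set_links: "K \<le> N \<Longrightarrow> X \<in> G N \<Longrightarrow> Y \<in> set_pmf (links K N X) \<Longrightarrow> Y \<in> G K"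
proof (induction N arbitrary: X)
  case (Suc N)
  show ?case
  proof (cases "K \<le> N")
    case True
    then obtain Z where "Z \<in> set_pmf (link N X)" "Y \<in> set_pmf (links K N Z)"
      using Suc.prems(3) by (auto simp: set_bind_pmf)
    then show ?thesis using Suc.IH[OF True] set_link_G[OF Suc.prems(2)] by blast
  qed (use Suc.prems in \<open>auto simp: le_Suc_eq\<close>)
qed auto

lemma links_abs_le:
  assumes "K \<le> N" "X \<in> G N" "\<And>x. x \<in> X \<Longrightarrow> \<bar>x\<bar> \<le> R" "Y \<in> set_pmf (links K N X)" "y \<in> Y"
  shows "\<bar>y\<bar> \<le> R"
  using assms
proof (induction N arbitrary: X)
  case (Suc N)
  show ?case
  proof (cases "K \<le> N")
    case True
    then obtain Z where Z: "Z \<in> set_pmf (link N X)" "Y \<in> set_pmf (links K N Z)"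
      using Suc.prems(4) by (auto simp: set_bind_pmf)
    note ZX = set_link_below[OF Suc.prems(2) Z(1)]
    show ?thesis
    proof (rule Suc.IH[OF True set_link_G[OF Suc.prems(2) Z(1)] _ Z(2) Suc.prems(5)])
      fix z assume "z \<in> Z"
      then obtain x where "x \<in> X" "\<bar>z\<bar> \<le> \<bar>x\<bar>" using below_abs[OF ZX] by blast
      then show "\<bar>z\<bar> \<le> R" using Suc.prems(3)[of x] by simp
    qed
  qed (use Suc.prems in \<open>auto simp: le_Suc_eq\<close>)
qed auto

lemma links_split:
  assumes "K \<le> M" "M \<le> N"
  shows "links K N X = bind_pmf (links M N X) (links K M)"
  using assms(2)
proof (induction N arbitrary: X)
  case 0
  then show ?case using assms(1) by (simp add: bind_return_pmf)
next
  case (Suc N)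
  show ?case
  proof (cases "M \<le> N")
    case True
    then have "links K N = (\<lambda>Z. bind_pmf (links M N Z) (links K M))" using Suc.IH by (intro ext) simp
    then show ?thesis using True assms(1) by (simp add: bind_assoc_pmf)
  next
    case False
    then have "M = Suc N" using Suc.prems by simp
    then show ?thesis by (simp only: links_refl bind_return_pmf)
  qed
qed

lemma pmf_links:
  "K \<le> N \<Longrightarrow> X \<in> G N \<Longrightarrow> Y \<in> G K \<Longrightarrow> pmf (links K N X) Y = qlinks q zm zp K N X Y"
proof (induction N arbitrary: X)
  case 0
  then show ?case by (simp add: pmf_return)
next
  case (Suc N)
  show ?case
  proof (cases "K \<le> N")
    case True
    have "pmf (links K (Suc N) X) Y = measure_pmf.expectation (link N X) (\<lambda>Z. pmf (links K N Z) Y)"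
      using True by (simp add: pmf_bind)
    also have "\<dots> = (\<Sum>\<^sub>\<infinity>Z\<in>G N. pmf (link N X) Z * pmf (links K N Z) Y)"
      by (rule expectation_infsum[where B = 1]) (auto simp: pmf_le_1 intro: set_link_G[OF Suc.prems(2)])
    also have "\<dots> = (\<Sum>\<^sub>\<infinity>Z\<in>G N. qlink q zm zp N X Z * qlinks q zm zp K N Z Y)"
      by (rule infsum_cong) (simp add: pmf_link[OF Suc.prems(2)] Suc.IH[OF True _ Suc.prems(3)])
    finally show ?thesis using True by simp
  next
    case False
    then show ?thesis by (simp add: pmf_return)
  qed
qed

subsection \<open>Uniform estimates for iterated links\<close>

text \<open>The error probabilities of the single links form a geometric series, so even after arbitrarily
  many links the first \<open>k\<close> terms are most likely unchanged, provided that the lower level is high.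
  This uniformity in the upper level is what makes the boundary computable.\<close>

lemma links_stable:
  obtains C where "0 \<le> C" "\<And>K N X. K \<le> N \<Longrightarrow> X \<in> G N \<Longrightarrow>
    measure_pmf.prob (links K N X) {Y. \<not> agree k Y X} \<le> C * \<rho> ^ K"
proof -
  obtain C where C: "0 \<le> C" "\<And>N X. X \<in> G (Suc N) \<Longrightarrow>
    measure_pmf.prob (link N X) {Y. \<not> agree k Y X} \<le> C * \<rho> ^ N"
    using link_stable by blast
  have main: "measure_pmf.prob (links K N X) {Y. \<not> agree k Y X} \<le> C * (\<Sum>n=K..<N. \<rho> ^ n)"
    if "K \<le> N" "X \<in> G N" for K N X
    using that
  proof (induction N arbitrary: X)
    case 0
    then show ?case by (simp add: agree_def)
  next
    case (Suc N)
    show ?case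
    proof (cases "K \<le> N")
      case True
      let ?s = "\<Sum>n=K..<N. \<rho> ^ n"
      have s0: "0 \<le> C * ?s" using C(1) \<rho>_bounds by (intro mult_nonneg_nonneg sum_nonneg) auto
      have "measure_pmf.prob (links K (Suc N) X) {Y. \<not> agree k Y X}
          = measure_pmf.expectation (link N X) (\<lambda>Z. measure_pmf.prob (links K N Z) {Y. \<not> agree k Y X})"
        using True by (simp add: prob_bind)
      also have "\<dots> \<le> measure_pmf.expectation (link N X)
          (\<lambda>Z. C * ?s + indicator {Z. \<not> agree k Z X} Z)"
      proof (rule expectation_mono[where B = 1 and C = "C * ?s + 1"])
        fix Z assume Z: "Z \<in> set_pmf (link N X)"
        show "measure_pmf.prob (links K N Z) {Y. \<not> agree k Y X} \<le> C * ?s + indicator {Z. \<not> agree k Z X} Z"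
        proof (cases "agree k Z X")
          case True
          then have "{Y. \<not> agree k Y X} = {Y. \<not> agree k Y Z}" by (auto simp: agree_def)
          then have "measure_pmf.prob (links K N Z) {Y. \<not> agree k Y X} \<le> C * ?s"
            using Suc.IH[OF \<open>K \<le> N\<close> set_link_G[OF Suc.prems(2) Z]] by (simp only:)
          moreover have "(0 :: real) \<le> indicator {Z. \<not> agree k Z X} Z" by simp
          ultimately show ?thesis by linarith
        next
          case False
          then have "indicator {Z. \<not> agree k Z X} Z = (1 :: real)" by simp
          then show ?thesis
            using s0 measure_pmf.prob_le_1[of "links K N Z" "{Y. \<not> agree k Y X}"] by linarith
        qed
        show "\<bar>C * ?s + indicator {Z. \<not> agree k Z X} Z\<bar> \<le> C * ?s + 1"
          using s0 by (simp add: indicator_def)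
      qed simp
      also have "\<dots> = C * ?s + measure_pmf.prob (link N X) {Z. \<not> agree k Z X}"
        using integrable_bounded_pmf[of "link N X" "indicator {Z. \<not> agree k Z X}" 1]
        by (subst Bochner_Integration.integral_add) (auto simp: indicator_def)
      also have "\<dots> \<le> C * ?s + C * \<rho> ^ N" using C(2)[OF Suc.prems(2)] by simp
      also have "\<dots> = C * (\<Sum>n=K..<Suc N. \<rho> ^ n)" using True by (simp add: distrib_left)
      finally show ?thesis .
    next
      case False
      then show ?thesis using Suc.prems(1) by (simp add: agree_def)
    qed
  qed
  have geom: "(\<Sum>n=K..<N. \<rho> ^ n) \<le> \<rho> ^ K / (1 - \<rho>)" if "K \<le> N" for K N
  proof -
    have "(1 - \<rho>) * (\<Sum>n=K..<N. \<rho> ^ n) = \<rho> ^ K - \<rho> ^ N"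
      using that
    proof (induction N rule: dec_induct)
      case (step n)
      have "(1 - \<rho>) * (\<Sum>n=K..<Suc n. \<rho> ^ n) = (1 - \<rho>) * (\<Sum>n=K..<n. \<rho> ^ n) + (1 - \<rho>) * \<rho> ^ n"
        using step.hyps by (simp add: distrib_left)
      then show ?case unfolding step.IH by (simp add: algebra_simps)
    qed simp
    also have "\<dots> \<le> \<rho> ^ K" using \<rho>_bounds by simp
    finally show ?thesis using \<rho>_bounds by (simp add: pos_le_divide_eq mult.commute)
  qed
  show thesis
  proof (rule that[of "C / (1 - \<rho>)"])
    show "0 \<le> C / (1 - \<rho>)" using C(1) \<rho>_bounds by simp
    fix K N X assume KN: "K \<le> N" and X: "X \<in> G N"
    have "measure_pmf.prob (links K N X) {Y. \<not> agree k Y X} \<le> C * (\<rho> ^ K / (1 - \<rho>))"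
      using main[OF KN X] mult_left_mono[OF geom[OF KN] C(1)] by linarith
    then show "measure_pmf.prob (links K N X) {Y. \<not> agree k Y X} \<le> C / (1 - \<rho>) * \<rho> ^ K" by simp
  qed
qed

text \<open>An induction over finitely many levels; unlike the stability estimate, the bound may deteriorate
  with \<open>M\<close>.\<close>

lemma links_large_points:
  assumes "K \<le> M" "0 < \<eta>" "0 < e"
  shows "\<exists>\<delta>>0. \<forall>Z\<in>G M. k \<le> card {z \<in> Z. \<eta> \<le> \<bar>z\<bar>} \<longrightarrow>
    measure_pmf.prob (links K M Z) {Y. card {y \<in> Y. \<delta> \<le> \<bar>y\<bar>} < min k K} \<le> e"
  using assms
proof (induction M arbitrary: \<eta> e k rule: dec_induct)
  case base
  then show ?case by (intro exI[of _ \<eta>]) (auto simp: links_refl)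
next
  case (step N)
  define c where "c = real k * ((\<kappa> / \<rho>) ^ N * \<kappa>) / \<eta> + 1"
  have c: "0 < c"
  proof -
    have "0 \<le> real k * ((\<kappa> / \<rho>) ^ N * \<kappa>) / \<eta>"
      using step.prems \<rho>_bounds \<kappa>_gt
      by (intro divide_nonneg_nonneg mult_nonneg_nonneg zero_le_power) simp_all
    then show ?thesis by (simp add: c_def)
  qed
  define \<delta>1 where "\<delta>1 = e / 2 / c"
  have \<delta>1: "0 < \<delta>1" using step.prems c by (simp add: \<delta>1_def)
  have "0 < e / 2" using step.prems by simp
  from step.IH[OF \<delta>1 this, of "min k N"] obtain \<delta> where \<delta>: "0 < \<delta>"
    "\<And>Z. Z \<in> G N \<Longrightarrow> min k N \<le> card {z \<in> Z. \<delta>1 \<le> \<bar>z\<bar>} \<Longrightarrow>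
      measure_pmf.prob (links K N Z) {Y. card {y \<in> Y. \<delta> \<le> \<bar>y\<bar>} < min (min k N) K} \<le> e / 2"
    by blast
  have mm: "min (min k N) K = min k K" using step.hyps by simp
  show ?case
  proof (intro exI[of _ \<delta>] conjI ballI impI \<delta>(1))
    fix X assume X: "X \<in> G (Suc N)" and k: "k \<le> card {z \<in> X. \<eta> \<le> \<bar>z\<bar>}"
    let ?A = "{Y. card {y \<in> Y. \<delta> \<le> \<bar>y\<bar>} < min k K}"
    let ?B = "{Z. card {z \<in> Z. \<delta>1 \<le> \<bar>z\<bar>} < min k N}"
    have "measure_pmf.prob (links K (Suc N) X) ?A
        = measure_pmf.expectation (link N X) (\<lambda>Z. measure_pmf.prob (links K N Z) ?A)"
      using step.hyps by (simp add: prob_bind)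
    also have "\<dots> \<le> measure_pmf.expectation (link N X) (\<lambda>Z. e / 2 + indicator ?B Z)"
    proof (rule expectation_mono[where B = 1 and C = "e / 2 + 1"])
      fix Z assume Z: "Z \<in> set_pmf (link N X)"
      show "measure_pmf.prob (links K N Z) ?A \<le> e / 2 + indicator ?B Z"
      proof (cases "Z \<in> ?B")
        case True
        then show ?thesis
          using step.prems measure_pmf.prob_le_1[of "links K N Z" ?A] by (simp add: add_increasing)
      next
        case False
        then have "min k N \<le> card {z \<in> Z. \<delta>1 \<le> \<bar>z\<bar>}" unfolding mem_Collect_eq not_less .
        from \<delta>(2)[OF set_link_G[OF X Z] this] show ?thesis using False unfolding mm by simp
      qed
      show "\<bar>e / 2 + indicator ?B Z\<bar> \<le> e / 2 + 1"
        using step.prems by (simp add: indicator_def)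
    qed simp
    also have "\<dots> = e / 2 + measure_pmf.prob (link N X) ?B"
      using integrable_bounded_pmf[of "link N X" "indicator ?B" 1]
      by (subst Bochner_Integration.integral_add) (auto simp: indicator_def)
    also have "measure_pmf.prob (link N X) ?B \<le> real k * ((\<kappa> / \<rho>) ^ N * \<kappa> * \<delta>1 / \<eta>)"
      by (rule link_large_points[OF X step.prems(1) k]) (use \<delta>1 in simp)
    also have "\<dots> = (c - 1) * \<delta>1" by (simp add: c_def)
    also have "\<dots> \<le> c * \<delta>1" using \<delta>1 by (simp add: algebra_simps)
    also have "\<dots> = e / 2" using c by (simp add: \<delta>1_def)
    finally show "measure_pmf.prob (links K (Suc N) X) ?A \<le> e" by simp
  qed
qed

end

section \<open>Limits along stabilizing configurations\<close>

text \<open>Uniform approximation by convergent functions forces the Cauchy property. The value of the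
  limit stays implicit.\<close>

lemma limit_if_approximable:
  fixes f :: "'a \<Rightarrow> real"
  assumes F: "F \<noteq> bot"
    and ap: "\<And>e. 0 < e \<Longrightarrow> \<exists>g l. (g \<longlongrightarrow> l) F \<and> (\<forall>\<^sub>F x in F. \<bar>f x - g x\<bar> \<le> e)"
  shows "\<exists>l. (f \<longlongrightarrow> l) F"
proof -
  have "cauchy_filter (filtermap f F)"
    unfolding cauchy_filter_metric_filtermap
  proof (intro allI impI)
    fix e :: real assume e: "0 < e"
    then have e4: "0 < e / 4" by simp
    from ap[OF this] obtain g l where g: "(g \<longlongrightarrow> l) F" "\<forall>\<^sub>F x in F. \<bar>f x - g x\<bar> \<le> e / 4"
      by blast
    have ev: "\<forall>\<^sub>F x in F. \<bar>f x - l\<bar> < e / 2"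
      using tendstoD[OF g(1) e4] g(2)
    proof eventually_elim
      case (elim x)
      then show ?case using e unfolding dist_real_def by linarith
    qed
    have "dist (f x) (f y) < e" if "\<bar>f x - l\<bar> < e / 2" "\<bar>f y - l\<bar> < e / 2" for x y
      using that unfolding dist_real_def by linarith
    then show "\<exists>P. eventually P F \<and> (\<forall>x y. P x \<and> P y \<longrightarrow> dist (f x) (f y) < e)"
      using ev by (intro exI[of _ "\<lambda>x. \<bar>f x - l\<bar> < e / 2"]) blast
  qed
  moreover have "filtermap f F \<noteq> bot" using F by (simp add: filtermap_bot_iff)
  ultimately have "\<exists>l. filtermap f F \<le> nhds l"
    using cauchy_filter_complete_converges[of "filtermap f F" UNIV] by (simp add: complete_UNIV)
  then show ?thesis by (simp add: filterlim_def)
qed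

text \<open>Pointwise limits of probability weights along a tight family are probability weights.\<close>

lemma pmf_limit_exists:
  fixes P :: "'b \<Rightarrow> 'a pmf"
  assumes F: "F \<noteq> bot" and lim: "\<And>x. \<exists>l. ((\<lambda>i. pmf (P i) x) \<longlongrightarrow> l) F"
    and tight: "\<And>e. 0 < e \<Longrightarrow> \<exists>A. finite A \<and> (\<forall>\<^sub>F i in F. 1 - e \<le> measure_pmf.prob (P i) A)"
  shows "\<exists>Q. \<forall>x. ((\<lambda>i. pmf (P i) x) \<longlongrightarrow> pmf Q x) F"
proof -
  from choice[of "\<lambda>x l. ((\<lambda>i. pmf (P i) x) \<longlongrightarrow> l) F"] lim
  obtain m where m: "\<And>x. ((\<lambda>i. pmf (P i) x) \<longlongrightarrow> m x) F" by blast
  have nn: "0 \<le> m x" for x by (rule tendsto_lowerbound[OF m _ F]) simp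
  have sumA: "((\<lambda>i. measure_pmf.prob (P i) A) \<longlongrightarrow> (\<Sum>x\<in>A. m x)) F" if "finite A" for A
    unfolding measure_measure_pmf_finite[OF that] by (intro tendsto_intros m)
  have le1: "(\<Sum>x\<in>A. m x) \<le> 1" if "finite A" for A
    by (rule tendsto_upperbound[OF sumA[OF that] _ F]) simp
  \<comment> \<open>Finite partial sums are at most 1, and by tightness some are nearly 1.\<close>
  have hs: "(m has_sum 1) UNIV"
    unfolding has_sum_def tendsto_iff eventually_finite_subsets_at_top
  proof (intro allI impI)
    fix e :: real assume e: "0 < e"
    then have "0 < e / 2" by simp
    from tight[OF this] obtain A where A: "finite A" "\<forall>\<^sub>F i in F. 1 - e / 2 \<le> measure_pmf.prob (P i) A"
      by blast
    have "1 - e / 2 \<le> (\<Sum>x\<in>A. m x)" by (rule tendsto_lowerbound[OF sumA[OF A(1)] A(2) F])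
    then have "dist (sum m Y) 1 < e" if "finite Y" "A \<subseteq> Y" for Y
    proof -
      have "sum m A \<le> sum m Y" by (rule sum_mono2[OF that]) (rule nn)
      then show ?thesis using le1[OF that(1)] \<open>1 - e / 2 \<le> (\<Sum>x\<in>A. m x)\<close> e
        unfolding dist_real_def by linarith
    qed
    then show "\<exists>X. finite X \<and> X \<subseteq> UNIV \<and>
        (\<forall>Y. finite Y \<and> X \<subseteq> Y \<and> Y \<subseteq> UNIV \<longrightarrow> dist (sum m Y) 1 < e)"
      using A(1) by auto
  qed
  have "m summable_on UNIV" using hs by (rule has_sum_imp_summable)
  then have "(\<lambda>x. norm (m x)) summable_on UNIV"
    by (rule summable_on_iff_abs_summable_on_real[THEN iffD1])
  then have abs: "Infinite_Set_Sum.abs_summable_on m UNIV"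
    by (rule abs_summable_equivalent[THEN iffD1])
  have "(\<integral>\<^sup>+x. ennreal (m x) \<partial>count_space UNIV) = ennreal (infsetsum m UNIV)"
    by (rule nn_integral_conv_infsetsum[OF abs nn])
  also have "\<dots> = 1" using infsetsum_infsum[OF abs] infsumI[OF hs] by simp
  finally have one: "(\<integral>\<^sup>+x. ennreal (m x) \<partial>count_space UNIV) = 1" .
  have "pmf (embed_pmf m) x = m x"  for x by (rule pmf_embed_pmf[OF nn one])
  then show ?thesis using m by (intro exI[of _ "embed_pmf m"]) simp
qed

context qlattice
begin

text \<open>The filter of pairs \<open>(N, Z)\<close>, where \<open>Z\<close> has \<open>N\<close> points and shares longer and longer
  initial parts of the variational series with \<open>X\<close>.\<close>

definition stab_filter :: "real set \<Rightarrow> (nat \<times> real set) filter" where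
  "stab_filter X = (INF k. principal {(N, Z). k \<le> N \<and> Z \<in> G N \<and> agree k Z X})"

lemma eventually_stab_filter:
  "eventually P (stab_filter X) \<longleftrightarrow> (\<exists>k. \<forall>N Z. k \<le> N \<longrightarrow> Z \<in> G N \<longrightarrow> agree k Z X \<longrightarrow> P (N, Z))"
proof -
  have "eventually P (stab_filter X)
      \<longleftrightarrow> (\<exists>k\<in>UNIV. eventually P (principal {(N, Z). k \<le> N \<and> Z \<in> G N \<and> agree k Z X}))"
    unfolding stab_filter_def
  proof (rule eventually_INF_base)
    fix a b :: nat
    show "\<exists>x\<in>UNIV. principal {(N, Z). x \<le> N \<and> Z \<in> G N \<and> agree x Z X}
        \<le> inf (principal {(N, Z). a \<le> N \<and> Z \<in> G N \<and> agree a Z X})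
            (principal {(N, Z). b \<le> N \<and> Z \<in> G N \<and> agree b Z X})"
      by (rule bexI[of _ "max a b"]) (auto simp: agree_def)
  qed simp
  then show ?thesis by (auto simp: eventually_principal)
qed

lemma stab_filter_nontrivial: "X \<in> Ginf \<Longrightarrow> stab_filter X \<noteq> bot"
  using initial_segment unfolding trivial_limit_def eventually_stab_filter by blast

lemma stabilizes_filterlim:
  assumes "Xs \<in> conf_seqs q zm zp" "stabilizes Xs X"
  shows "filterlim (\<lambda>N. (N, Xs N)) (stab_filter X) sequentially"
  unfolding filterlim_iff
proof (intro allI impI)
  fix P assume "eventually P (stab_filter X)"
  then obtain k where k: "\<And>N Z. k \<le> N \<Longrightarrow> Z \<in> G N \<Longrightarrow> agree k Z X \<Longrightarrow> P (N, Z)"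
    unfolding eventually_stab_filter by blast
  have "\<forall>\<^sub>F N in sequentially. \<forall>i\<in>{..<k}. variational (Xs N) i = variational X i"
    using assms(2) by (intro eventually_ball_finite) (auto simp: stabilizes_def)
  moreover have "\<forall>\<^sub>F N in sequentially. max 1 k \<le> N" by (rule eventually_ge_at_top)
  ultimately show "\<forall>\<^sub>F N in sequentially. P (N, Xs N)"
  proof eventually_elim
    case (elim N)
    then have "Xs N \<in> G N" using assms(1) by (auto simp: conf_seqs_def)
    then show ?case using k elim by (auto simp: agree_def)
  qed
qed

lemma prod_lessThan_add: "(\<Prod>j<a + b. f j) = (\<Prod>j<a. f j) * (\<Prod>j<b. f (a + j :: nat))"
  by (induction b) (auto simp: ac_simps)

lemma pad_0: "pad 0 p = p"
  by (auto simp: pad_def)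

section \<open>Moments of stabilizing configurations\<close>

lemma hsum_bound:
  assumes "bconf X"
  shows "\<bar>hsum (variational X) r k\<bar> \<le> (2 * \<bar>variational X 0\<bar> / (1 - q)) ^ r"
proof (induction r arbitrary: k)
  case (Suc r)
  let ?S = "2 * \<bar>variational X 0\<bar> / (1 - q)"
  have S0: "0 \<le> ?S" using q1 by simp
  have "\<bar>hsum (variational X) (Suc r) k\<bar> \<le> (\<Sum>s\<le>k. \<bar>variational X s\<bar> * ?S ^ r)"
    unfolding hsum.simps
    by (rule order_trans[OF sum_abs sum_mono]) (simp only: abs_mult mult_left_mono[OF Suc] abs_ge_zero)
  also have "\<dots> = (\<Sum>s\<le>k. \<bar>variational X s\<bar>) * ?S ^ r" by (simp only: sum_distrib_right)
  also have "\<dots> \<le> ?S * ?S ^ r"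
    using variational_sum_le[OF assms, of "{..k}" 0] zero_le_power[OF S0] by (intro mult_right_mono) auto
  finally show ?case by simp
qed simp

text \<open>Extending the variables beyond index \<open>l\<close> adds only monomials with a factor from the tail of the
  series, whose sum is of the order of its first term.\<close>

lemma hsum_tail:
  assumes X: "bconf X" and lk: "l \<le> k"
  shows "\<bar>hsum (variational X) r k - hsum (variational X) r l\<bar>
    \<le> 2 * \<bar>variational X l\<bar> / (1 - q) * (2 * \<bar>variational X 0\<bar> / (1 - q)) ^ (r - 1)"
proof (cases r)
  case 0
  then show ?thesis using q1 by simp
next
  case (Suc r')
  let ?S = "2 * \<bar>variational X 0\<bar> / (1 - q)" and ?x = "variational X"
  have S0: "0 \<le> ?S" using q1 by simp
  have "hsum ?x r k - hsum ?x r l = (\<Sum>s\<in>{l<..k}. ?x s * hsum ?x r' s)"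
  proof -
    have "{..k} = {..l} \<union> {l<..k}" using lk by auto
    then have "(\<Sum>s\<le>k. ?x s * hsum ?x r' s) = (\<Sum>s\<in>{..l} \<union> {l<..k}. ?x s * hsum ?x r' s)" by simp
    also have "\<dots> = (\<Sum>s\<le>l. ?x s * hsum ?x r' s) + (\<Sum>s\<in>{l<..k}. ?x s * hsum ?x r' s)"
      by (rule sum.union_disjoint) auto
    finally show ?thesis unfolding Suc hsum.simps by simp
  qed
  also have "\<bar>\<dots>\<bar> \<le> (\<Sum>s\<in>{l<..k}. \<bar>?x s\<bar> * ?S ^ r')"
    by (rule order_trans[OF sum_abs sum_mono])
      (simp only: abs_mult mult_left_mono[OF hsum_bound[OF X]] abs_ge_zero)
  also have "\<dots> = (\<Sum>s\<in>{l<..k}. \<bar>?x s\<bar>) * ?S ^ r'" by (simp only: sum_distrib_right)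
  also have "\<dots> \<le> 2 * \<bar>?x l\<bar> / (1 - q) * ?S ^ r'"
    using variational_sum_le[OF X, of "{l<..k}" l] zero_le_power[OF S0] by (intro mult_right_mono) auto
  finally show ?thesis by (simp add: Suc)
qed

lemma hsum_agree: "agree m X Y \<Longrightarrow> k < m \<Longrightarrow> hsum (variational X) r k = hsum (variational Y) r k"
proof (induction r arbitrary: k)
  case (Suc r)
  show ?case unfolding hsum.simps
  proof (rule sum.cong)
    fix s assume "s \<in> {..k}"
    then have "s < m" using Suc.prems(2) by simp
    then show "variational X s * hsum (variational X) r s = variational Y s * hsum (variational Y) r s"
      using Suc.IH[OF Suc.prems(1)] Suc.prems(1) by (simp add: agree_def)
  qed simp
qed simp

text \<open>Cutting the variables off at a fixed index \<open>l\<close> changes little, uniformly near \<open>X\<close>; after that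
  only terms shared with \<open>X\<close> are involved.\<close>

lemma hsum_tendsto:
  assumes X: "X \<in> Ginf"
  shows "\<exists>l. ((\<lambda>(N, Z). hsum (variational Z) r (N - K + i)) \<longlongrightarrow> l) (stab_filter X)"
proof (rule limit_if_approximable[OF stab_filter_nontrivial[OF X]])
  fix e :: real assume e: "0 < e"
  let ?S = "2 * \<bar>variational X 0\<bar> / (1 - q)"
  have "(\<lambda>l. 2 * \<bar>variational X l\<bar> / (1 - q) * ?S ^ (r - 1)) \<longlonglongrightarrow> 2 * \<bar>0\<bar> / (1 - q) * ?S ^ (r - 1)"
    using q1 by (intro tendsto_intros variational_tendsto_0[OF X]) auto
  then have "\<forall>\<^sub>F l in sequentially. 2 * \<bar>variational X l\<bar> / (1 - q) * ?S ^ (r - 1) < e"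
    using e order_tendstoD(2) by fastforce
  then obtain l where l: "2 * \<bar>variational X l\<bar> / (1 - q) * ?S ^ (r - 1) < e"
    by (auto simp: eventually_sequentially)
  show "\<exists>g l. (g \<longlongrightarrow> l) (stab_filter X) \<and>
      (\<forall>\<^sub>F x in stab_filter X. \<bar>(case x of (N, Z) \<Rightarrow> hsum (variational Z) r (N - K + i)) - g x\<bar> \<le> e)"
  proof (intro exI conjI)
    show "((\<lambda>_. hsum (variational X) r l) \<longlongrightarrow> hsum (variational X) r l) (stab_filter X)" by simp
    show "\<forall>\<^sub>F x in stab_filter X. \<bar>(case x of (N, Z) \<Rightarrow> hsum (variational Z) r (N - K + i))
        - hsum (variational X) r l\<bar> \<le> e"
      unfolding eventually_stab_filter
    proof (intro exI[of _ "Suc l + K"] allI impI)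
      fix N Z assume N: "Suc l + K \<le> N" and Z: "Z \<in> G N" and ag: "agree (Suc l + K) Z X"
      have a: "variational Z l = variational X l" "variational Z 0 = variational X 0"
        "hsum (variational Z) r l = hsum (variational X) r l"
        using ag hsum_agree[OF ag, of l r] by (auto simp: agree_def)
      have "l \<le> N - K + i" using N by simp
      from hsum_tail[OF G_bconf[OF Z] this, of r]
      show "\<bar>(case (N, Z) of (N, Z) \<Rightarrow> hsum (variational Z) r (N - K + i))
          - hsum (variational X) r l\<bar> \<le> e"
        unfolding a using l by simp
    qed
  qed
qed

text \<open>The Jacobi--Trudi formula, with the points listed in the order of the variational series. The
  size of the determinant does not depend on \<open>N\<close>.\<close>

lemma bialt_pad:
  assumes Z: "Z \<in> G N" and K: "K \<le> N"
  shows "bialt (pad (N - K) p) Z = Determinant.det (mat K K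
    (\<lambda>(i, j). newton (variational Z) (N - K + p j) (N - K + i)))"
proof -
  let ?z = "variational Z"
  have "bialt (pad (N - K) p) Z = alternant N ?z (pad (N - K) p) / alternant N ?z (\<lambda>j. j)"
    unfolding bialt_def vandermonde_alternant confsD(3)[OF Z]
    by (rule alternant_ratio_cong[OF nth_el_bij[OF Z] variational_bij[OF Z]])
  moreover have "alternant N ?z (\<lambda>j. j) \<noteq> 0"
    using bialt_id[OF Z] unfolding bialt_def vandermonde_alternant confsD(3)[OF Z]
    using alternant_ratio_cong[OF nth_el_bij[OF Z] variational_bij[OF Z], of "\<lambda>j. j" "\<lambda>j. j"] by auto
  ultimately show ?thesis
    using alternant_pad[of "N - K" K ?z p] K unfolding alternant_id by simp
qed

lemma bialt_tendsto:
  assumes X: "X \<in> Ginf"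
  shows "\<exists>l. ((\<lambda>(N, Z). bialt (pad (N - K) p) Z) \<longlongrightarrow> l) (stab_filter X)"
proof -
  have "\<exists>l. ((\<lambda>(N, Z). newton (variational Z) (N - K + p j) (N - K + i)) \<longlongrightarrow> l) (stab_filter X)" for i j
  proof (cases "i \<le> p j")
    case True
    then show ?thesis using hsum_tendsto[OF X, of "p j - i" K i] by (simp add: newton_def)
  next
    case False
    then show ?thesis by (auto simp: newton_def case_prod_unfold intro!: exI[of _ 0])
  qed
  then have "\<forall>x. \<exists>l. ((\<lambda>(N, Z). newton (variational Z) (N - K + p (snd x)) (N - K + fst x)) \<longlongrightarrow> l) (stab_filter X)"
    by blast
  from choice[OF this] obtain l where
    l: "\<And>x. ((\<lambda>(N, Z). newton (variational Z) (N - K + p (snd x)) (N - K + fst x)) \<longlongrightarrow> l x) (stab_filter X)"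
    by blast
  have l': "((\<lambda>x. newton (variational (snd x)) (fst x - K + p (s i)) (fst x - K + i)) \<longlongrightarrow> l (i, s i))
    (stab_filter X)" for i s
    using l[of "(i, s i)"] by (simp only: case_prod_unfold fst_conv snd_conv)
  have "((\<lambda>(N, Z). \<Sum>s | s permutes {0..<K}. of_int (sign s)
      * (\<Prod>i<K. newton (variational Z) (N - K + p (s i)) (N - K + i)))
    \<longlongrightarrow> (\<Sum>s | s permutes {0..<K}. of_int (sign s) * (\<Prod>i<K. l (i, s i)))) (stab_filter X)"
    unfolding case_prod_unfold
    by (intro tendsto_sum tendsto_mult tendsto_const tendsto_prod l')
  moreover have "\<forall>\<^sub>F x in stab_filter X. (case x of (N, Z) \<Rightarrow> \<Sum>s | s permutes {0..<K}. of_int (sign s)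
      * (\<Prod>i<K. newton (variational Z) (N - K + p (s i)) (N - K + i)))
    = (case x of (N, Z) \<Rightarrow> bialt (pad (N - K) p) Z)"
    unfolding eventually_stab_filter
    by (intro exI[of _ K] allI impI) (simp add: bialt_pad det_leibniz)
  ultimately show ?thesis by (blast intro: Lim_transform_eventually)
qed

lemma bialt_bounded:
  obtains B where "\<And>Z. Z \<in> G K \<Longrightarrow> (\<And>z. z \<in> Z \<Longrightarrow> \<bar>z\<bar> \<le> R) \<Longrightarrow> \<bar>bialt p Z\<bar> \<le> B"
proof -
  let ?S = "2 * \<bar>R\<bar> / (1 - q)"
  let ?b = "\<lambda>i j. \<bar>?S ^ (p j - i)\<bar>"
  show thesis
  proof
    fix Z assume Z: "Z \<in> G K" and R: "\<And>z. z \<in> Z \<Longrightarrow> \<bar>z\<bar> \<le> R"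
    note bZ = G_bconf[OF Z]
    have "\<bar>variational Z 0\<bar> \<le> \<bar>R\<bar>"
      using variational_in(1)[OF bZ, of 0] variational_invalid[of Z 0] R by force
    then have vS: "2 * \<bar>variational Z 0\<bar> / (1 - q) \<le> ?S" using q1 by (intro divide_right_mono) auto
    have nb: "\<bar>newton (variational Z) (p j) i\<bar> \<le> ?b i j" for i j
    proof -
      have "\<bar>hsum (variational Z) (p j - i) i\<bar> \<le> (2 * \<bar>variational Z 0\<bar> / (1 - q)) ^ (p j - i)"
        by (rule hsum_bound[OF bZ])
      also have "\<dots> \<le> ?S ^ (p j - i)" using vS q1 by (intro power_mono) auto
      finally show ?thesis by (simp add: newton_def)
    qed
    have "bialt p Z = Determinant.det (mat K K (\<lambda>(i, j). newton (variational Z) (p j) i))"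
      using bialt_pad[OF Z order_refl, of p] by (simp add: pad_0)
    then have "\<bar>bialt p Z\<bar> \<le> (\<Sum>s | s permutes {0..<K}.
        \<bar>of_int (sign s) * (\<Prod>i<K. newton (variational Z) (p (s i)) i)\<bar>)"
      unfolding det_leibniz by (simp only: sum_abs)
    also have "\<dots> \<le> (\<Sum>s | s permutes {0..<K}. \<Prod>i<K. ?b i (s i))"
    proof (rule sum_mono)
      fix s :: "nat \<Rightarrow> nat"
      have "\<bar>of_int (sign s) :: real\<bar> = 1" by (auto simp: sign_def)
      then show "\<bar>of_int (sign s) * (\<Prod>i<K. newton (variational Z) (p (s i)) i)\<bar> \<le> (\<Prod>i<K. ?b i (s i))"
        unfolding abs_mult abs_prod by (simp only: mult_1) (rule prod_mono, use nb in simp)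
    qed
    finally show "\<bar>bialt p Z\<bar> \<le> (\<Sum>s | s permutes {0..<K}. \<Prod>i<K. ?b i (s i))" .
  qed
qed

text \<open>Each link pads the exponents by one more column and multiplies by an explicit constant, in which
  the factors of the padded columns cancel.\<close>

lemma links_moment:
  assumes "K \<le> N" "Z \<in> G N"
  shows "measure_pmf.expectation (links K N Z) (bialt p)
    = (\<Prod>m<N - K. \<Prod>j<K. (1 - q ^ Suc (m + j)) / (1 - q ^ Suc (m + p j))) * bialt (pad (N - K) p) Z"
  using assms
proof (induction N arbitrary: Z)
  case 0
  then show ?case by (simp add: pad_def)
next
  case (Suc N)
  show ?case
  proof (cases "K \<le> N")
    case True
    let ?c = "\<Prod>m<N - K. \<Prod>j<K. (1 - q ^ Suc (m + j)) / (1 - q ^ Suc (m + p j))"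
    let ?d = "\<Prod>j<K. (1 - q ^ Suc (N - K + j)) / (1 - q ^ Suc (N - K + p j))"
    obtain R where R: "\<And>z. z \<in> Z \<Longrightarrow> \<bar>z\<bar> \<le> R"
      using G_bconf[OF Suc.prems(2)] by (auto simp: bconf_def bounded_iff)
    \<comment> \<open>The expectation over two links may be split, since all configurations reached stay in
      \<open>[- R, R]\<close>.\<close>
    obtain B where B: "\<And>Y. Y \<in> G K \<Longrightarrow> (\<And>y. y \<in> Y \<Longrightarrow> \<bar>y\<bar> \<le> R) \<Longrightarrow> \<bar>bialt p Y\<bar> \<le> B"
      using bialt_bounded[of K R p] by blast
    have "measure_pmf.expectation (links K (Suc N) Z) (bialt p)
        = measure_pmf.expectation (link N Z) (\<lambda>Y. measure_pmf.expectation (links K N Y) (bialt p))"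
      unfolding links_Suc[OF True]
    proof (rule expectation_bind)
      fix Y assume "Y \<in> set_pmf (bind_pmf (link N Z) (links K N))"
      then have Y: "Y \<in> set_pmf (links K (Suc N) Z)" using True by simp
      show "\<bar>bialt p Y\<bar> \<le> B"
        by (rule B[OF set_links[OF Suc.prems Y]]) (rule links_abs_le[OF Suc.prems R Y])
    qed
    also have "\<dots> = measure_pmf.expectation (link N Z) (\<lambda>Y. ?c * bialt (pad (N - K) p) Y)"
      by (rule expectation_cong) (rule Suc.IH[OF True set_link_G[OF Suc.prems(2)]])
    also have "\<dots> = ?c * measure_pmf.expectation (link N Z) (bialt (pad (N - K) p))" by simp
    also have "measure_pmf.expectation (link N Z) (bialt (pad (N - K) p))
        = (\<Prod>j<N. (1 - q ^ Suc j) / (1 - q ^ Suc (pad (N - K) p j))) * bialt (pad (Suc N - K) p) Z"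
    proof -
      have "pad 1 (pad (N - K) p) = pad (Suc N - K) p"
        using True by (auto simp: pad_def fun_eq_iff Suc_diff_le)
      then show ?thesis using link_moment[OF Suc.prems(2), of "pad (N - K) p"] by simp
    qed
    also have "(\<Prod>j<N. (1 - q ^ Suc j) / (1 - q ^ Suc (pad (N - K) p j))) = ?d"
    proof -
      have "(\<Prod>j<N - K + K. (1 - q ^ Suc j) / (1 - q ^ Suc (pad (N - K) p j)))
          = (\<Prod>j<N - K. (1 - q ^ Suc j) / (1 - q ^ Suc (pad (N - K) p j)))
          * (\<Prod>j<K. (1 - q ^ Suc (N - K + j)) / (1 - q ^ Suc (pad (N - K) p (N - K + j))))"
        by (rule prod_lessThan_add)
      moreover have "(1 - q ^ Suc j) \<noteq> 0" for j
        using q0 q1 power_Suc_less_one[of q j] by auto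
      then have "(\<Prod>j<N - K. (1 - q ^ Suc j) / (1 - q ^ Suc (pad (N - K) p j))) = 1"
        by (intro prod.neutral) (simp add: pad_def del: power_Suc)
      moreover have "pad (N - K) p (N - K + j) = N - K + p j" for j by (simp add: pad_def)
      ultimately show ?thesis using True by (simp del: power_Suc)
    qed
    also have "?c * (?d * bialt (pad (Suc N - K) p) Z)
        = (\<Prod>m<Suc N - K. \<Prod>j<K. (1 - q ^ Suc (m + j)) / (1 - q ^ Suc (m + p j))) * bialt (pad (Suc N - K) p) Z"
      using True by (simp add: Suc_diff_le)
    finally show ?thesis .
  next
    case False
    then have "K = Suc N" using Suc.prems(1) by simp
    then show ?thesis by (simp add: pad_def)
  qed
qed

text \<open>The logarithms of the factors are summable like the powers of \<open>q\<close>.\<close>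

lemma q_pochhammer_tendsto: "\<exists>l. l \<noteq> 0 \<and> (\<lambda>n. \<Prod>m<n. 1 - q ^ Suc (m + a)) \<longlonglongrightarrow> l"
proof -
  let ?f = "\<lambda>m. 1 - q ^ Suc (m + a)"
  have nz: "?f m \<noteq> 0" for m using q0 q1 power_Suc_less_one[of q "m + a"] by auto
  have "summable (\<lambda>m. q ^ Suc a * q ^ m)" using q0 q1 by (intro summable_mult summable_geometric) simp
  then have "summable (\<lambda>m. norm (?f m - 1))"
    using q0 by (simp add: power_add mult.commute mult.left_commute)
  then have "abs_convergent_prod ?f" unfolding abs_convergent_prod_conv_summable .
  then have c: "convergent_prod ?f" by (rule abs_convergent_prod_imp_convergent_prod)
  have "(\<lambda>n. \<Prod>m<Suc n. ?f m) \<longlonglongrightarrow> prodinf ?f"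
    using convergent_prod_LIMSEQ[OF c] unfolding lessThan_Suc_atMost .
  then have "(\<lambda>n. \<Prod>m<n. ?f m) \<longlonglongrightarrow> prodinf ?f" by (rule LIMSEQ_imp_Suc)
  then show ?thesis using prodinf_nonzero[OF c nz] by blast
qed

lemma moment_tendsto:
  assumes X: "X \<in> Ginf"
  shows "\<exists>l. ((\<lambda>(N, Z). measure_pmf.expectation (links K N Z) (bialt p)) \<longlongrightarrow> l) (stab_filter X)"
proof -
  obtain l where l: "((\<lambda>(N, Z). bialt (pad (N - K) p) Z) \<longlongrightarrow> l) (stab_filter X)"
    using bialt_tendsto[OF X] by blast
  from choice[of "\<lambda>a l. l \<noteq> 0 \<and> (\<lambda>n. \<Prod>m<n. 1 - q ^ Suc (m + a)) \<longlonglongrightarrow> l"] q_pochhammer_tendsto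
  obtain c where c: "\<And>a. c a \<noteq> 0" "\<And>a. (\<lambda>n. \<Prod>m<n. 1 - q ^ Suc (m + a)) \<longlonglongrightarrow> c a" by blast
  have "(\<lambda>n. \<Prod>j<K. (\<Prod>m<n. 1 - q ^ Suc (m + j)) / (\<Prod>m<n. 1 - q ^ Suc (m + p j)))
      \<longlonglongrightarrow> (\<Prod>j<K. c j / c (p j))"
    by (intro tendsto_prod tendsto_divide c)
  moreover have "(\<Prod>j<K. (\<Prod>m<n. 1 - q ^ Suc (m + j)) / (\<Prod>m<n. 1 - q ^ Suc (m + p j)))
      = (\<Prod>m<n. \<Prod>j<K. (1 - q ^ Suc (m + j)) / (1 - q ^ Suc (m + p j)))" for n
    unfolding prod_dividef[symmetric] by (rule prod.swap)
  ultimately have "(\<lambda>n. \<Prod>m<n. \<Prod>j<K. (1 - q ^ Suc (m + j)) / (1 - q ^ Suc (m + p j)))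
      \<longlonglongrightarrow> (\<Prod>j<K. c j / c (p j))" by (simp only:)
  moreover have "filterlim (\<lambda>(N, Z). N - K) sequentially (stab_filter X)"
    unfolding filterlim_at_top eventually_stab_filter
  proof
    fix n show "\<exists>k. \<forall>N Z. k \<le> N \<longrightarrow> Z \<in> G N \<longrightarrow> agree k Z X \<longrightarrow> n \<le> (case (N, Z) of (N, Z) \<Rightarrow> N - K)"
      by (intro exI[of _ "n + K"]) auto
  qed
  ultimately have "((\<lambda>x. \<Prod>m<(case x of (N, Z) \<Rightarrow> N - K).
      \<Prod>j<K. (1 - q ^ Suc (m + j)) / (1 - q ^ Suc (m + p j))) \<longlongrightarrow> (\<Prod>j<K. c j / c (p j))) (stab_filter X)"
    by (rule filterlim_compose)
  from tendsto_mult[OF this l]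
  have "((\<lambda>x. (\<Prod>m<(case x of (N, Z) \<Rightarrow> N - K). \<Prod>j<K. (1 - q ^ Suc (m + j)) / (1 - q ^ Suc (m + p j)))
      * (case x of (N, Z) \<Rightarrow> bialt (pad (N - K) p) Z)) \<longlongrightarrow> (\<Prod>j<K. c j / c (p j)) * l) (stab_filter X)" .
  moreover have "\<forall>\<^sub>F x in stab_filter X. (\<Prod>m<(case x of (N, Z) \<Rightarrow> N - K).
      \<Prod>j<K. (1 - q ^ Suc (m + j)) / (1 - q ^ Suc (m + p j)))
      * (case x of (N, Z) \<Rightarrow> bialt (pad (N - K) p) Z)
    = (case x of (N, Z) \<Rightarrow> measure_pmf.expectation (links K N Z) (bialt p))"
    unfolding eventually_stab_filter by (intro exI[of _ K] allI impI) (simp only: links_moment prod.case)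
  ultimately show ?thesis by (blast intro: Lim_transform_eventually)
qed

end

section \<open>Moments determine the limit\<close>

lemma prod_diff_le:
  fixes a b :: "'i \<Rightarrow> real"
  assumes "finite I" "\<And>i. i \<in> I \<Longrightarrow> \<bar>a i\<bar> \<le> C" "\<And>i. i \<in> I \<Longrightarrow> \<bar>b i\<bar> \<le> C"
    "\<And>i. i \<in> I \<Longrightarrow> \<bar>a i - b i\<bar> \<le> e" "1 \<le> C" "0 \<le> e"
  shows "\<bar>(\<Prod>i\<in>I. a i) - (\<Prod>i\<in>I. b i)\<bar> \<le> real (card I) * C ^ card I * e"
  using assms(1-4)
proof (induction rule: finite_induct)
  case (insert x F)
  let ?n = "card F"
  have IH: "\<bar>(\<Prod>i\<in>F. a i) - (\<Prod>i\<in>F. b i)\<bar> \<le> real ?n * C ^ ?n * e"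
    by (rule insert.IH) (use insert.prems in auto)
  have pb: "\<bar>\<Prod>i\<in>F. b i\<bar> \<le> C ^ ?n"
    unfolding abs_prod using prod_mono[of F "\<lambda>i. \<bar>b i\<bar>" "\<lambda>_. C"] insert.prems(2) by simp
  have "(\<Prod>i\<in>insert x F. a i) - (\<Prod>i\<in>insert x F. b i)
      = a x * ((\<Prod>i\<in>F. a i) - (\<Prod>i\<in>F. b i)) + (a x - b x) * (\<Prod>i\<in>F. b i)"
    using insert.hyps by (simp add: algebra_simps)
  also have "\<bar>\<dots>\<bar> \<le> \<bar>a x\<bar> * \<bar>(\<Prod>i\<in>F. a i) - (\<Prod>i\<in>F. b i)\<bar> + \<bar>a x - b x\<bar> * \<bar>\<Prod>i\<in>F. b i\<bar>"
    using abs_triangle_ineq by (simp only: abs_mult[symmetric])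
  also have "\<dots> \<le> C * (real ?n * C ^ ?n * e) + e * C ^ ?n"
    using insert.prems(1,3) IH pb assms(5,6) by (intro add_mono mult_mono) auto
  also have "\<dots> \<le> C * (real ?n * C ^ ?n * e) + C * (C ^ ?n * e)"
  proof -
    have "0 \<le> C ^ ?n * e" using assms(5,6) by simp
    then have "1 * (C ^ ?n * e) \<le> C * (C ^ ?n * e)" using assms(5) by (intro mult_right_mono) auto
    then show ?thesis by (simp add: mult.commute)
  qed
  also have "\<dots> = real (card (insert x F)) * C ^ card (insert x F) * e"
    using insert.hyps by (simp add: algebra_simps)
  finally show ?case .
qed simp

lemma det_diff_le:
  fixes a b :: "nat \<Rightarrow> nat \<Rightarrow> real"
  assumes "\<And>i j. i < n \<Longrightarrow> j < n \<Longrightarrow> \<bar>a i j\<bar> \<le> C" "\<And>i j. i < n \<Longrightarrow> j < n \<Longrightarrow> \<bar>b i j\<bar> \<le> C"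
    "\<And>i j. i < n \<Longrightarrow> j < n \<Longrightarrow> \<bar>a i j - b i j\<bar> \<le> e" "1 \<le> C" "0 \<le> e"
  shows "\<bar>Determinant.det (mat n n (\<lambda>(i, j). a i j)) - Determinant.det (mat n n (\<lambda>(i, j). b i j))\<bar>
    \<le> real (card {s. s permutes {0..<n}}) * (real n * C ^ n * e)"
proof -
  let ?S = "{s. s permutes {0..<n}}"
  have "Determinant.det (mat n n (\<lambda>(i, j). a i j)) - Determinant.det (mat n n (\<lambda>(i, j). b i j))
      = (\<Sum>s\<in>?S. of_int (sign s) * ((\<Prod>i<n. a i (s i)) - (\<Prod>i<n. b i (s i))))"
    unfolding det_leibniz by (simp add: right_diff_distrib sum_subtractf)
  also have "\<bar>\<dots>\<bar> \<le> (\<Sum>s\<in>?S. real n * C ^ n * e)"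
  proof (rule order_trans[OF sum_abs sum_mono])
    fix s assume "s \<in> ?S"
    then have s: "s i < n" if "i < n" for i using permutes_in_image[of s "{0..<n}" i] that by simp
    have "\<bar>of_int (sign s) :: real\<bar> = 1" by (auto simp: sign_def)
    moreover have "\<bar>(\<Prod>i<n. a i (s i)) - (\<Prod>i<n. b i (s i))\<bar> \<le> real (card {..<n}) * C ^ card {..<n} * e"
      by (rule prod_diff_le) (use assms s in auto)
    ultimately show "\<bar>of_int (sign s) * ((\<Prod>i<n. a i (s i)) - (\<Prod>i<n. b i (s i)))\<bar> \<le> real n * C ^ n * e"
      by (simp add: abs_mult)
  qed
  finally show ?thesis by simp
qed

lemma det_leibniz_col:
  "Determinant.det (mat n n (\<lambda>(i, j). a i j :: real))
    = (\<Sum>s | s permutes {0..<n}. of_int (sign s) * (\<Prod>j<n. a (s j) j))"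
proof -
  have "transpose_mat (mat n n (\<lambda>(i, j). a j i)) = mat n n (\<lambda>(i, j). a i j)"
    by (rule eq_matI) auto
  then have "Determinant.det (mat n n (\<lambda>(i, j). a i j)) = Determinant.det (mat n n (\<lambda>(i, j). a j i))"
    using det_transpose[of "mat n n (\<lambda>(i, j). a j i)" n] by simp
  then show ?thesis using det_leibniz[where n = n and a = "\<lambda>i j. a j i"] by simp
qed

lemma det_scale_rows:
  "Determinant.det (mat n n (\<lambda>(i, j). d i * a i j :: real))
    = (\<Prod>i<n. d i) * Determinant.det (mat n n (\<lambda>(i, j). a i j))"
  unfolding det_leibniz by (simp add: prod.distrib sum_distrib_left algebra_simps)

text \<open>The determinant is multilinear in its columns.\<close>

lemma det_polynomials:
  fixes a :: "nat \<Rightarrow> nat \<Rightarrow> real"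
  shows "Determinant.det (mat K K (\<lambda>(i, j). y i ^ m * (\<Sum>k\<le>d j. a j k * y i ^ k)))
    = (\<Sum>n\<in>PiE {..<K} (\<lambda>j. {..d j}). (\<Prod>j<K. a j (n j)) * alternant K y (\<lambda>j. m + n j))"
proof -
  let ?T = "PiE {..<K} (\<lambda>j. {..d j})"
  have "Determinant.det (mat K K (\<lambda>(i, j). y i ^ m * (\<Sum>k\<le>d j. a j k * y i ^ k)))
      = (\<Sum>s | s permutes {0..<K}. of_int (sign s) * (\<Prod>j<K. \<Sum>k\<le>d j. a j k * y (s j) ^ (m + k)))"
    unfolding det_leibniz_col by (simp add: sum_distrib_left power_add mult.left_commute)
  also have "\<dots> = (\<Sum>s | s permutes {0..<K}. \<Sum>n\<in>?T.
      of_int (sign s) * (\<Prod>j<K. a j (n j) * y (s j) ^ (m + n j)))"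
    by (subst prod_sum_PiE) (auto simp: sum_distrib_left)
  also have "\<dots> = (\<Sum>n\<in>?T. \<Sum>s | s permutes {0..<K}.
      of_int (sign s) * (\<Prod>j<K. a j (n j) * y (s j) ^ (m + n j)))"
    by (rule sum.swap)
  also have "\<dots> = (\<Sum>n\<in>?T. (\<Prod>j<K. a j (n j)) * alternant K y (\<lambda>j. m + n j))"
    unfolding alternant_def det_leibniz_col
    by (simp add: prod.distrib sum_distrib_left mult.left_commute)
  finally show ?thesis .
qed

context qlattice
begin

text \<open>If \<open>Y\<close> and \<open>U\<close> differ, some row of the matrix vanishes; otherwise it is the identity.\<close>

lemma det_indicator:
  assumes Y: "Y \<in> G K" and U: "U \<in> G K"
  shows "Determinant.det (mat K K (\<lambda>(i, j). if nth_el Y i = nth_el U j then 1 else 0)) = (of_bool (Y = U) :: real)"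
proof (cases "Y = U")
  case True
  have inj: "nth_el U i = nth_el U j \<longleftrightarrow> i = j" if "i < K" "j < K" for i j
    using bij_betw_imp_inj_on[OF nth_el_bij[OF U]] that by (auto dest: inj_onD)
  have "mat K K (\<lambda>(i, j). if nth_el Y i = nth_el U j then 1 else 0) = (1\<^sub>m K :: real mat)"
    by (rule eq_matI) (auto simp: True inj)
  then show ?thesis using True by simp
next
  case False
  have z: "(\<Prod>i<K. if nth_el Y i = nth_el U (s i) then 1 else 0) = (0 :: real)"
    if s: "s permutes {0..<K}" for s
  proof (rule ccontr)
    assume nz: "\<not> ?thesis"
    have "nth_el Y i \<in> U" if i: "i < K" for i
    proof -
      have "s i < K" using permutes_in_image[OF s, of i] i by simp
      moreover have "nth_el Y i = nth_el U (s i)"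
        using nz i prod_zero[of "{..<K}" "\<lambda>i. if nth_el Y i = nth_el U (s i) then 1 else (0 :: real)"]
        by fastforce
      ultimately show ?thesis using nth_el_in[OF U] by simp
    qed
    then have "nth_el Y ` {..<K} \<subseteq> U" by auto
    then have "Y \<subseteq> U" unfolding bij_betw_imp_surj_on[OF nth_el_bij[OF Y]] .
    then have "Y = U" using card_subset_eq[of U Y] confsD[OF Y] confsD[OF U] by simp
    then show False using False by simp
  qed
  have "Determinant.det (mat K K (\<lambda>(i, j). if nth_el Y i = nth_el U j then 1 else 0)) = (0 :: real)"
    unfolding det_leibniz
  proof (rule sum.neutral, intro ballI)
    fix s assume "s \<in> {s. s permutes {0..<K}}"
    then have "s permutes {0..<K}" by simp
    from z[OF this] show "of_int (sign s)
        * (\<Prod>i<K. if nth_el Y i = nth_el U (s i) then 1 else 0) = (0 :: real)"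
      by (simp only: mult_zero_right)
  qed
  then show ?thesis using False by simp
qed

text \<open>Two points of the grid are at least \<open>(1 - q) * \<bar>y\<bar>\<close> apart. Hence a factor $y^K$ in each
  variable compensates for small values of the Vandermonde determinant.\<close>

lemma vandermonde_compensation:
  obtains M where "0 \<le> M" "\<And>Y. Y \<in> G K \<Longrightarrow> (\<And>y. y \<in> Y \<Longrightarrow> \<bar>y\<bar> \<le> R) \<Longrightarrow>
    (\<Prod>i<K. \<bar>nth_el Y i\<bar> ^ K) / vandermonde Y \<le> M"
proof -
  define c where "c j = max 1 R ^ K / (1 - q) ^ j" for j :: nat
  have c0: "0 \<le> c j" for j using q1 by (simp add: c_def)
  show thesis
  proof (rule that[of "\<Prod>j<K. c j"])
    show "0 \<le> (\<Prod>j<K. c j)" using c0 by (intro prod_nonneg) auto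
    fix Y assume Y: "Y \<in> G K" and R: "\<And>y. y \<in> Y \<Longrightarrow> \<bar>y\<bar> \<le> R"
    let ?y = "nth_el Y"
    have "(\<Prod>i<K. \<bar>?y i\<bar> ^ K) \<le> (\<Prod>j<K. c j * (\<Prod>i<j. ?y j - ?y i))"
    proof (rule prod_mono)
      fix j assume "j \<in> {..<K}"
      then have j: "j < K" by simp
      have yj: "?y j \<in> Y" by (rule nth_el_in[OF Y j])
      have "\<bar>?y j\<bar> ^ K = \<bar>?y j\<bar> ^ (K - j) * \<bar>?y j\<bar> ^ j" using j by (simp add: power_add[symmetric])
      also have "\<bar>?y j\<bar> ^ (K - j) \<le> max 1 R ^ (K - j)" using R[OF yj] by (intro power_mono) auto
      also have "max 1 R ^ (K - j) \<le> max 1 R ^ K" by (intro power_increasing) auto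
      also have "max 1 R ^ K * \<bar>?y j\<bar> ^ j = c j * ((1 - q) * \<bar>?y j\<bar>) ^ j"
        using q1 by (simp add: c_def power_mult_distrib)
      also have "((1 - q) * \<bar>?y j\<bar>) ^ j = (\<Prod>i<j. (1 - q) * \<bar>?y j\<bar>)" by simp
      also have "c j * \<dots> \<le> c j * (\<Prod>i<j. ?y j - ?y i)"
      proof (rule mult_left_mono[OF prod_mono c0])
        fix i assume "i \<in> {..<j}"
        then have i: "i < j" by simp
        have "?y i < ?y j" by (rule nth_el_less[OF Y i j])
        moreover have "(1 - q) * \<bar>?y j\<bar> \<le> \<bar>?y i - ?y j\<bar>"
          using nth_el_in[OF Y, of i] yj i j confsD(1)[OF Y] calculation by (intro L_dist) auto
        ultimately show "0 \<le> (1 - q) * \<bar>?y j\<bar> \<and> (1 - q) * \<bar>?y j\<bar> \<le> ?y j - ?y i" using q1 by simp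
      qed
      finally show "0 \<le> \<bar>?y j\<bar> ^ K \<and> \<bar>?y j\<bar> ^ K \<le> c j * (\<Prod>i<j. ?y j - ?y i)"
        by (simp add: mult_right_mono)
    qed
    also have "\<dots> = (\<Prod>j<K. c j) * vandermonde Y"
      unfolding vandermonde_def confsD(3)[OF Y] by (rule prod.distrib)
    finally show "(\<Prod>i<K. \<bar>?y i\<bar> ^ K) / vandermonde Y \<le> (\<Prod>j<K. c j)"
      using vandermonde_pos[OF Y] by (simp add: pos_divide_le_eq)
  qed
qed

text \<open>Isolated points have continuous indicators. The extra factor \<open>1 / u ^ K\<close> prepares for the
  multiplication by \<open>y ^ K\<close> that tames the division by the Vandermonde determinant.\<close>

lemma bump_polynomial:
  assumes u: "u \<in> L" and e: "0 < e"
  shows "\<exists>a d. \<forall>y\<in>L. \<bar>y\<bar> \<le> R \<longrightarrow> \<bar>(if y = u then 1 / u ^ K else 0) - (\<Sum>k\<le>d. a k * y ^ k)\<bar> < e"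
proof -
  define r where "r = (1 - q) * \<bar>u\<bar>"
  have r: "0 < r" using q1 L_nz[OF u] by (simp add: r_def)
  define f where "f y = 1 / u ^ K * max 0 (1 - \<bar>y - u\<bar> / r)" for y
  have "continuous_on {- R..R} f"
    unfolding f_def using r by (intro continuous_intros) auto
  from Stone_Weierstrass_real_polynomial_function[OF compact_Icc this e] obtain g where
    g: "real_polynomial_function g" "\<And>y. y \<in> {- R..R} \<Longrightarrow> \<bar>f y - g y\<bar> < e" by blast
  obtain a d where ad: "g = (\<lambda>y. \<Sum>k\<le>d. a k * y ^ k)"
    using real_polynomial_function_imp_sum[OF g(1)] by blast
  have fy: "f y = (if y = u then 1 / u ^ K else 0)" if y: "y \<in> L" for y
  proof (cases "y = u")
    case False
    have "r \<le> \<bar>y - u\<bar>" unfolding r_def by (rule L_dist[OF y u False])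
    then have "1 \<le> \<bar>y - u\<bar> / r" using r by simp
    then show ?thesis using False by (simp add: f_def)
  qed (simp add: f_def)
  show ?thesis
  proof (intro exI ballI impI)
    fix y assume y: "y \<in> L" "\<bar>y\<bar> \<le> R"
    then have "y \<in> {- R..R}" by auto
    from g(2)[OF this] show "\<bar>(if y = u then 1 / u ^ K else 0) - (\<Sum>k\<le>d. a k * y ^ k)\<bar> < e"
      unfolding ad fy[OF y(1)] .
  qed
qed

text \<open>Multiplied by the Vandermonde determinant, the indicator of a configuration is a multiple of
  the determinant of one-point indicators. By the Weierstrass theorem the latter are approximated by
  polynomials.\<close>

lemma indicator_approx:
  assumes U: "U \<in> G K" and e: "0 < e"
  obtains J :: "(nat \<Rightarrow> nat) set" and c p where "finite J"
    "\<And>Y. Y \<in> G K \<Longrightarrow> (\<And>y. y \<in> Y \<Longrightarrow> \<bar>y\<bar> \<le> R) \<Longrightarrow>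
      \<bar>of_bool (Y = U) - (\<Sum>n\<in>J. c n * bialt (p n) Y)\<bar> \<le> e"
proof -
  let ?u = "nth_el U"
  obtain M where M: "0 \<le> M" "\<And>Y. Y \<in> G K \<Longrightarrow> (\<And>y. y \<in> Y \<Longrightarrow> \<bar>y\<bar> \<le> R) \<Longrightarrow>
    (\<Prod>i<K. \<bar>nth_el Y i\<bar> ^ K) / vandermonde Y \<le> M"
    using vandermonde_compensation by blast
  define C where "C = 2 + (\<Sum>j<K. 1 / \<bar>?u j\<bar> ^ K)"
  have C0: "0 \<le> (\<Sum>j<K. 1 / \<bar>?u j\<bar> ^ K)" by (intro sum_nonneg) simp
  have C1: "1 \<le> C" using C0 by (simp add: C_def)
  define D where "D = vandermonde U * M * (real (card {s. s permutes {0..<K}}) * (real K * C ^ K))"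
  have D0: "0 \<le> D"
    unfolding D_def using vandermonde_pos[OF U] M(1) C1
    by (intro mult_nonneg_nonneg zero_le_power) simp_all
  define e' where "e' = min 1 (e / (D + 1))"
  have e': "0 < e'" "e' \<le> 1" "D * e' \<le> e"
  proof -
    show "0 < e'" "e' \<le> 1" using e D0 by (auto simp: e'_def)
    have "D * e' \<le> D * (e / (D + 1))" using D0 by (intro mult_left_mono) (auto simp: e'_def)
    also have "\<dots> = D / (D + 1) * e" by simp
    also have "\<dots> \<le> 1 * e" using D0 e by (intro mult_right_mono) auto
    finally show "D * e' \<le> e" by simp
  qed
  have "\<forall>j. \<exists>a d. j < K \<longrightarrow> (\<forall>y\<in>L. \<bar>y\<bar> \<le> R \<longrightarrow>
      \<bar>(if y = ?u j then 1 / ?u j ^ K else 0) - (\<Sum>k\<le>d. a k * y ^ k)\<bar> < e')"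
    using bump_polynomial[OF _ e'(1)] nth_el_in[OF U] confsD(1)[OF U] by (meson subsetD)
  from choice[OF this] obtain a where "\<forall>j. \<exists>d. j < K \<longrightarrow> (\<forall>y\<in>L. \<bar>y\<bar> \<le> R \<longrightarrow>
      \<bar>(if y = ?u j then 1 / ?u j ^ K else 0) - (\<Sum>k\<le>d. a j k * y ^ k)\<bar> < e')" ..
  from choice[OF this] obtain d where ad: "\<forall>j. j < K \<longrightarrow> (\<forall>y\<in>L. \<bar>y\<bar> \<le> R \<longrightarrow>
      \<bar>(if y = ?u j then 1 / ?u j ^ K else 0) - (\<Sum>k\<le>d j. a j k * y ^ k)\<bar> < e')" ..
  show thesis
  proof (rule that[of "PiE {..<K} (\<lambda>j. {..d j})" "\<lambda>n. vandermonde U * (\<Prod>j<K. a j (n j))" "\<lambda>n j. K + n j"])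
    show "finite (PiE {..<K} (\<lambda>j. {..d j}))" by (intro finite_PiE) auto
    fix Y assume Y: "Y \<in> G K" and R: "\<And>y. y \<in> Y \<Longrightarrow> \<bar>y\<bar> \<le> R"
    let ?y = "nth_el Y"
    define A where "A i j = (if ?y i = ?u j then 1 / ?u j ^ K else 0)" for i j
    define B where "B i j = (\<Sum>k\<le>d j. a j k * ?y i ^ k)" for i j
    let ?dA = "Determinant.det (mat K K (\<lambda>(i, j). A i j))"
    let ?dB = "Determinant.det (mat K K (\<lambda>(i, j). B i j))"
    let ?w = "\<Prod>i<K. ?y i ^ K"
    have V: "0 < vandermonde Y" "0 < vandermonde U" using vandermonde_pos Y U by auto
    have "mat K K (\<lambda>(i, j). if ?y i = ?u j then 1 else 0) = mat K K (\<lambda>(i, j). ?y i ^ K * A i j)"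
    proof (rule eq_matI)
      fix i j assume "i < dim_row (mat K K (\<lambda>(i, j). ?y i ^ K * A i j))"
        "j < dim_col (mat K K (\<lambda>(i, j). ?y i ^ K * A i j))"
      moreover have "?u j \<noteq> 0" if "j < K"
        using nth_el_in[OF U that] confsD(1)[OF U] L_nz by auto
      ultimately show "mat K K (\<lambda>(i, j). if ?y i = ?u j then 1 else 0) $$ (i, j)
          = mat K K (\<lambda>(i, j). ?y i ^ K * A i j) $$ (i, j)"
        by (simp add: A_def)
    qed auto
    then have ind: "of_bool (Y = U) = ?w * ?dA"
      using det_indicator[OF Y U] det_scale_rows[where n = K and d = "\<lambda>i. ?y i ^ K" and a = A] by simp
    then have 1: "of_bool (Y = U) = vandermonde U / vandermonde Y * (?w * ?dA)"
      using V by (cases "Y = U") auto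
    have "(\<Sum>n\<in>PiE {..<K} (\<lambda>j. {..d j}). (\<Prod>j<K. a j (n j)) * alternant K ?y (\<lambda>j. K + n j)) = ?w * ?dB"
      unfolding det_polynomials[symmetric] B_def by (rule det_scale_rows)
    moreover have "(\<Sum>n\<in>PiE {..<K} (\<lambda>j. {..d j}). vandermonde U * (\<Prod>j<K. a j (n j)) * bialt (\<lambda>j. K + n j) Y)
        = vandermonde U / vandermonde Y
          * (\<Sum>n\<in>PiE {..<K} (\<lambda>j. {..d j}). (\<Prod>j<K. a j (n j)) * alternant K ?y (\<lambda>j. K + n j))"
      unfolding bialt_def confsD(3)[OF Y] sum_distrib_left by (rule sum.cong) auto
    ultimately have 2: "(\<Sum>n\<in>PiE {..<K} (\<lambda>j. {..d j}). vandermonde U * (\<Prod>j<K. a j (n j)) * bialt (\<lambda>j. K + n j) Y)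
        = vandermonde U / vandermonde Y * (?w * ?dB)" by simp
    have AB: "\<bar>A i j - B i j\<bar> \<le> e'" if "i < K" "j < K" for i j
      using ad[rule_format, OF that(2), of "?y i"] nth_el_in[OF Y that(1)] confsD(1)[OF Y] R
      unfolding A_def B_def by force
    have Ab: "\<bar>A i j\<bar> \<le> C - 1" if "i < K" "j < K" for i j
    proof -
      have "1 / \<bar>?u j\<bar> ^ K \<le> (\<Sum>j<K. 1 / \<bar>?u j\<bar> ^ K)"
        using that(2) by (intro member_le_sum) auto
      then show ?thesis using C0 by (simp add: A_def C_def power_abs)
    qed
    have "\<bar>?dA - ?dB\<bar> \<le> real (card {s. s permutes {0..<K}}) * (real K * C ^ K * e')"
    proof (rule det_diff_le[OF _ _ AB C1])
      fix i j assume ij: "i < K" "j < K"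
      show "\<bar>A i j\<bar> \<le> C" using Ab[OF ij] by simp
      show "\<bar>B i j\<bar> \<le> C" using Ab[OF ij] AB[OF ij] e'(2) by linarith
    qed (use e' in auto)
    moreover have "\<bar>?w\<bar> / vandermonde Y \<le> M"
      using M(2)[OF Y R] by (simp add: abs_prod power_abs)
    ultimately have "vandermonde U * ((\<bar>?w\<bar> / vandermonde Y) * \<bar>?dA - ?dB\<bar>)
        \<le> vandermonde U * (M * (real (card {s. s permutes {0..<K}}) * (real K * C ^ K * e')))"
      using V M(1) by (intro mult_left_mono mult_mono) auto
    also have "\<dots> = D * e'" by (simp add: D_def)
    also have "\<dots> \<le> e" by (rule e'(3))
    finally have "vandermonde U * ((\<bar>?w\<bar> / vandermonde Y) * \<bar>?dA - ?dB\<bar>) \<le> e" .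
    moreover have "\<bar>of_bool (Y = U) - (\<Sum>n\<in>PiE {..<K} (\<lambda>j. {..d j}).
        vandermonde U * (\<Prod>j<K. a j (n j)) * bialt (\<lambda>j. K + n j) Y)\<bar>
        = vandermonde U * ((\<bar>?w\<bar> / vandermonde Y) * \<bar>?dA - ?dB\<bar>)"
    proof -
      have "vandermonde U / vandermonde Y * (?w * ?dA) - vandermonde U / vandermonde Y * (?w * ?dB)
          = vandermonde U * (?w / vandermonde Y * (?dA - ?dB))" by (simp add: right_diff_distrib)
      then show ?thesis unfolding 1 2 using V by (simp add: abs_mult)
    qed
    ultimately show "\<bar>of_bool (Y = U) - (\<Sum>n\<in>PiE {..<K} (\<lambda>j. {..d j}).
        vandermonde U * (\<Prod>j<K. a j (n j)) * bialt (\<lambda>j. K + n j) Y)\<bar> \<le> e" by simp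
  qed
qed

end

section \<open>The limit of a stabilizing sequence\<close>

context qlattice
begin

lemma agree_bound:
  assumes Z: "Z \<in> G N" and ag: "agree (Suc k) Z X" and z: "z \<in> Z"
  shows "\<bar>z\<bar> \<le> \<bar>variational X 0\<bar>"
proof -
  obtain i where "variational Z i = z" using variational_surj[OF G_bconf[OF Z] z] by blast
  then have "\<bar>z\<bar> \<le> \<bar>variational Z 0\<bar>" using variational_abs_mono[OF G_bconf[OF Z], of 0 i] by simp
  then show ?thesis using ag by (simp add: agree_def)
qed

text \<open>The weight of \<open>U\<close> is the expectation of its indicator, which is uniformly close to a linear
  combination of ratios of alternants on all configurations that can occur. Their expectations
  converge.\<close>

lemma pmf_links_tendsto:
  assumes X: "X \<in> Ginf"
  shows "\<exists>l. ((\<lambda>(N, Z). pmf (links K N Z) U) \<longlongrightarrow> l) (stab_filter X)"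
proof (cases "U \<in> G K")
  case False
  have "\<forall>\<^sub>F x in stab_filter X. 0 = (case x of (N, Z) \<Rightarrow> pmf (links K N Z) U)"
    unfolding eventually_stab_filter
  proof (intro exI[of _ K] allI impI)
    fix N Z assume "K \<le> N" "Z \<in> G N" "agree K Z X"
    then have "U \<notin> set_pmf (links K N Z)" using set_links[of K N Z U] False by blast
    then show "0 = (case (N, Z) of (N, Z) \<Rightarrow> pmf (links K N Z) U)" by (simp add: set_pmf_iff)
  qed
  then show ?thesis by (blast intro: Lim_transform_eventually tendsto_const)
next
  case U: True
  let ?R = "\<bar>variational X 0\<bar>"
  show ?thesis
  proof (rule limit_if_approximable[OF stab_filter_nontrivial[OF X]])
    fix e :: real assume e: "0 < e"
    obtain J :: "(nat \<Rightarrow> nat) set" and c p where J: "finite J"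
      "\<And>Y. Y \<in> G K \<Longrightarrow> (\<And>y. y \<in> Y \<Longrightarrow> \<bar>y\<bar> \<le> ?R) \<Longrightarrow>
        \<bar>of_bool (Y = U) - (\<Sum>n\<in>J. c n * bialt (p n) Y)\<bar> \<le> e"
      using indicator_approx[OF U e] by blast
    have "\<forall>n. \<exists>l. ((\<lambda>(N, Z). measure_pmf.expectation (links K N Z) (bialt (p n))) \<longlongrightarrow> l) (stab_filter X)"
      using moment_tendsto[OF X] by blast
    from choice[OF this] obtain l where
      l: "\<And>n. ((\<lambda>(N, Z). measure_pmf.expectation (links K N Z) (bialt (p n))) \<longlongrightarrow> l n) (stab_filter X)"
      by blast
    have "((\<lambda>x. \<Sum>n\<in>J. c n * (case x of (N, Z) \<Rightarrow> measure_pmf.expectation (links K N Z) (bialt (p n))))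
        \<longlongrightarrow> (\<Sum>n\<in>J. c n * l n)) (stab_filter X)"
      by (intro tendsto_sum tendsto_mult tendsto_const l)
    moreover have "\<forall>\<^sub>F x in stab_filter X. \<bar>(case x of (N, Z) \<Rightarrow> pmf (links K N Z) U)
        - (\<Sum>n\<in>J. c n * (case x of (N, Z) \<Rightarrow> measure_pmf.expectation (links K N Z) (bialt (p n))))\<bar> \<le> e"
      unfolding eventually_stab_filter
    proof (intro exI[of _ "Suc K"] allI impI)
      fix N Z assume N: "Suc K \<le> N" and Z: "Z \<in> G N" and ag: "agree (Suc K) Z X"
      let ?p = "links K N Z"
      have KN: "K \<le> N" using N by simp
      have sup: "Y \<in> G K" "\<And>y. y \<in> Y \<Longrightarrow> \<bar>y\<bar> \<le> ?R" if "Y \<in> set_pmf ?p" for Y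
        using set_links[OF KN Z that] links_abs_le[OF KN Z agree_bound[OF Z ag] that] by blast+
      have int: "integrable (measure_pmf ?p) (bialt r)" for r
      proof -
        obtain B where B: "\<And>Y. Y \<in> G K \<Longrightarrow> (\<And>y. y \<in> Y \<Longrightarrow> \<bar>y\<bar> \<le> ?R) \<Longrightarrow> \<bar>bialt r Y\<bar> \<le> B"
          using bialt_bounded[of K ?R r] by blast
        show ?thesis by (rule integrable_bounded_pmf[of _ _ B]) (use B sup in blast)
      qed
      have "pmf ?p U = measure_pmf.expectation ?p (\<lambda>Y. of_bool (Y = U))"
      proof -
        have "(\<lambda>Y. of_bool (Y = U) :: real) = indicator {U}" by (auto simp: indicator_def fun_eq_iff)
        then show ?thesis by (simp add: measure_pmf_single)
      qed
      then have "pmf ?p U - (\<Sum>n\<in>J. c n * measure_pmf.expectation ?p (bialt (p n)))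
          = measure_pmf.expectation ?p (\<lambda>Y. of_bool (Y = U) - (\<Sum>n\<in>J. c n * bialt (p n) Y))"
        using int integrable_bounded_pmf[of ?p "\<lambda>Y. of_bool (Y = U)" 1]
        by (simp add: Bochner_Integration.integral_sum)
      also have "\<bar>\<dots>\<bar> \<le> e"
      proof (rule expectation_abs_le)
        fix Y assume "Y \<in> set_pmf ?p"
        from J(2)[OF sup[OF this]] show "\<bar>of_bool (Y = U) - (\<Sum>n\<in>J. c n * bialt (p n) Y)\<bar> \<le> e" .
      qed
      finally show "\<bar>(case (N, Z) of (N, Z) \<Rightarrow> pmf (links K N Z) U)
        - (\<Sum>n\<in>J. c n * (case (N, Z) of (N, Z) \<Rightarrow> measure_pmf.expectation (links K N Z) (bialt (p n))))\<bar> \<le> e"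
        by simp
    qed
    ultimately show "\<exists>g l. (g \<longlongrightarrow> l) (stab_filter X)
        \<and> (\<forall>\<^sub>F x in stab_filter X. \<bar>(case x of (N, Z) \<Rightarrow> pmf (links K N Z) U) - g x\<bar> \<le> e)" by blast
  qed
qed

text \<open>No mass escapes to configurations with a point at 0: on a high level \<open>M\<close> the first \<open>K\<close>
  points of the variational series are most likely those of \<open>X\<close>, and going down from \<open>M\<close> to
  \<open>K\<close> keeps \<open>K\<close> points away from 0.\<close>

lemma links_tight:
  assumes X: "X \<in> Ginf" and e: "0 < e"
  shows "\<exists>A. finite A \<and> (\<forall>\<^sub>F x in stab_filter X. 1 - e \<le> measure_pmf.prob (case x of (N, Z) \<Rightarrow> links K N Z) A)"
proof -
  let ?x = "variational X"
  note bX = Ginf_bconf[OF X] and vX = Ginf_valid[OF X]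
  obtain C where C: "0 \<le> C" "\<And>M N Z. M \<le> N \<Longrightarrow> Z \<in> G N \<Longrightarrow>
    measure_pmf.prob (links M N Z) {Y. \<not> agree K Y Z} \<le> C * \<rho> ^ M"
    using links_stable[of K] by blast
  have "(\<lambda>M. C * \<rho> ^ M) \<longlonglongrightarrow> C * 0" using \<rho>_bounds by (intro tendsto_intros LIMSEQ_realpow_zero) auto
  then have "\<forall>\<^sub>F M in sequentially. C * \<rho> ^ M < e / 2"
    using e order_tendstoD(2)[of "\<lambda>M. C * \<rho> ^ M" 0 sequentially "e / 2"] by simp
  then obtain M0 where M0: "\<forall>M\<ge>M0. C * \<rho> ^ M < e / 2" unfolding eventually_sequentially ..
  define M where "M = max M0 K"
  have "M0 \<le> M" "K \<le> M" by (simp_all add: M_def)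
  then have M: "C * \<rho> ^ M < e / 2" "K \<le> M" using M0 by blast+
  define \<eta> where "\<eta> = \<bar>?x K\<bar>"
  have \<eta>: "0 < \<eta>" using variational_nz[OF bX] vX by (simp add: \<eta>_def)
  have "0 < e / 2" using e by simp
  from links_large_points[OF M(2) \<eta> this, of K] obtain \<delta> where \<delta>: "0 < \<delta>"
    "\<And>Z. Z \<in> G M \<Longrightarrow> K \<le> card {z \<in> Z. \<eta> \<le> \<bar>z\<bar>} \<Longrightarrow>
      measure_pmf.prob (links K M Z) {Y. card {y \<in> Y. \<delta> \<le> \<bar>y\<bar>} < K} \<le> e / 2"
    unfolding min.idem by blast
  define A where "A = Pow {y \<in> L. \<delta> \<le> \<bar>y\<bar> \<and> \<bar>y\<bar> \<le> \<bar>?x 0\<bar>}"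
  have "finite A" unfolding A_def using finite_annulus[OF \<delta>(1)] by simp
  moreover have "\<forall>\<^sub>F x in stab_filter X. 1 - e \<le> measure_pmf.prob (case x of (N, Z) \<Rightarrow> links K N Z) A"
    unfolding eventually_stab_filter
  proof (intro exI[of _ "Suc M"] allI impI)
    fix N Z assume N: "Suc M \<le> N" and Z: "Z \<in> G N" and ag: "agree (Suc M) Z X"
    have KN: "K \<le> N" and MN: "M \<le> N" using N M by auto
    let ?B = "{Y. card {y \<in> Y. \<delta> \<le> \<bar>y\<bar>} < K}" and ?E = "{W. \<not> agree K W Z}"
    have "measure_pmf.prob (links K N Z) (- A) \<le> measure_pmf.prob (links K N Z) ?B"
    proof (rule prob_mono_pmf, rule ccontr)
      fix Y assume Y: "Y \<in> set_pmf (links K N Z)" "Y \<in> - A" "Y \<notin> ?B"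
      have YK: "Y \<in> G K" by (rule set_links[OF KN Z Y(1)])
      have "card Y \<le> card {y \<in> Y. \<delta> \<le> \<bar>y\<bar>}" using Y(3) unfolding confsD(3)[OF YK] mem_Collect_eq not_less .
      then have "{y \<in> Y. \<delta> \<le> \<bar>y\<bar>} = Y" by (intro card_seteq confsD(2)[OF YK]) blast
      moreover have "\<bar>y\<bar> \<le> \<bar>?x 0\<bar>" if "y \<in> Y" for y
        using links_abs_le[OF KN Z agree_bound[OF Z ag] Y(1) that] .
      ultimately have "Y \<in> A" using confsD(1)[OF YK] unfolding A_def by blast
      then show False using Y(2) by simp
    qed
    also have "\<dots> = measure_pmf.expectation (links M N Z) (\<lambda>W. measure_pmf.prob (links K M W) ?B)"
      unfolding links_split[OF M(2) MN, of Z] by (rule prob_bind)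
    also have "\<dots> \<le> measure_pmf.expectation (links M N Z) (\<lambda>W. e / 2 + indicator ?E W)"
    proof (rule expectation_mono[where B = 1 and C = "e / 2 + 1"])
      fix W assume W: "W \<in> set_pmf (links M N Z)"
      have WM: "W \<in> G M" by (rule set_links[OF MN Z W])
      note bW = G_bconf[OF WM]
      show "measure_pmf.prob (links K M W) ?B \<le> e / 2 + indicator ?E W"
      proof (cases "agree K W Z")
        case False
        then have "indicator ?E W = (1 :: real)" by simp
        then show ?thesis using e measure_pmf.prob_le_1[of "links K M W" ?B] by linarith
      next
        case True
        have wx: "variational W i = ?x i" if "i < K" for i
          using True ag that M(2) by (simp add: agree_def)
        have "variational W ` {..<K} \<subseteq> {z \<in> W. \<eta> \<le> \<bar>z\<bar>}"
        proof (rule image_subsetI)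
          fix i assume "i \<in> {..<K}"
          then have i: "i < K" by simp
          have "valid W i" using i M(2) G_valid[OF WM] by simp
          moreover have "\<eta> \<le> \<bar>variational W i\<bar>"
            unfolding wx[OF i] \<eta>_def using i by (intro variational_abs_mono[OF bX]) simp
          ultimately show "variational W i \<in> {z \<in> W. \<eta> \<le> \<bar>z\<bar>}" using variational_in(1)[OF bW] by simp
        qed
        moreover have "inj_on (variational W) {..<K}"
        proof (rule inj_on_subset[OF variational_inj[OF bW]], rule subsetI)
          fix i assume "i \<in> {..<K}"
          then show "i \<in> {k. valid W k}" using M(2) G_valid[OF WM, of i] by simp
        qed
        ultimately have "K \<le> card {z \<in> W. \<eta> \<le> \<bar>z\<bar>}"
          using card_inj_on_le[of "variational W" "{..<K}" "{z \<in> W. \<eta> \<le> \<bar>z\<bar>}"] confsD(2)[OF WM] by simp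
        from \<delta>(2)[OF WM this] show ?thesis using True by simp
      qed
      show "\<bar>e / 2 + indicator ?E W\<bar> \<le> e / 2 + 1" using e by (simp add: indicator_def)
    qed simp
    also have "\<dots> = e / 2 + measure_pmf.prob (links M N Z) ?E"
      using integrable_bounded_pmf[of "links M N Z" "indicator ?E" 1]
      by (subst Bochner_Integration.integral_add) (auto simp: indicator_def)
    also have "\<dots> \<le> e" using C(2)[OF MN Z] M(1) by linarith
    finally show "1 - e \<le> measure_pmf.prob (case (N, Z) of (N, Z) \<Rightarrow> links K N Z) A"
      unfolding prob_compl by simp
  qed
  ultimately show ?thesis by blast
qed

text \<open>The \<open>K\<close>-th component of $M^{(X)}$, as a probability mass function.\<close>

definition limit_law :: "real set \<Rightarrow> nat \<Rightarrow> real set pmf" where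
  "limit_law X K = (SOME Q. \<forall>U. ((\<lambda>(N, Z). pmf (links K N Z) U) \<longlongrightarrow> pmf Q U) (stab_filter X))"

lemma limit_law_tendsto:
  assumes X: "X \<in> Ginf"
  shows "((\<lambda>(N, Z). pmf (links K N Z) U) \<longlongrightarrow> pmf (limit_law X K) U) (stab_filter X)"
proof -
  have "\<exists>Q. \<forall>U. ((\<lambda>x. pmf (case x of (N, Z) \<Rightarrow> links K N Z) U) \<longlongrightarrow> pmf Q U) (stab_filter X)"
  proof (rule pmf_limit_exists[OF stab_filter_nontrivial[OF X]])
    show "\<exists>l. ((\<lambda>x. pmf (case x of (N, Z) \<Rightarrow> links K N Z) U) \<longlongrightarrow> l) (stab_filter X)" for U
      using pmf_links_tendsto[OF X, of K U] by (simp add: case_prod_unfold)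
  qed (rule links_tight[OF X])
  then have "\<exists>Q. \<forall>U. ((\<lambda>(N, Z). pmf (links K N Z) U) \<longlongrightarrow> pmf Q U) (stab_filter X)"
    by (simp add: case_prod_unfold)
  from someI_ex[OF this] show ?thesis unfolding limit_law_def by blast
qed

lemma limit_law_tendsto':
  "X \<in> Ginf \<Longrightarrow> ((\<lambda>x. pmf (links K (fst x) (snd x)) U) \<longlongrightarrow> pmf (limit_law X K) U) (stab_filter X)"
  using limit_law_tendsto[of X K U] by (simp only: case_prod_unfold)

end

section \<open>Coherent families\<close>

lemma expectation_has_sum_bounded:
  fixes f :: "'a \<Rightarrow> real"
  assumes B: "\<And>x. \<bar>f x\<bar> \<le> B"
  shows "((\<lambda>x. pmf p x * f x) has_sum measure_pmf.expectation p f) UNIV"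
proof -
  have "(\<lambda>x. norm (pmf p x * f x)) summable_on UNIV"
  proof (rule summable_on_comparison_test)
    show "(\<lambda>x. B * pmf p x) summable_on UNIV"
      using pmf_has_sum[of p UNIV] by (intro summable_on_cmult_right has_sum_imp_summable)
    fix x
    have "pmf p x * \<bar>f x\<bar> \<le> pmf p x * B" by (intro mult_left_mono B) simp
    then show "norm (pmf p x * f x) \<le> B * pmf p x" by (simp add: abs_mult mult.commute)
  qed simp
  then have "(\<lambda>x. pmf p x * f x) summable_on UNIV"
    by (rule summable_on_iff_abs_summable_on_real[THEN iffD2])
  then have "((\<lambda>x. pmf p x * f x) has_sum (\<Sum>\<^sub>\<infinity>x\<in>UNIV. pmf p x * f x)) UNIV"
    by (rule has_sum_infsum)
  moreover have "measure_pmf.expectation p f = (\<Sum>\<^sub>\<infinity>x\<in>UNIV. pmf p x * f x)"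
    by (rule expectation_infsum[OF B]) simp
  ultimately show ?thesis by (simp only:)
qed

lemma expectation_cond:
  fixes f :: "'a \<Rightarrow> real"
  assumes B: "\<And>x. \<bar>f x\<bar> \<le> B" and E: "0 < measure_pmf.prob p E"
  shows "measure_pmf.expectation (cond_pmf p E) f
    = measure_pmf.expectation p (\<lambda>x. indicator E x * f x) / measure_pmf.prob p E"
proof (rule expectation_has_sum)
  have ne: "set_pmf p \<inter> E \<noteq> {}" using E measure_pmf_zero_iff[of p E] by auto
  have "((\<lambda>x. pmf p x * (indicator E x * f x)) has_sum
      measure_pmf.expectation p (\<lambda>x. indicator E x * f x)) UNIV"
  proof (rule expectation_has_sum_bounded[of _ "\<bar>B\<bar>"])
    fix x show "\<bar>indicator E x * f x\<bar> \<le> \<bar>B\<bar>" using B[of x] order_trans[OF abs_ge_zero B[of x]] by (simp add: indicator_def)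
  qed
  from has_sum_cmult_left[OF this, of "1 / measure_pmf.prob p E"]
  have "((\<lambda>x. pmf p x * (indicator E x * f x) * (1 / measure_pmf.prob p E)) has_sum
      measure_pmf.expectation p (\<lambda>x. indicator E x * f x) / measure_pmf.prob p E) UNIV"
    by (simp only: times_divide_eq_right mult_1_right)
  moreover have "(\<lambda>x. pmf (cond_pmf p E) x * f x)
      = (\<lambda>x. pmf p x * (indicator E x * f x) * (1 / measure_pmf.prob p E))"
    by (rule ext) (simp add: pmf_cond[OF ne] indicator_def)
  ultimately show "((\<lambda>x. pmf (cond_pmf p E) x * f x) has_sum
      measure_pmf.expectation p (\<lambda>x. indicator E x * f x) / measure_pmf.prob p E) UNIV"
    by (simp only:)
qed

lemma prob_mixture:
  assumes "\<And>Y. pmf P Y = (1 - t) * pmf A Y + t * pmf B Y"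
  shows "measure_pmf.prob P E = (1 - t) * measure_pmf.prob A E + t * measure_pmf.prob B E"
proof -
  have "((\<lambda>Y. (1 - t) * pmf A Y + t * pmf B Y) has_sum
      ((1 - t) * measure_pmf.prob A E + t * measure_pmf.prob B E)) E"
    by (intro has_sum_add has_sum_cmult_right pmf_has_sum)
  then have "(pmf P has_sum ((1 - t) * measure_pmf.prob A E + t * measure_pmf.prob B E)) E"
    by (simp only: assms[symmetric])
  then show ?thesis using pmf_has_sum[of P E] has_sum_unique by blast
qed

lemma real_Cauchy_geometric:
  fixes a :: "nat \<Rightarrow> real"
  assumes r: "0 < r" "r < 1" and a: "\<And>M N. M0 \<le> M \<Longrightarrow> M \<le> N \<Longrightarrow> \<bar>a N - a M\<bar> \<le> C * r ^ M"
  shows "convergent a"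
proof -
  have "(\<lambda>M. C * r ^ M) \<longlonglongrightarrow> C * 0" using r by (intro tendsto_intros LIMSEQ_realpow_zero) auto
  then have lim: "(\<lambda>M. C * r ^ M) \<longlonglongrightarrow> 0" by simp
  have "Cauchy a"
    unfolding Cauchy_altdef2
  proof (intro allI impI)
    fix e :: real assume "0 < e"
    then have "\<forall>\<^sub>F M in sequentially. C * r ^ M < e" using order_tendstoD(2)[OF lim] by blast
    then obtain M1 where M1: "\<forall>M\<ge>M1. C * r ^ M < e" unfolding eventually_sequentially ..
    let ?M = "max M0 M1"
    have "dist (a n) (a ?M) < e" if "?M \<le> n" for n
    proof -
      have "\<bar>a n - a ?M\<bar> \<le> C * r ^ ?M" using that by (intro a) auto
      also have "\<dots> < e" using M1 by simp
      finally show ?thesis by (simp add: dist_real_def)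
    qed
    then show "\<exists>N. \<forall>n\<ge>N. dist (a n) (a N) < e" by blast
  qed
  then show ?thesis by (rule Cauchy_convergent)
qed

context qlattice
begin

definition coherent_family :: "(nat \<Rightarrow> real set pmf) \<Rightarrow> bool" where
  "coherent_family P \<longleftrightarrow> (\<forall>N\<ge>1. set_pmf (P N) \<subseteq> G N \<and> bind_pmf (P (Suc N)) (link N) = P N)"

definition extreme_family :: "(nat \<Rightarrow> real set pmf) \<Rightarrow> bool" where
  "extreme_family P \<longleftrightarrow> coherent_family P \<and> (\<forall>A B t. coherent_family A \<and> coherent_family B \<and> 0 < t \<and> t < 1 \<and>
     (\<forall>N\<ge>1. \<forall>Y. pmf (P N) Y = (1 - t) * pmf (A N) Y + t * pmf (B N) Y) \<longrightarrow> (\<forall>N\<ge>1. A N = B N))"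

text \<open>Each term of the variational series converges in probability to the corresponding term of \<open>v\<close>.\<close>

definition concentrates :: "(nat \<Rightarrow> real set pmf) \<Rightarrow> (nat \<Rightarrow> real) \<Rightarrow> bool" where
  "concentrates P v \<longleftrightarrow> (\<forall>i. (\<lambda>N. measure_pmf.prob (P N) {Z. variational Z i = v i}) \<longlonglongrightarrow> 1)"

lemma coh_set: "coherent_family P \<Longrightarrow> 1 \<le> N \<Longrightarrow> Z \<in> set_pmf (P N) \<Longrightarrow> Z \<in> G N"
  unfolding coherent_family_def by blast

lemma coh_links:
  assumes P: "coherent_family P" and K: "1 \<le> K" "K \<le> N"
  shows "bind_pmf (P N) (links K N) = P K"
  using K(2)
proof (induction N rule: dec_induct)
  case base
  have "links K K = return_pmf" by (rule ext) (rule links_refl)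
  then show ?case by (simp add: bind_return_pmf')
next
  case (step N)
  have "bind_pmf (P (Suc N)) (links K (Suc N)) = bind_pmf (bind_pmf (P (Suc N)) (link N)) (links K N)"
    using step.hyps by (simp add: bind_assoc_pmf)
  also have "bind_pmf (P (Suc N)) (link N) = P N"
    using P K step.hyps unfolding coherent_family_def by (meson order_trans)
  finally show ?case using step.IH by simp
qed

lemma links_one: "links K (Suc K) = link K"
proof (rule ext)
  fix X
  have "links K K = return_pmf" by (rule ext) (rule links_refl)
  then show "links K (Suc K) X = link K X" by (simp add: bind_return_pmf')
qed

text \<open>Coherence passes to pointwise limits, since a link maps bounded functions to bounded functions
  and pointwise convergence of probability weights controls their expectations.\<close>

lemma coh_limit:
  assumes F: "F \<noteq> bot" and ev: "\<forall>\<^sub>F i in F. bind_pmf (p' i) (link K) = p i"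
    and lim: "\<And>U. ((\<lambda>i. pmf (p i) U) \<longlongrightarrow> pmf Q U) F" "\<And>U. ((\<lambda>i. pmf (p' i) U) \<longlongrightarrow> pmf Q' U) F"
  shows "bind_pmf Q' (link K) = Q"
proof (rule pmf_eqI)
  fix U
  have "((\<lambda>i. measure_pmf.expectation (p' i) (\<lambda>Z. pmf (link K Z) U))
      \<longlongrightarrow> measure_pmf.expectation Q' (\<lambda>Z. pmf (link K Z) U)) F"
    by (rule pmf_tendsto_expectation[OF lim(2), of _ 1]) (simp add: pmf_le_1)
  then have "((\<lambda>i. pmf (bind_pmf (p' i) (link K)) U) \<longlongrightarrow> pmf (bind_pmf Q' (link K)) U) F"
    by (simp only: pmf_bind)
  moreover have "\<forall>\<^sub>F i in F. pmf (bind_pmf (p' i) (link K)) U = pmf (p i) U"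
    using ev by eventually_elim simp
  ultimately have "((\<lambda>i. pmf (p i) U) \<longlongrightarrow> pmf (bind_pmf Q' (link K)) U) F"
    by (rule Lim_transform_eventually)
  then show "pmf (bind_pmf Q' (link K)) U = pmf Q U" using tendsto_unique[OF F _ lim(1)] by blast
qed

lemma set_limit:
  assumes F: "F \<noteq> bot" and ev: "\<forall>\<^sub>F i in F. set_pmf (p i) \<subseteq> S"
    and lim: "\<And>U. ((\<lambda>i. pmf (p i) U) \<longlongrightarrow> pmf Q U) F"
  shows "set_pmf Q \<subseteq> S"
proof
  fix U assume U: "U \<in> set_pmf Q"
  show "U \<in> S"
  proof (rule ccontr)
    assume "U \<notin> S"
    then have "\<forall>\<^sub>F i in F. pmf (p i) U = 0" using ev by (auto elim!: eventually_mono simp: set_pmf_iff)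
    then have "((\<lambda>i. pmf (p i) U) \<longlongrightarrow> 0) F" by (rule tendsto_eventually)
    then have "pmf Q U = 0" using tendsto_unique[OF F lim] by blast
    then show False using U by (simp add: set_pmf_iff)
  qed
qed

lemma limit_law_set: "X \<in> Ginf \<Longrightarrow> set_pmf (limit_law X K) \<subseteq> G K"
proof (rule set_limit[OF stab_filter_nontrivial _ limit_law_tendsto'])
  assume "X \<in> Ginf"
  show "\<forall>\<^sub>F x in stab_filter X. set_pmf (links K (fst x) (snd x)) \<subseteq> G K"
    unfolding eventually_stab_filter using set_links by (intro exI[of _ K]) auto
qed auto

lemma limit_law_coherent:
  assumes X: "X \<in> Ginf"
  shows "coherent_family (limit_law X)"
  unfolding coherent_family_def
proof (intro allI impI conjI)
  fix K :: nat
  show "set_pmf (limit_law X K) \<subseteq> G K" by (rule limit_law_set[OF X])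
  show "bind_pmf (limit_law X (Suc K)) (link K) = limit_law X K"
  proof (rule coh_limit[OF stab_filter_nontrivial[OF X] _ limit_law_tendsto'[OF X] limit_law_tendsto'[OF X]])
    have "bind_pmf (links (Suc K) N Z) (link K) = links K N Z" if "Suc K \<le> N" for N Z
      using links_split[of K "Suc K" N Z] that by (simp only: links_one le_SucI order_refl)
    then show "\<forall>\<^sub>F x in stab_filter X. bind_pmf (links (Suc K) (fst x) (snd x)) (link K) = links K (fst x) (snd x)"
      unfolding eventually_stab_filter by (intro exI[of _ "Suc K"]) simp
  qed
qed

lemma concentrates_agree:
  assumes "concentrates P (variational X)"
  shows "(\<lambda>N. measure_pmf.prob (P N) {Z. \<not> agree k Z X}) \<longlonglongrightarrow> 0"
proof (rule tendsto_sandwich[OF _ _ tendsto_const])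
  have "(\<lambda>N. \<Sum>i<k. 1 - measure_pmf.prob (P N) {Z. variational Z i = variational X i}) \<longlonglongrightarrow> (\<Sum>i<k. 1 - 1)"
    using assms unfolding concentrates_def by (intro tendsto_intros) auto
  then show "(\<lambda>N. \<Sum>i<k. 1 - measure_pmf.prob (P N) {Z. variational Z i = variational X i}) \<longlonglongrightarrow> 0" by simp
  have "measure_pmf.prob (P N) {Z. \<not> agree k Z X}
      \<le> (\<Sum>i<k. 1 - measure_pmf.prob (P N) {Z. variational Z i = variational X i})" for N
  proof -
    have "{Z. \<not> agree k Z X} = (\<Union>i\<in>{..<k}. - {Z. variational Z i = variational X i})"
      by (auto simp: agree_def)
    then have "measure_pmf.prob (P N) {Z. \<not> agree k Z X}
        \<le> (\<Sum>i<k. measure_pmf.prob (P N) (- {Z. variational Z i = variational X i}))"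
      by (simp only:) (rule measure_UNION_le, auto)
    then show ?thesis by (simp only: prob_compl)
  qed
  then show "\<forall>\<^sub>F N in sequentially. measure_pmf.prob (P N) {Z. \<not> agree k Z X}
      \<le> (\<Sum>i<k. 1 - measure_pmf.prob (P N) {Z. variational Z i = variational X i})" by simp
qed simp

text \<open>A coherent family is an average of the rows of the links from ever higher levels. If it
  concentrates on configurations close to \<open>X\<close>, these rows are close to the limit.\<close>

lemma concentrates_unique:
  assumes P: "coherent_family P" and X: "X \<in> Ginf" and c: "concentrates P (variational X)" and K: "1 \<le> K"
  shows "P K = limit_law X K"
proof (rule pmf_eqI)
  fix U
  have "\<bar>pmf (P K) U - pmf (limit_law X K) U\<bar> \<le> e" if e: "0 < e" for e
  proof -
    have e2: "0 < e / 2" using e by simp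
    have "\<forall>\<^sub>F x in stab_filter X. dist (pmf (links K (fst x) (snd x)) U) (pmf (limit_law X K) U) < e / 2"
      by (rule tendstoD[OF limit_law_tendsto'[OF X] e2])
    then obtain k where k: "\<And>N Z. k \<le> N \<Longrightarrow> Z \<in> G N \<Longrightarrow> agree k Z X \<Longrightarrow>
      \<bar>pmf (links K N Z) U - pmf (limit_law X K) U\<bar> < e / 2"
      unfolding eventually_stab_filter by (auto simp: dist_real_def)
    have "\<forall>\<^sub>F N in sequentially. measure_pmf.prob (P N) {Z. \<not> agree k Z X} < e / 2"
      by (rule order_tendstoD(2)[OF concentrates_agree[OF c] e2])
    then obtain N0 where N0: "\<forall>N\<ge>N0. measure_pmf.prob (P N) {Z. \<not> agree k Z X} < e / 2"
      unfolding eventually_sequentially ..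
    define N where "N = N0 + k + K"
    have N: "N0 \<le> N" "k \<le> N" "K \<le> N" "1 \<le> N" using K by (auto simp: N_def)
    let ?f = "\<lambda>Z. pmf (links K N Z) U" and ?c = "pmf (limit_law X K) U" and ?E = "{Z. \<not> agree k Z X}"
    have fb: "\<bar>?f Z\<bar> \<le> 1" for Z by (simp add: pmf_le_1)
    have "pmf (P K) U = measure_pmf.expectation (P N) ?f"
      unfolding coh_links[OF P K N(3), symmetric] by (rule pmf_bind)
    then have "pmf (P K) U - ?c = measure_pmf.expectation (P N) (\<lambda>Z. ?f Z - ?c)"
      using integrable_bounded_pmf[of "P N" ?f 1] fb by simp
    also have "\<bar>\<dots>\<bar> \<le> measure_pmf.expectation (P N) (\<lambda>Z. \<bar>?f Z - ?c\<bar>)"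
      using integral_norm_bound[of "measure_pmf (P N)" "\<lambda>Z. ?f Z - ?c"] by simp
    also have "\<dots> \<le> measure_pmf.expectation (P N) (\<lambda>Z. e / 2 + indicator ?E Z)"
    proof (rule expectation_mono[where B = 1 and C = "e / 2 + 1"])
      fix Z assume Z: "Z \<in> set_pmf (P N)"
      have d1: "\<bar>?f Z - ?c\<bar> \<le> 1"
        using pmf_nonneg[of "links K N Z" U] pmf_nonneg[of "limit_law X K" U]
          pmf_le_1[of "links K N Z" U] pmf_le_1[of "limit_law X K" U] by linarith
      then show "\<bar>\<bar>?f Z - ?c\<bar>\<bar> \<le> 1" by simp
      show "\<bar>?f Z - ?c\<bar> \<le> e / 2 + indicator ?E Z"
      proof (cases "agree k Z X")
        case True
        then show ?thesis using k[OF N(2) coh_set[OF P N(4) Z] True] by simp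
      next
        case False
        then have "indicator ?E Z = (1 :: real)" by simp
        then show ?thesis using d1 e by linarith
      qed
      show "\<bar>e / 2 + indicator ?E Z\<bar> \<le> e / 2 + 1" using e by (simp add: indicator_def)
    qed
    also have "\<dots> = e / 2 + measure_pmf.prob (P N) ?E"
      using integrable_bounded_pmf[of "P N" "indicator ?E" 1]
      by (subst Bochner_Integration.integral_add) (auto simp: indicator_def)
    also have "\<dots> \<le> e" using N0 N(1) by (smt (verit) field_sum_of_halves)
    finally show ?thesis .
  qed
  then have "\<bar>pmf (P K) U - pmf (limit_law X K) U\<bar> \<le> 0" by (rule field_le_epsilon[of _ 0, simplified])
  then show "pmf (P K) U = pmf (limit_law X K) U" by simp
qed

text \<open>The stability estimate for the iterated links does not depend on the upper level, so it survives
  the limit.\<close>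

lemma limit_law_concentrates:
  assumes X: "X \<in> Ginf"
  shows "concentrates (limit_law X) (variational X)"
  unfolding concentrates_def
proof
  fix i
  obtain C where C: "0 \<le> C" "\<And>K N Z. K \<le> N \<Longrightarrow> Z \<in> G N \<Longrightarrow>
    measure_pmf.prob (links K N Z) {Y. \<not> agree (Suc i) Y Z} \<le> C * \<rho> ^ K"
    using links_stable[of "Suc i"] by blast
  let ?A = "{Z. variational Z i = variational X i}"
  have low: "1 - C * \<rho> ^ K \<le> measure_pmf.prob (limit_law X K) ?A" for K
  proof (rule tendsto_lowerbound[OF pmf_tendsto_prob[OF limit_law_tendsto'[OF X]] _ stab_filter_nontrivial[OF X]])
    show "\<forall>\<^sub>F x in stab_filter X. 1 - C * \<rho> ^ K \<le> measure_pmf.prob (links K (fst x) (snd x)) ?A"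
      unfolding eventually_stab_filter
    proof (intro exI[of _ "Suc i + K"] allI impI)
      fix N Z assume N: "Suc i + K \<le> N" and Z: "Z \<in> G N" and ag: "agree (Suc i + K) Z X"
      have "measure_pmf.prob (links K N Z) (- ?A) \<le> measure_pmf.prob (links K N Z) {Y. \<not> agree (Suc i) Y Z}"
      proof (rule prob_mono_pmf, rule CollectI, rule notI)
        fix Y assume "Y \<in> - ?A" "agree (Suc i) Y Z"
        then have "variational Z i \<noteq> variational X i" by (auto simp: agree_def)
        then show False using ag by (simp add: agree_def)
      qed
      also have "\<dots> \<le> C * \<rho> ^ K" using N by (intro C Z) simp
      finally show "1 - C * \<rho> ^ K \<le> measure_pmf.prob (links K (fst (N, Z)) (snd (N, Z))) ?A"
        unfolding prob_compl by simp
    qed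
  qed
  have "(\<lambda>K. 1 - C * \<rho> ^ K) \<longlonglongrightarrow> 1 - C * 0" using \<rho>_bounds by (intro tendsto_intros LIMSEQ_realpow_zero) auto
  then have l: "(\<lambda>K. 1 - C * \<rho> ^ K) \<longlonglongrightarrow> 1" by simp
  show "(\<lambda>K. measure_pmf.prob (limit_law X K) ?A) \<longlonglongrightarrow> 1"
    by (rule tendsto_sandwich[OF _ _ l tendsto_const]) (simp_all add: low)
qed

text \<open>Two different values of the same term cannot both have probability more than \<open>1/2\<close>.\<close>

lemma limit_law_inj:
  assumes X: "X \<in> Ginf" "Y \<in> Ginf" and eq: "\<And>K. 1 \<le> K \<Longrightarrow> limit_law X K = limit_law Y K"
  shows "X = Y"
proof (rule Ginf_eqI[OF X])
  fix i
  let ?A = "\<lambda>X. {Z. variational Z i = variational X i}"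
  have l: "(\<lambda>K. measure_pmf.prob (limit_law X K) (?A X)) \<longlonglongrightarrow> 1" "(\<lambda>K. measure_pmf.prob (limit_law Y K) (?A Y)) \<longlonglongrightarrow> 1"
    using limit_law_concentrates[OF X(1)] limit_law_concentrates[OF X(2)] unfolding concentrates_def by blast+
  have "\<forall>\<^sub>F K in sequentially. 1 / 2 < measure_pmf.prob (limit_law X K) (?A X)"
    "\<forall>\<^sub>F K in sequentially. 1 / 2 < measure_pmf.prob (limit_law Y K) (?A Y)"
    by (rule order_tendstoD(1)[OF l(1)], simp) (rule order_tendstoD(1)[OF l(2)], simp)
  then have "\<forall>\<^sub>F K in sequentially. 1 / 2 < measure_pmf.prob (limit_law X K) (?A X)
      \<and> 1 / 2 < measure_pmf.prob (limit_law Y K) (?A Y)" by (rule eventually_conj)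
  then obtain K0 where K0: "\<forall>K\<ge>K0. 1 / 2 < measure_pmf.prob (limit_law X K) (?A X)
      \<and> 1 / 2 < measure_pmf.prob (limit_law Y K) (?A Y)" unfolding eventually_sequentially ..
  let ?K = "Suc K0"
  have e: "limit_law Y ?K = limit_law X ?K" using eq[of ?K] by simp
  have 1: "1 / 2 < measure_pmf.prob (limit_law X ?K) (?A X)" "1 / 2 < measure_pmf.prob (limit_law X ?K) (?A Y)"
    using K0[rule_format, of ?K] unfolding e by simp_all
  show "variational X i = variational Y i"
  proof (rule ccontr)
    assume "variational X i \<noteq> variational Y i"
    then have "measure_pmf.prob (limit_law X ?K) (?A X) \<le> measure_pmf.prob (limit_law X ?K) (- ?A Y)"
      by (intro prob_mono_pmf) auto
    then show False using 1 unfolding prob_compl by linarith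
  qed
qed

text \<open>Components of a mixture that concentrates on \<open>X\<close> must concentrate on \<open>X\<close> as well, and
  concentration determines a coherent family.\<close>

lemma limit_law_extreme:
  assumes X: "X \<in> Ginf"
  shows "extreme_family (limit_law X)"
  unfolding extreme_family_def
proof (intro conjI allI impI)
  show "coherent_family (limit_law X)" by (rule limit_law_coherent[OF X])
  fix A B t and N :: nat assume *: "coherent_family A \<and> coherent_family B \<and> 0 < t \<and> t < 1 \<and>
     (\<forall>N\<ge>1. \<forall>Y. pmf (limit_law X N) Y = (1 - t) * pmf (A N) Y + t * pmf (B N) Y)" and N: "1 \<le> N"
  have conc: "concentrates A (variational X)" if s: "0 < s" "s < 1"
    and mix: "\<And>N Y. 1 \<le> N \<Longrightarrow> pmf (limit_law X N) Y = (1 - s) * pmf (A N) Y + s * pmf (B N) Y" for A B s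
    unfolding concentrates_def
  proof
    fix i
    let ?E = "{Z. variational Z i = variational X i}"
    let ?p = "\<lambda>N. measure_pmf.prob (limit_law X N) ?E"
    have "?p \<longlonglongrightarrow> 1" using limit_law_concentrates[OF X] unfolding concentrates_def by blast
    then have "(\<lambda>N. 1 - (1 - ?p N) / (1 - s)) \<longlonglongrightarrow> 1 - (1 - 1) / (1 - s)" using s by (intro tendsto_intros) auto
    then have l: "(\<lambda>N. 1 - (1 - ?p N) / (1 - s)) \<longlonglongrightarrow> 1" by simp
    show "(\<lambda>N. measure_pmf.prob (A N) ?E) \<longlonglongrightarrow> 1"
    proof (rule tendsto_sandwich[OF _ _ l tendsto_const])
      have "1 - (1 - ?p N) / (1 - s) \<le> measure_pmf.prob (A N) ?E" if "1 \<le> N" for N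
      proof -
        have "?p N = (1 - s) * measure_pmf.prob (A N) ?E + s * measure_pmf.prob (B N) ?E"
          by (rule prob_mixture[OF mix[OF that]])
        moreover have "s * measure_pmf.prob (B N) ?E \<le> s * 1" using s by (intro mult_left_mono) auto
        ultimately have "(1 - s) * (1 - measure_pmf.prob (A N) ?E) \<le> 1 - ?p N" by (simp add: algebra_simps)
        then have "1 - measure_pmf.prob (A N) ?E \<le> (1 - ?p N) / (1 - s)"
          using s by (simp add: pos_le_divide_eq mult.commute)
        then show ?thesis by linarith
      qed
      then show "\<forall>\<^sub>F N in sequentially. 1 - (1 - ?p N) / (1 - s) \<le> measure_pmf.prob (A N) ?E"
        by (rule eventually_sequentiallyI)
    qed simp
  qed
  have "concentrates A (variational X)" by (rule conc[of t A B]) (use * in auto)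
  then have "A N = limit_law X N" using concentrates_unique[OF _ X _ N, of A] * by blast
  moreover have "concentrates B (variational X)" by (rule conc[of "1 - t" B A]) (use * in auto)
  then have "B N = limit_law X N" using concentrates_unique[OF _ X _ N, of B] * by blast
  ultimately show "A N = B N" by simp
qed

end

section \<open>Extreme coherent families\<close>

context qlattice
begin

text \<open>Events that depend on one term of the variational series are asymptotically invariant under
  the links.\<close>

definition term_event :: "nat \<Rightarrow> real set \<Rightarrow> real set set" where
  "term_event i S = {Z. variational Z i \<in> S}"

lemma term_event_compl: "- term_event i S = term_event i (- S)"
  by (auto simp: term_event_def)

lemma term_event_stable:
  obtains C where "0 \<le> C" "\<And>K N Z S. K \<le> N \<Longrightarrow> Z \<in> G N \<Longrightarrow>
    measure_pmf.prob (links K N Z) {Y. (Y \<in> term_event i S) \<noteq> (Z \<in> term_event i S)} \<le> C * \<rho> ^ K"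
proof -
  obtain C where C: "0 \<le> C" "\<And>K N Z. K \<le> N \<Longrightarrow> Z \<in> G N \<Longrightarrow>
    measure_pmf.prob (links K N Z) {Y. \<not> agree (Suc i) Y Z} \<le> C * \<rho> ^ K"
    using links_stable[of "Suc i"] by blast
  show thesis
  proof (rule that[OF C(1)])
    fix K N Z S assume KN: "K \<le> N" "Z \<in> G N"
    have "measure_pmf.prob (links K N Z) {Y. (Y \<in> term_event i S) \<noteq> (Z \<in> term_event i S)}
        \<le> measure_pmf.prob (links K N Z) {Y. \<not> agree (Suc i) Y Z}"
      by (rule prob_mono_pmf) (auto simp: term_event_def agree_def)
    also have "\<dots> \<le> C * \<rho> ^ K" by (rule C(2)[OF KN])
    finally show "measure_pmf.prob (links K N Z) {Y. (Y \<in> term_event i S) \<noteq> (Z \<in> term_event i S)} \<le> C * \<rho> ^ K" .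
  qed
qed

text \<open>Descending from level \<open>N\<close> to level \<open>M\<close>, the event \<open>E\<close> is preserved up to a small error, so its
  indicator may be evaluated on either level.\<close>

lemma term_event_transfer:
  assumes P: "coherent_family P" and f: "\<And>M. \<bar>f M\<bar> \<le> (1 :: real)" and
    C: "\<And>K N Z. K \<le> N \<Longrightarrow> Z \<in> G N \<Longrightarrow>
      measure_pmf.prob (links K N Z) {Y. (Y \<in> E) \<noteq> (Z \<in> E)} \<le> C * \<rho> ^ K"
    and MN: "1 \<le> M" "M \<le> N"
  shows "\<bar>measure_pmf.expectation (P N) (\<lambda>Z. indicator E Z * measure_pmf.expectation (links M N Z) f)
    - measure_pmf.expectation (P M) (\<lambda>Y. indicator E Y * f Y)\<bar> \<le> C * \<rho> ^ M"
proof -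
  have fe: "\<bar>measure_pmf.expectation (links M N Z) f\<bar> \<le> 1" for Z by (rule expectation_abs_le[OF f])
  have fi: "\<bar>indicator E Y * f Y\<bar> \<le> 1" for Y using f[of Y] by (simp add: indicator_def)
  have "measure_pmf.expectation (P M) (\<lambda>Y. indicator E Y * f Y)
      = measure_pmf.expectation (P N) (\<lambda>Z. measure_pmf.expectation (links M N Z) (\<lambda>Y. indicator E Y * f Y))"
    unfolding coh_links[OF P MN, symmetric] by (rule expectation_bind[OF fi])
  moreover have "\<bar>measure_pmf.expectation (P N) (\<lambda>Z. indicator E Z * measure_pmf.expectation (links M N Z) f)
    - measure_pmf.expectation (P N) (\<lambda>Z. measure_pmf.expectation (links M N Z) (\<lambda>Y. indicator E Y * f Y))\<bar>
    \<le> C * \<rho> ^ M"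
  proof (rule expectation_diff_le[where B = 1 and C = 1])
    fix Z assume Z: "Z \<in> set_pmf (P N)"
    let ?p = "links M N Z" and ?D = "{Y. (Y \<in> E) \<noteq> (Z \<in> E)}"
    have N1: "1 \<le> N" using MN by simp
    have "indicator E Z * measure_pmf.expectation ?p f = measure_pmf.expectation ?p (\<lambda>Y. indicator E Z * f Y)"
      by simp
    then have "\<bar>indicator E Z * measure_pmf.expectation ?p f - measure_pmf.expectation ?p (\<lambda>Y. indicator E Y * f Y)\<bar>
        = \<bar>measure_pmf.expectation ?p (\<lambda>Y. indicator E Z * f Y - indicator E Y * f Y)\<bar>"
      using integrable_bounded_pmf[of ?p f 1] integrable_bounded_pmf[of ?p "\<lambda>Y. indicator E Y * f Y" 1] f fi
      by simp
    also have "\<dots> \<le> measure_pmf.expectation ?p (\<lambda>Y. \<bar>indicator E Z * f Y - indicator E Y * f Y\<bar>)"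
      using integral_norm_bound[of "measure_pmf ?p" "\<lambda>Y. indicator E Z * f Y - indicator E Y * f Y"] by simp
    also have "\<dots> \<le> measure_pmf.expectation ?p (indicator ?D)"
    proof (rule expectation_mono[where B = 1 and C = 1])
      fix Y
      show "\<bar>indicator E Z * f Y - indicator E Y * f Y\<bar> \<le> indicator ?D Y"
        using f[of Y] by (auto simp: indicator_def)
      show "\<bar>\<bar>indicator E Z * f Y - indicator E Y * f Y\<bar>\<bar> \<le> 1"
        using f[of Y] by (auto simp: indicator_def)
    qed (simp add: indicator_def)
    also have "\<dots> \<le> C * \<rho> ^ M" using C[OF MN(2) coh_set[OF P N1 Z]] by simp
    finally show "\<bar>indicator E Z * measure_pmf.expectation ?p f
      - measure_pmf.expectation ?p (\<lambda>Y. indicator E Y * f Y)\<bar> \<le> C * \<rho> ^ M" .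
  next
    fix Z
    show "\<bar>indicator E Z * measure_pmf.expectation (links M N Z) f\<bar> \<le> 1"
      using fe[of Z] by (simp add: indicator_def)
    show "\<bar>measure_pmf.expectation (links M N Z) (\<lambda>Y. indicator E Y * f Y)\<bar> \<le> 1"
      by (rule expectation_abs_le[OF fi])
  qed
  ultimately show ?thesis by simp
qed

lemma term_event_prob:
  assumes P: "coherent_family P" and C: "\<And>K N Z. K \<le> N \<Longrightarrow> Z \<in> G N \<Longrightarrow>
      measure_pmf.prob (links K N Z) {Y. (Y \<in> E) \<noteq> (Z \<in> E)} \<le> C * \<rho> ^ K"
    and MN: "1 \<le> M" "M \<le> N"
  shows "\<bar>measure_pmf.prob (P N) E - measure_pmf.prob (P M) E\<bar> \<le> C * \<rho> ^ M"
  using term_event_transfer[OF P _ C MN, of "\<lambda>_. 1"] by simp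

text \<open>Conditioning the high levels of a coherent family on an asymptotically invariant event and
  projecting down gives, in the limit, another coherent family. The projections form Cauchy sequences
  with a geometric rate. They are tight because conditioning increases the projected
  weights only by a factor of the order of \<open>1 / p\<close>. On high levels the new family is almost
  supported by the event.\<close>

lemma conditioned_family:
  assumes P: "coherent_family P" and C: "\<And>K N Z. K \<le> N \<Longrightarrow> Z \<in> G N \<Longrightarrow>
      measure_pmf.prob (links K N Z) {Y. (Y \<in> E) \<noteq> (Z \<in> E)} \<le> C * \<rho> ^ K"
    and p: "(\<lambda>N. measure_pmf.prob (P N) E) \<longlonglongrightarrow> p" "0 < p"
  obtains A where "coherent_family A"
    "\<And>K U. 1 \<le> K \<Longrightarrow> (\<lambda>N. measure_pmf.expectation (P N) (\<lambda>Z. indicator E Z * pmf (links K N Z) U))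
      \<longlonglongrightarrow> p * pmf (A K) U"
    "\<And>K. 1 \<le> K \<Longrightarrow> measure_pmf.prob (A K) (- E) \<le> C * \<rho> ^ K / p"
proof -
  \<comment> \<open>Level \<open>K\<close> of the family conditioned on level \<open>N\<close>; \<open>?a\<close> is its numerator.\<close>
  define Q where "Q K N = bind_pmf (cond_pmf (P N) E) (links K N)" for K N
  let ?a = "\<lambda>K U N. measure_pmf.expectation (P N) (\<lambda>Z. indicator E Z * pmf (links K N Z) U)"
  let ?p = "\<lambda>N. measure_pmf.prob (P N) E"
  have pp: "\<forall>\<^sub>F N in sequentially. p / 2 < ?p N" by (rule order_tendstoD(1)[OF p(1)]) (use p(2) in simp)
  have Qprob: "measure_pmf.prob (Q K N) S
      = measure_pmf.expectation (P N) (\<lambda>Z. indicator E Z * measure_pmf.prob (links K N Z) S) / ?p N"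
    if "0 < ?p N" for K N S
    unfolding Q_def prob_bind by (rule expectation_cond[OF _ that, of _ 1]) simp
  have Qpmf: "pmf (Q K N) U = ?a K U N / ?p N" if "0 < ?p N" for K N U
    using Qprob[OF that, of K "{U}"] by (simp add: measure_pmf_single)
  have aconv: "\<exists>l. ?a K U \<longlonglongrightarrow> l" if K: "1 \<le> K" for K U
  proof -
    have "\<bar>?a K U N - ?a K U M\<bar> \<le> C * \<rho> ^ M" if MN: "K \<le> M" "M \<le> N" for M N
    proof -
      have M1: "1 \<le> M" using K MN by simp
      have "measure_pmf.expectation (links M N Z) (\<lambda>Y. pmf (links K M Y) U) = pmf (links K N Z) U" for Z
        unfolding links_split[OF MN, of Z] by (rule pmf_bind[symmetric])
      then show ?thesis
        using term_event_transfer[OF P _ C M1 MN(2), of "\<lambda>Y. pmf (links K M Y) U"] by (simp add: pmf_le_1)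
    qed
    then have "convergent (?a K U)" by (rule real_Cauchy_geometric[OF \<rho>_bounds, of K "?a K U" C])
    then show ?thesis unfolding convergent_def .
  qed
  have ev0: "\<forall>\<^sub>F N in sequentially. 0 < ?p N"
    using pp
  proof eventually_elim
    case (elim N)
    then show ?case using p(2) by linarith
  qed
  have Qconv: "\<exists>l. (\<lambda>N. pmf (Q K N) U) \<longlonglongrightarrow> l" if K: "1 \<le> K" for K U
  proof -
    obtain l where l: "?a K U \<longlonglongrightarrow> l" using aconv[OF K] by blast
    have "(\<lambda>N. ?a K U N / ?p N) \<longlonglongrightarrow> l / p" by (rule tendsto_divide[OF l p(1)]) (use p(2) in simp)
    moreover have "\<forall>\<^sub>F N in sequentially. ?a K U N / ?p N = pmf (Q K N) U"
      using ev0 by eventually_elim (rule Qpmf[symmetric])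
    ultimately have "(\<lambda>N. pmf (Q K N) U) \<longlonglongrightarrow> l / p" by (rule Lim_transform_eventually)
    then show ?thesis by (rule exI)
  qed
  have Qtight: "\<exists>S. finite S \<and> (\<forall>\<^sub>F N in sequentially. 1 - e \<le> measure_pmf.prob (Q K N) S)"
    if K: "1 \<le> K" and e: "0 < e" for K e
  proof -
    have ep: "0 < e * (p / 2)" using e p(2) by simp
    obtain S where S: "finite S" "1 - e * (p / 2) < measure_pmf.prob (P K) S"
      by (rule finite_prob_approx[OF ep])
    have "\<forall>\<^sub>F N in sequentially. 1 - e \<le> measure_pmf.prob (Q K N) S"
      using pp eventually_ge_at_top[of K]
    proof eventually_elim
      case (elim N)
      have pN: "0 < ?p N" using elim(1) p(2) by simp
      have "measure_pmf.expectation (P N) (\<lambda>Z. indicator E Z * measure_pmf.prob (links K N Z) (- S))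
          \<le> measure_pmf.expectation (P N) (\<lambda>Z. measure_pmf.prob (links K N Z) (- S))"
      proof (rule expectation_mono[where B = 1 and C = 1])
        fix Z
        have "0 \<le> measure_pmf.prob (links K N Z) (- S)" "measure_pmf.prob (links K N Z) (- S) \<le> 1"
          by simp_all
        then show "indicator E Z * measure_pmf.prob (links K N Z) (- S) \<le> measure_pmf.prob (links K N Z) (- S)"
          "\<bar>indicator E Z * measure_pmf.prob (links K N Z) (- S)\<bar> \<le> 1"
          "\<bar>measure_pmf.prob (links K N Z) (- S)\<bar> \<le> 1"
          by (cases "Z \<in> E", simp_all)+
      qed
      also have "\<dots> = measure_pmf.prob (P K) (- S)"
        unfolding coh_links[OF P K elim(2), symmetric] by (rule prob_bind[symmetric])
      also have "\<dots> \<le> e * (p / 2)" using S(2) unfolding prob_compl by simp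
      also have "\<dots> \<le> e * ?p N" using elim(1) e by (intro mult_left_mono) auto
      finally have "measure_pmf.prob (Q K N) (- S) \<le> e"
        unfolding Qprob[OF pN] pos_divide_le_eq[OF pN] .
      then show ?case unfolding prob_compl by simp
    qed
    with S(1) have "finite S \<and> (\<forall>\<^sub>F N in sequentially. 1 - e \<le> measure_pmf.prob (Q K N) S)" by (rule conjI)
    then show ?thesis by (rule exI)
  qed
  have "\<exists>R. \<forall>U. (\<lambda>N. pmf (Q K N) U) \<longlonglongrightarrow> pmf R U" if "1 \<le> K" for K
    by (rule pmf_limit_exists[OF sequentially_bot Qconv[OF that] Qtight[OF that]])
  then have "\<forall>K. \<exists>R. 1 \<le> K \<longrightarrow> (\<forall>U. (\<lambda>N. pmf (Q K N) U) \<longlonglongrightarrow> pmf R U)" by blast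
  from choice[OF this] obtain A where
    "\<forall>K. 1 \<le> K \<longrightarrow> (\<forall>U. (\<lambda>N. pmf (Q K N) U) \<longlonglongrightarrow> pmf (A K) U)" ..
  then have A: "(\<lambda>N. pmf (Q K N) U) \<longlonglongrightarrow> pmf (A K) U" if "1 \<le> K" for K U using that by simp
  show thesis
  proof (rule that[of A])
    show "coherent_family A"
      unfolding coherent_family_def
    proof (intro allI impI conjI)
      fix K :: nat assume K: "1 \<le> K"
      then have K': "1 \<le> Suc K" by simp
      have setQ: "\<forall>\<^sub>F N in sequentially. set_pmf (Q K N) \<subseteq> G K"
        using ev0 eventually_ge_at_top[of K]
      proof eventually_elim
        case (elim N)
        have "set_pmf (P N) \<inter> E \<noteq> {}" using elim(1) measure_pmf_zero_iff[of "P N" E] by auto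
        then have "set_pmf (cond_pmf (P N) E) \<subseteq> set_pmf (P N)" by (simp add: set_cond_pmf)
        moreover have N1: "1 \<le> N" using K elim(2) by simp
        have "set_pmf (P N) \<subseteq> G N" using P N1 unfolding coherent_family_def by simp
        ultimately have sG: "set_pmf (cond_pmf (P N) E) \<subseteq> G N" by (rule subset_trans)
        show ?case
        proof
          fix Y assume "Y \<in> set_pmf (Q K N)"
          then obtain Z where Z: "Z \<in> set_pmf (cond_pmf (P N) E)" "Y \<in> set_pmf (links K N Z)"
            unfolding Q_def set_bind_pmf by (rule UN_E)
          show "Y \<in> G K" by (rule set_links[OF elim(2) subsetD[OF sG Z(1)] Z(2)])
        qed
      qed
      show "set_pmf (A K) \<subseteq> G K" by (rule set_limit[OF sequentially_bot setQ A[OF K]])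
      show "bind_pmf (A (Suc K)) (link K) = A K"
      proof (rule coh_limit[OF sequentially_bot _ A[OF K] A[OF K']])
        show "\<forall>\<^sub>F N in sequentially. bind_pmf (Q (Suc K) N) (link K) = Q K N"
          using eventually_ge_at_top[of "Suc K"]
        proof eventually_elim
          case (elim N)
          have "links K N = (\<lambda>Z. bind_pmf (links (Suc K) N Z) (link K))"
          proof (rule ext)
            fix Z
            show "links K N Z = bind_pmf (links (Suc K) N Z) (link K)"
              using links_split[OF _ elim, of K Z] unfolding links_one by simp
          qed
          then show ?case unfolding Q_def by (simp only: bind_assoc_pmf)
        qed
      qed
    qed
    fix K :: nat assume K: "1 \<le> K"
    fix U
    have "(\<lambda>N. ?p N * pmf (Q K N) U) \<longlonglongrightarrow> p * pmf (A K) U" by (rule tendsto_mult[OF p(1) A[OF K]])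
    moreover have "\<forall>\<^sub>F N in sequentially. ?p N * pmf (Q K N) U = ?a K U N"
      using ev0
    proof eventually_elim
      case (elim N)
      show ?case unfolding Qpmf[OF elim] using elim by simp
    qed
    ultimately show "?a K U \<longlonglongrightarrow> p * pmf (A K) U" by (rule Lim_transform_eventually)
  next
    fix K :: nat assume K: "1 \<le> K"
    have l: "(\<lambda>N. C * \<rho> ^ K / ?p N) \<longlonglongrightarrow> C * \<rho> ^ K / p"
      by (rule tendsto_divide[OF tendsto_const p(1)]) (use p(2) in simp)
    show "measure_pmf.prob (A K) (- E) \<le> C * \<rho> ^ K / p"
    proof (rule tendsto_le[OF sequentially_bot l pmf_tendsto_prob[OF A[OF K]]])
      show "\<forall>\<^sub>F N in sequentially. measure_pmf.prob (Q K N) (- E) \<le> C * \<rho> ^ K / ?p N"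
        using ev0 eventually_ge_at_top[of K]
      proof eventually_elim
        case (elim N)
        have N1: "1 \<le> N" using K elim(2) by simp
        have C0: "0 \<le> C * \<rho> ^ K"
        proof -
          obtain Z where "Z \<in> set_pmf (P N)" using set_pmf_not_empty[of "P N"] by blast
          from C[OF elim(2) coh_set[OF P N1 this]] show ?thesis
            using measure_nonneg[of "measure_pmf (links K N Z)" "{Y. (Y \<in> E) \<noteq> (Z \<in> E)}"] by linarith
        qed
        have "\<bar>measure_pmf.expectation (P N) (\<lambda>Z. indicator E Z * measure_pmf.prob (links K N Z) (- E))\<bar> \<le> C * \<rho> ^ K"
        proof (rule expectation_abs_le)
          fix Z assume Z: "Z \<in> set_pmf (P N)"
          show "\<bar>indicator E Z * measure_pmf.prob (links K N Z) (- E)\<bar> \<le> C * \<rho> ^ K"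
          proof (cases "Z \<in> E")
            case True
            then have "{Y. (Y \<in> E) \<noteq> (Z \<in> E)} = - E" by auto
            then have "measure_pmf.prob (links K N Z) (- E) \<le> C * \<rho> ^ K"
              using C[OF elim(2) coh_set[OF P N1 Z]] by (simp only:)
            then show ?thesis using True by simp
          next
            case False
            then show ?thesis using C0 by simp
          qed
        qed
        from abs_le_D1[OF this] show ?case
          unfolding Qprob[OF elim(1)] by (rule divide_right_mono) (rule less_imp_le[OF elim(1)])
      qed
    qed
  qed
qed

text \<open>Otherwise the family is a mixture of its conditionings on the event and on the complement. By
  extremality these two coincide, but on high levels they live on nearly disjoint sets.\<close>

lemma zero_one_law:
  assumes xt: "extreme_family P"
  shows "(\<lambda>N. measure_pmf.prob (P N) (term_event i S)) \<longlonglongrightarrow> 0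
    \<or> (\<lambda>N. measure_pmf.prob (P N) (term_event i S)) \<longlonglongrightarrow> 1"
proof -
  let ?E = "term_event i S" and ?F = "term_event i (- S)"
  have P: "coherent_family P" using xt by (simp add: extreme_family_def)
  obtain C where C: "0 \<le> C" "\<And>K N Z S. K \<le> N \<Longrightarrow> Z \<in> G N \<Longrightarrow>
    measure_pmf.prob (links K N Z) {Y. (Y \<in> term_event i S) \<noteq> (Z \<in> term_event i S)} \<le> C * \<rho> ^ K"
    using term_event_stable[of i] by blast
  have "convergent (\<lambda>N. measure_pmf.prob (P N) ?E)"
    by (rule real_Cauchy_geometric[OF \<rho>_bounds term_event_prob[OF P C(2)]])
  then obtain p where p: "(\<lambda>N. measure_pmf.prob (P N) ?E) \<longlonglongrightarrow> p" by (auto simp: convergent_def)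
  have p01: "0 \<le> p" "p \<le> 1"
    by (rule tendsto_lowerbound[OF p _ sequentially_bot], simp)
      (rule tendsto_upperbound[OF p _ sequentially_bot], simp)
  have pF: "(\<lambda>N. measure_pmf.prob (P N) ?F) \<longlonglongrightarrow> 1 - p"
    unfolding term_event_compl[symmetric] prob_compl by (intro tendsto_intros p)
  show ?thesis
  proof (rule ccontr)
    assume "\<not> ?thesis"
    then have "p \<noteq> 0" "p \<noteq> 1" using p by auto
    then have pp: "0 < p" "0 < 1 - p" using p01 by auto
    obtain A where A: "coherent_family A" "\<And>K U. 1 \<le> K \<Longrightarrow>
        (\<lambda>N. measure_pmf.expectation (P N) (\<lambda>Z. indicator ?E Z * pmf (links K N Z) U)) \<longlonglongrightarrow> p * pmf (A K) U"
      "\<And>K. 1 \<le> K \<Longrightarrow> measure_pmf.prob (A K) (- ?E) \<le> C * \<rho> ^ K / p"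
      using conditioned_family[OF P C(2) p pp(1)] by blast
    obtain B where B: "coherent_family B" "\<And>K U. 1 \<le> K \<Longrightarrow>
        (\<lambda>N. measure_pmf.expectation (P N) (\<lambda>Z. indicator ?F Z * pmf (links K N Z) U)) \<longlonglongrightarrow> (1 - p) * pmf (B K) U"
      "\<And>K. 1 \<le> K \<Longrightarrow> measure_pmf.prob (B K) (- ?F) \<le> C * \<rho> ^ K / (1 - p)"
      using conditioned_family[OF P C(2) pF pp(2)] by blast
    have mix: "pmf (P K) U = (1 - (1 - p)) * pmf (A K) U + (1 - p) * pmf (B K) U" if K: "1 \<le> K" for K U
    proof -
      have "(\<lambda>N. measure_pmf.expectation (P N) (\<lambda>Z. indicator ?E Z * pmf (links K N Z) U)
          + measure_pmf.expectation (P N) (\<lambda>Z. indicator ?F Z * pmf (links K N Z) U))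
          \<longlonglongrightarrow> p * pmf (A K) U + (1 - p) * pmf (B K) U"
        by (intro tendsto_add A(2) B(2) K)
      moreover have "\<forall>\<^sub>F N in sequentially.
          measure_pmf.expectation (P N) (\<lambda>Z. indicator ?E Z * pmf (links K N Z) U)
          + measure_pmf.expectation (P N) (\<lambda>Z. indicator ?F Z * pmf (links K N Z) U) = pmf (P K) U"
        using eventually_ge_at_top[of K]
      proof eventually_elim
        case (elim N)
        have b: "\<bar>indicator D Z * pmf (links K N Z) U\<bar> \<le> 1" for D Z
          by (simp add: indicator_def pmf_le_1)
        have "measure_pmf.expectation (P N) (\<lambda>Z. indicator ?E Z * pmf (links K N Z) U)
          + measure_pmf.expectation (P N) (\<lambda>Z. indicator ?F Z * pmf (links K N Z) U)
          = measure_pmf.expectation (P N) (\<lambda>Z. indicator ?E Z * pmf (links K N Z) U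
             + indicator ?F Z * pmf (links K N Z) U)"
          by (rule Bochner_Integration.integral_add[symmetric]) (rule integrable_bounded_pmf[OF b])+
        also have "(\<lambda>Z. indicator ?E Z * pmf (links K N Z) U + indicator ?F Z * pmf (links K N Z) U)
            = (\<lambda>Z. pmf (links K N Z) U)"
          by (rule ext) (simp add: term_event_def indicator_def)
        also have "measure_pmf.expectation (P N) (\<lambda>Z. pmf (links K N Z) U) = pmf (P K) U"
          unfolding coh_links[OF P K elim, symmetric] by (rule pmf_bind[symmetric])
        finally show ?case .
      qed
      ultimately have "(\<lambda>N. pmf (P K) U) \<longlonglongrightarrow> p * pmf (A K) U + (1 - p) * pmf (B K) U"
        by (rule Lim_transform_eventually)
      then show ?thesis using LIMSEQ_unique[OF tendsto_const] by fastforce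
    qed
    have AB: "A K = B K" if K: "1 \<le> K" for K
    proof -
      have "coherent_family A \<and> coherent_family B \<and> 0 < 1 - p \<and> 1 - p < 1 \<and>
          (\<forall>N\<ge>1. \<forall>Y. pmf (P N) Y = (1 - (1 - p)) * pmf (A N) Y + (1 - p) * pmf (B N) Y)"
        using A(1) B(1) pp mix by simp
      then have "\<forall>N\<ge>1. A N = B N" using conjunct2[OF xt[unfolded extreme_family_def]] by blast
      then show ?thesis using K by blast
    qed
    have "(\<lambda>K. C * \<rho> ^ K / p + C * \<rho> ^ K / (1 - p)) \<longlonglongrightarrow> C * 0 / p + C * 0 / (1 - p)"
      using \<rho>_bounds pp by (intro tendsto_intros LIMSEQ_realpow_zero) auto
    then have "\<forall>\<^sub>F K in sequentially. C * \<rho> ^ K / p + C * \<rho> ^ K / (1 - p) < 1"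
      using order_tendstoD(2)[of "\<lambda>K. C * \<rho> ^ K / p + C * \<rho> ^ K / (1 - p)" 0 sequentially 1] by simp
    then obtain K0 where K0: "\<forall>K\<ge>K0. C * \<rho> ^ K / p + C * \<rho> ^ K / (1 - p) < 1"
      unfolding eventually_sequentially ..
    let ?K = "Suc K0"
    have K1: "1 \<le> ?K" by simp
    have "1 = measure_pmf.prob (A ?K) (- ?E) + measure_pmf.prob (B ?K) (- ?F)"
      unfolding AB[OF K1] term_event_compl[symmetric] prob_compl by simp
    also have "\<dots> \<le> C * \<rho> ^ ?K / p + C * \<rho> ^ ?K / (1 - p)" by (intro add_mono A(3) B(3) K1)
    also have "\<dots> < 1" using K0[rule_format, of ?K] by (simp only: le_SucI order_refl)
    finally show False by simp
  qed
qed

text \<open>By the zero-one law every single value has asymptotic probability 0 or 1. They cannot all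
  have probability 0: a finite set of values carries half of the mass on some level, and a
  definite part of it on all higher levels.\<close>

lemma extreme_value:
  assumes xt: "extreme_family P"
  shows "\<exists>v. (\<lambda>N. measure_pmf.prob (P N) {Z. variational Z i = v}) \<longlonglongrightarrow> 1"
proof (rule ccontr)
  assume none: "\<not> ?thesis"
  have P: "coherent_family P" using xt by (simp add: extreme_family_def)
  obtain C where C: "0 \<le> C" "\<And>K N Z S. K \<le> N \<Longrightarrow> Z \<in> G N \<Longrightarrow>
    measure_pmf.prob (links K N Z) {Y. (Y \<in> term_event i S) \<noteq> (Z \<in> term_event i S)} \<le> C * \<rho> ^ K"
    using term_event_stable[of i] by blast
  have ts: "term_event i {v} = {Z. variational Z i = v}" for v by (auto simp: term_event_def)
  have z: "(\<lambda>N. measure_pmf.prob (P N) (term_event i {v})) \<longlonglongrightarrow> 0" for v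
    using zero_one_law[OF xt, of i "{v}"] none ts[of v] by auto
  have "(\<lambda>M. C * \<rho> ^ M) \<longlonglongrightarrow> C * 0" using \<rho>_bounds by (intro tendsto_intros LIMSEQ_realpow_zero) auto
  then have "\<forall>\<^sub>F M in sequentially. C * \<rho> ^ M < 1 / 4"
    using order_tendstoD(2)[of "\<lambda>M. C * \<rho> ^ M" 0 sequentially "1 / 4"] by simp
  then obtain M0 where M0: "\<forall>M\<ge>M0. C * \<rho> ^ M < 1 / 4" unfolding eventually_sequentially ..
  let ?M = "Suc M0"
  have M1: "1 \<le> ?M" by simp
  obtain S where S: "finite S" "1 - 1 / 2 < measure_pmf.prob (P ?M) S"
  proof (rule finite_prob_approx[of "1 / 2" "P ?M"])
    show "0 < (1 / 2 :: real)" by simp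
  qed
  define V where "V = (\<lambda>Z. variational Z i) ` S"
  have V: "finite V" using S(1) by (simp add: V_def)
  have low: "1 / 4 \<le> measure_pmf.prob (P N) (term_event i V)" if "?M \<le> N" for N
  proof -
    have "measure_pmf.prob (P ?M) S \<le> measure_pmf.prob (P ?M) (term_event i V)"
      by (rule prob_mono_pmf) (auto simp: V_def term_event_def)
    moreover have "\<bar>measure_pmf.prob (P N) (term_event i V) - measure_pmf.prob (P ?M) (term_event i V)\<bar> \<le> C * \<rho> ^ ?M"
      by (rule term_event_prob[OF P C(2) M1 that])
    moreover have "C * \<rho> ^ ?M < 1 / 4" by (rule M0[rule_format]) simp
    ultimately show ?thesis using S(2) by linarith
  qed
  have up: "measure_pmf.prob (P N) (term_event i V) \<le> (\<Sum>v\<in>V. measure_pmf.prob (P N) (term_event i {v}))" for N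
  proof -
    have "term_event i V = (\<Union>v\<in>V. term_event i {v})" by (auto simp: term_event_def)
    then show ?thesis by (simp only:) (rule measure_UNION_le[OF V], simp)
  qed
  have "(\<lambda>N. \<Sum>v\<in>V. measure_pmf.prob (P N) (term_event i {v})) \<longlonglongrightarrow> (\<Sum>v\<in>V. 0)"
    by (intro tendsto_sum z)
  moreover have "\<forall>\<^sub>F N in sequentially. 1 / 4 \<le> (\<Sum>v\<in>V. measure_pmf.prob (P N) (term_event i {v}))"
    using eventually_ge_at_top[of ?M] by eventually_elim (rule order_trans[OF low up])
  ultimately have "1 / 4 \<le> (\<Sum>v\<in>V. 0 :: real)" by (rule tendsto_lowerbound[OF _ _ sequentially_bot])
  then show False by simp
qed

text \<open>The terms on which an extreme family concentrates occur together in finite configurations, hence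
  they form the variational series of an infinite one.\<close>

lemma extreme_limit_law:
  assumes xt: "extreme_family P"
  obtains X where "X \<in> Ginf" "\<And>K. 1 \<le> K \<Longrightarrow> P K = limit_law X K"
proof -
  have P: "coherent_family P" using xt by (simp add: extreme_family_def)
  from choice[of "\<lambda>i v. (\<lambda>N. measure_pmf.prob (P N) {Z. variational Z i = v}) \<longlonglongrightarrow> 1"] extreme_value[OF xt]
  obtain v where v: "\<And>i. (\<lambda>N. measure_pmf.prob (P N) {Z. variational Z i = v i}) \<longlonglongrightarrow> 1" by blast
  have "\<exists>N\<ge>k. \<exists>Z\<in>G N. \<forall>i<k. variational Z i = v i" for k
  proof -
    have "(\<lambda>N. \<Sum>i<k. 1 - measure_pmf.prob (P N) {Z. variational Z i = v i}) \<longlonglongrightarrow> (\<Sum>i<k. 1 - 1)"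
      by (intro tendsto_intros v)
    then have "\<forall>\<^sub>F N in sequentially. (\<Sum>i<k. 1 - measure_pmf.prob (P N) {Z. variational Z i = v i}) < 1"
      using order_tendstoD(2)[of "\<lambda>N. \<Sum>i<k. 1 - measure_pmf.prob (P N) {Z. variational Z i = v i}" 0 sequentially 1]
      by simp
    then obtain N0 where N0: "\<forall>N\<ge>N0. (\<Sum>i<k. 1 - measure_pmf.prob (P N) {Z. variational Z i = v i}) < 1"
      unfolding eventually_sequentially ..
    define N where "N = Suc (N0 + k)"
    have N: "N0 \<le> N" "k \<le> N" "1 \<le> N" by (simp_all add: N_def)
    have "\<exists>Z\<in>set_pmf (P N). \<forall>i<k. variational Z i = v i"
    proof (rule ccontr)
      assume no: "\<not> ?thesis"
      have "1 = measure_pmf.prob (P N) UNIV" by simp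
      also have "\<dots> \<le> measure_pmf.prob (P N) (\<Union>i\<in>{..<k}. - {Z. variational Z i = v i})"
        by (rule prob_mono_pmf) (use no in blast)
      also have "\<dots> \<le> (\<Sum>i<k. measure_pmf.prob (P N) (- {Z. variational Z i = v i}))"
        by (rule measure_UNION_le) auto
      also have "\<dots> < 1" unfolding prob_compl using N0 N(1) by blast
      finally show False by simp
    qed
    then show ?thesis using coh_set[OF P N(3)] N(2) by blast
  qed
  from limit_configuration[OF this] obtain X where X: "X \<in> Ginf" "\<And>i. variational X i = v i" by blast
  have "concentrates P (variational X)" unfolding concentrates_def X(2) using v by blast
  then show thesis using that[OF X(1)] concentrates_unique[OF P X(1)] by blast
qed

section \<open>Regular sequences stabilize\<close>

text \<open>On a sufficiently high fixed level \<open>K\<close>, the row of the link from \<open>N\<close> charges the value of the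
  term at \<open>Xs N\<close> with probability more than \<open>3/4\<close>. As the rows converge to \<open>Q K\<close>, the limit charges
  it with more than \<open>1/2\<close>, which is possible for one value only.\<close>

lemma regular_value:
  assumes Xs: "Xs \<in> conf_seqs q zm zp"
    and lim: "\<And>K U. 1 \<le> K \<Longrightarrow> (\<lambda>N. pmf (links K N (Xs N)) U) \<longlonglongrightarrow> pmf (Q K) U"
  shows "\<exists>v. \<forall>\<^sub>F N in sequentially. variational (Xs N) i = v"
proof -
  obtain C where C: "0 \<le> C" "\<And>K N Z S. K \<le> N \<Longrightarrow> Z \<in> G N \<Longrightarrow>
    measure_pmf.prob (links K N Z) {Y. (Y \<in> term_event i S) \<noteq> (Z \<in> term_event i S)} \<le> C * \<rho> ^ K"
    using term_event_stable[of i] by blast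
  have "(\<lambda>M. C * \<rho> ^ M) \<longlonglongrightarrow> C * 0" using \<rho>_bounds by (intro tendsto_intros LIMSEQ_realpow_zero) auto
  then have "\<forall>\<^sub>F M in sequentially. C * \<rho> ^ M < 1 / 4"
    using order_tendstoD(2)[of "\<lambda>M. C * \<rho> ^ M" 0 sequentially "1 / 4"] by simp
  then obtain M0 where M0: "\<forall>M\<ge>M0. C * \<rho> ^ M < 1 / 4" unfolding eventually_sequentially ..
  define K where "K = Suc M0"
  have K: "1 \<le> K" "C * \<rho> ^ K < 1 / 4"
    by (simp add: K_def) (rule M0[rule_format], simp add: K_def)
  let ?p = "\<lambda>N. measure_pmf.prob (links K N (Xs N))" and ?x = "\<lambda>N. variational (Xs N) i"
  have keep: "3 / 4 < ?p N (term_event i S)" if "K \<le> N" "?x N \<in> S" for N S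
  proof -
    have "1 \<le> N" using that(1) K(1) by simp
    then have "Xs N \<in> G N" using Xs unfolding conf_seqs_def by (intro Pi_mem[of Xs "{1..}"]) simp_all
    from C(2)[OF that(1) this, of S] have "?p N {Y. (Y \<in> term_event i S) \<noteq> (Xs N \<in> term_event i S)} < 1 / 4"
      using K(2) by linarith
    moreover have "{Y. (Y \<in> term_event i S) \<noteq> (Xs N \<in> term_event i S)} = - term_event i S"
      using that(2) by (auto simp: term_event_def)
    ultimately have "?p N (- term_event i S) < 1 / 4" by (simp only:)
    then show ?thesis unfolding prob_compl by simp
  qed
  have plim: "(\<lambda>N. ?p N A) \<longlonglongrightarrow> measure_pmf.prob (Q K) A" for A
    by (rule pmf_tendsto_prob[OF lim[OF K(1)]])
  obtain S where S: "finite S" "1 - 1 / 4 < measure_pmf.prob (Q K) S"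
  proof (rule finite_prob_approx[of "1 / 4" "Q K"])
    show "0 < (1 / 4 :: real)" by simp
  qed
  \<comment> \<open>A finite set that contains all values of the term for large \<open>N\<close>, so that the convergence of
    their probabilities is uniform.\<close>
  define V where "V = (\<lambda>Z. variational Z i) ` S"
  have V: "finite V" using S(1) by (simp add: V_def)
  have "measure_pmf.prob (Q K) S \<le> measure_pmf.prob (Q K) (term_event i V)"
    by (rule prob_mono_pmf) (auto simp: V_def term_event_def)
  then have "1 / 4 < measure_pmf.prob (Q K) (term_event i V)" using S(2) by linarith
  then have ev1: "\<forall>\<^sub>F N in sequentially. 1 / 4 < ?p N (term_event i V)"
    by (rule order_tendstoD(1)[OF plim])
  have ev2: "\<forall>\<^sub>F N in sequentially. \<forall>v\<in>V. \<bar>?p N (term_event i {v}) - measure_pmf.prob (Q K) (term_event i {v})\<bar> < 1 / 4"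
  proof (rule eventually_ball_finite[OF V], rule ballI)
    fix v
    show "\<forall>\<^sub>F N in sequentially. \<bar>?p N (term_event i {v}) - measure_pmf.prob (Q K) (term_event i {v})\<bar> < 1 / 4"
      using tendstoD[OF plim, of "1 / 4" "term_event i {v}"] by (simp add: dist_real_def)
  qed
  have ev: "\<forall>\<^sub>F N in sequentially. 1 / 2 < measure_pmf.prob (Q K) (term_event i {?x N})"
    using ev1 ev2 eventually_ge_at_top[of K]
  proof eventually_elim
    case (elim N)
    have "?x N \<in> V"
    proof (rule ccontr)
      assume "?x N \<notin> V"
      then have "3 / 4 < ?p N (- term_event i V)" unfolding term_event_compl by (intro keep elim(3)) simp
      then show False using elim(1) unfolding prob_compl by linarith
    qed
    then have "\<bar>?p N (term_event i {?x N}) - measure_pmf.prob (Q K) (term_event i {?x N})\<bar> < 1 / 4"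
      using elim(2) by blast
    moreover have "3 / 4 < ?p N (term_event i {?x N})" by (rule keep[OF elim(3)]) simp
    ultimately show ?case by linarith
  qed
  then obtain N0 where N0: "\<forall>N\<ge>N0. 1 / 2 < measure_pmf.prob (Q K) (term_event i {?x N})"
    unfolding eventually_sequentially ..
  have "?x N = ?x N0" if "N0 \<le> N" for N
  proof (rule ccontr)
    assume ne: "?x N \<noteq> ?x N0"
    have "measure_pmf.prob (Q K) (term_event i {?x N}) \<le> measure_pmf.prob (Q K) (- term_event i {?x N0})"
      by (rule prob_mono_pmf) (use ne in \<open>auto simp: term_event_def\<close>)
    moreover have "1 / 2 < measure_pmf.prob (Q K) (term_event i {?x N})"
      "1 / 2 < measure_pmf.prob (Q K) (term_event i {?x N0})" using N0 that by auto
    ultimately show False unfolding prob_compl by linarith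
  qed
  then show ?thesis unfolding eventually_sequentially by blast
qed

lemma regular_stabilizes:
  assumes Xs: "Xs \<in> conf_seqs q zm zp"
    and lim: "\<And>K U. 1 \<le> K \<Longrightarrow> (\<lambda>N. pmf (links K N (Xs N)) U) \<longlonglongrightarrow> pmf (Q K) U"
  obtains X where "X \<in> Ginf" "stabilizes Xs X"
proof -
  from choice[of "\<lambda>i v. \<forall>\<^sub>F N in sequentially. variational (Xs N) i = v"] regular_value[OF Xs lim]
  obtain v where v: "\<And>i. \<forall>\<^sub>F N in sequentially. variational (Xs N) i = v i" by blast
  have "\<exists>N\<ge>k. \<exists>Z\<in>G N. \<forall>i<k. variational Z i = v i" for k
  proof -
    have "\<forall>\<^sub>F N in sequentially. \<forall>i\<in>{..<k}. variational (Xs N) i = v i"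
      by (rule eventually_ball_finite) (use v in auto)
    then obtain N0 where N0: "\<forall>N\<ge>N0. \<forall>i\<in>{..<k}. variational (Xs N) i = v i"
      unfolding eventually_sequentially ..
    let ?N = "Suc (N0 + k)"
    have "Xs ?N \<in> G ?N" using Xs unfolding conf_seqs_def by (rule Pi_mem) simp
    moreover have "N0 \<le> ?N" by simp
    then have "\<forall>i\<in>{..<k}. variational (Xs ?N) i = v i" using N0 by blast
    then have "\<forall>i<k. variational (Xs ?N) i = v i" by blast
    moreover have "k \<le> ?N" by simp
    ultimately show ?thesis by blast
  qed
  from limit_configuration[OF this] obtain X where X: "X \<in> Ginf" "\<And>i. variational X i = v i" by blast
  show thesis by (rule that[OF X(1)]) (use v X(2) in \<open>simp add: stabilizes_def\<close>)
qed

lemma stabilizes_tendsto: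
  assumes "X \<in> Ginf" "Xs \<in> conf_seqs q zm zp" "stabilizes Xs X"
  shows "(\<lambda>N. pmf (links K N (Xs N)) U) \<longlonglongrightarrow> pmf (limit_law X K) U"
  using filterlim_compose[OF limit_law_tendsto'[OF assms(1)] stabilizes_filterlim[OF assms(2,3)]] by simp

end

section \<open>Measures and probability mass functions\<close>

context qlattice
begin

definition to_meas :: "nat \<Rightarrow> real set pmf \<Rightarrow> real set measure" where
  "to_meas N p = point_measure (G N) (\<lambda>Y. ennreal (pmf p Y))"

lemma sets_to_meas: "sets (to_meas N p) = Pow (G N)"
  by (simp add: to_meas_def sets_point_measure)

lemma space_to_meas: "space (to_meas N p) = G N"
  by (simp add: to_meas_def space_point_measure)

lemma emeasure_to_meas:
  assumes A: "A \<subseteq> G N"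
  shows "emeasure (to_meas N p) A = emeasure (measure_pmf p) A"
proof -
  have "emeasure (to_meas N p) A = (\<integral>\<^sup>+Y. ennreal (pmf p Y) * indicator A Y \<partial>count_space (G N))"
    unfolding to_meas_def point_measure_def by (rule emeasure_density) (use A in auto)
  also have "\<dots> = (\<integral>\<^sup>+Y. ennreal (pmf p Y) \<partial>restrict_space (count_space (G N)) A)"
    by (rule nn_integral_restrict_space[symmetric]) (use A in auto)
  also have "restrict_space (count_space (G N)) A = count_space A"
    using A by (simp add: restrict_count_space Int_absorb2)
  finally show ?thesis by (simp only: nn_integral_pmf)
qed

lemma to_meas_restrict: "to_meas N p = restrict_space (measure_pmf p) (G N)"
proof (rule measure_eqI)
  show "sets (to_meas N p) = sets (restrict_space (measure_pmf p) (G N))"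
    unfolding sets_to_meas sets_restrict_space by auto
  fix A assume "A \<in> sets (to_meas N p)"
  then have A: "A \<subseteq> G N" by (simp add: sets_to_meas)
  show "emeasure (to_meas N p) A = emeasure (restrict_space (measure_pmf p) (G N)) A"
    unfolding emeasure_to_meas[OF A] by (rule emeasure_restrict_space[symmetric]) (use A in auto)
qed

lemma measure_to_meas: "A \<subseteq> G N \<Longrightarrow> measure (to_meas N p) A = measure_pmf.prob p A"
  by (simp add: measure_def emeasure_to_meas)

lemma measure_to_meas_single: "Y \<in> G N \<Longrightarrow> measure (to_meas N p) {Y} = pmf p Y"
  by (simp add: measure_to_meas measure_pmf_single)

lemma integral_to_meas:
  fixes f :: "real set \<Rightarrow> real"
  assumes "set_pmf p \<subseteq> G N"
  shows "(\<integral>Y. f Y \<partial>to_meas N p) = measure_pmf.expectation p f"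
proof -
  have "(\<integral>Y. f Y \<partial>to_meas N p) = measure_pmf.expectation p (\<lambda>Y. indicator (G N) Y *\<^sub>R f Y)"
    unfolding to_meas_restrict by (rule integral_restrict_space) simp
  also have "\<dots> = measure_pmf.expectation p f"
    by (rule expectation_cong) (use assms in \<open>simp add: subset_iff\<close>)
  finally show ?thesis .
qed

lemma to_meas_prob:
  assumes "set_pmf p \<subseteq> G N"
  shows "to_meas N p \<in> space (prob_algebra (count_space (G N)))"
proof -
  have "emeasure (to_meas N p) (G N) = emeasure (measure_pmf p) (G N)" by (rule emeasure_to_meas) simp
  also have "\<dots> = 1"
    using measure_pmf.emeasure_eq_1_AE[of "G N" p] assms by (auto simp: AE_measure_pmf_iff)
  finally have "prob_space (to_meas N p)" by (intro prob_spaceI) (simp add: space_to_meas)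
  then show ?thesis by (simp add: space_prob_algebra sets_to_meas)
qed

text \<open>On a countable discrete space every probability measure is given by its point masses.\<close>

lemma prob_to_meas:
  assumes m: "m \<in> space (prob_algebra (count_space (G N)))"
  shows "\<exists>p. set_pmf p \<subseteq> G N \<and> m = to_meas N p"
proof -
  have sm: "sets m = Pow (G N)" and pm: "prob_space m" using m by (auto simp: space_prob_algebra)
  have sp: "space m = G N" using sets_eq_imp_space_eq[of m "count_space (G N)"] sm by simp
  interpret m: prob_space m by (rule pm)
  define f where "f Y = (if Y \<in> G N then measure m {Y} else 0)" for Y
  have nn: "0 \<le> f Y" for Y by (simp add: f_def)
  have "(\<integral>\<^sup>+Y. ennreal (f Y) \<partial>count_space UNIV) = (\<integral>\<^sup>+Y. ennreal (f Y) * indicator (G N) Y \<partial>count_space UNIV)"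
    by (rule nn_integral_cong) (simp add: f_def indicator_def)
  also have "\<dots> = (\<integral>\<^sup>+Y. ennreal (f Y) \<partial>count_space (G N))"
    by (simp add: nn_integral_count_space_indicator)
  also have "\<dots> = (\<integral>\<^sup>+Y. emeasure m {Y} \<partial>count_space (G N))"
    by (rule nn_integral_cong) (simp add: f_def m.emeasure_eq_measure)
  also have "\<dots> = emeasure m (\<Union>Y\<in>G N. {Y})"
    by (rule emeasure_UN_countable[symmetric]) (auto simp: sm countable_G disjoint_family_on_def)
  also have "(\<Union>Y\<in>G N. {Y}) = space m" by (auto simp: sp)
  also have "emeasure m (space m) = 1" by (rule m.emeasure_space_1)
  finally have one: "(\<integral>\<^sup>+Y. ennreal (f Y) \<partial>count_space UNIV) = 1" .
  have pf: "pmf (embed_pmf f) Y = f Y" for Y by (rule pmf_embed_pmf[OF nn one])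
  have "m = to_meas N (embed_pmf f)"
  proof (rule measure_eqI_countable[of _ "G N"])
    show "sets m = Pow (G N)" by (rule sm)
    show "sets (to_meas N (embed_pmf f)) = Pow (G N)" by (rule sets_to_meas)
    show "countable (G N)" by (rule countable_G)
    fix Y assume Y: "Y \<in> G N"
    have "emeasure (to_meas N (embed_pmf f)) {Y} = ennreal (pmf (embed_pmf f) Y)"
      using Y by (simp add: emeasure_to_meas emeasure_pmf_single)
    then show "emeasure m {Y} = emeasure (to_meas N (embed_pmf f)) {Y}"
      unfolding pf using Y by (simp add: f_def m.emeasure_eq_measure)
  qed
  moreover have "set_pmf (embed_pmf f) \<subseteq> G N"
    unfolding set_pmf_eq pf by (auto simp: f_def split: if_splits)
  ultimately show ?thesis by blast
qed

lemma to_meas_inj: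
  assumes "set_pmf p \<subseteq> G N" "set_pmf p' \<subseteq> G N" "to_meas N p = to_meas N p'"
  shows "p = p'"
proof (rule pmf_eqI)
  fix Y show "pmf p Y = pmf p' Y"
  proof (cases "Y \<in> G N")
    case True
    then show ?thesis using measure_to_meas_single[OF True, of p] measure_to_meas_single[OF True, of p'] assms(3) by simp
  next
    case False
    then have "Y \<notin> set_pmf p" "Y \<notin> set_pmf p'" using assms(1,2) by blast+
    then show ?thesis by (simp add: set_pmf_iff)
  qed
qed

definition supported :: "(nat \<Rightarrow> real set pmf) \<Rightarrow> bool" where
  "supported P \<longleftrightarrow> (\<forall>N\<ge>1. set_pmf (P N) \<subseteq> G N)"

text \<open>Level 0 is left \<open>undefined\<close>, as required in a product space indexed by \<open>N \<ge> 1\<close>.\<close>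

definition system_of :: "(nat \<Rightarrow> real set pmf) \<Rightarrow> nat \<Rightarrow> real set measure" where
  "system_of P = (\<lambda>N\<in>{1..}. to_meas N (P N))"

lemma system_of_nth: "1 \<le> N \<Longrightarrow> system_of P N = to_meas N (P N)"
  by (simp add: system_of_def)

lemma system_of_prob_systems: "supported P \<Longrightarrow> system_of P \<in> space (prob_systems q zm zp)"
  unfolding prob_systems_def space_PiM system_of_def supported_def by (intro restrict_PiE_iff[THEN iffD2]) (auto intro: to_meas_prob)

lemma prob_systems_system_of:
  assumes M: "M \<in> space (prob_systems q zm zp)"
  obtains P where "supported P" "M = system_of P"
proof -
  have MP: "M \<in> PiE {1..} (\<lambda>N. space (prob_algebra (count_space (G N))))"
    using M unfolding prob_systems_def space_PiM .
  have "\<forall>N. \<exists>p. 1 \<le> N \<longrightarrow> set_pmf p \<subseteq> G N \<and> M N = to_meas N p"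
  proof
    fix N show "\<exists>p. 1 \<le> N \<longrightarrow> set_pmf p \<subseteq> G N \<and> M N = to_meas N p"
    proof (cases "1 \<le> N")
      case True
      then have "M N \<in> space (prob_algebra (count_space (G N)))" using PiE_mem[OF MP, of N] by simp
      from prob_to_meas[OF this] show ?thesis by blast
    qed blast
  qed
  from choice[OF this] obtain P where P: "\<forall>N. 1 \<le> N \<longrightarrow> set_pmf (P N) \<subseteq> G N \<and> M N = to_meas N (P N)" ..
  show thesis
  proof (rule that[of P])
    show "supported P" using P unfolding supported_def by blast
    show "M = system_of P"
    proof
      fix N show "M N = system_of P N"
        using P PiE_arb[OF MP, of N] by (cases "1 \<le> N") (auto simp: system_of_def)
    qed
  qed
qed

lemma system_of_inj:
  assumes "supported P" "supported P'"
  shows "system_of P = system_of P' \<longleftrightarrow> (\<forall>N\<ge>1. P N = P' N)"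
proof
  assume eq: "system_of P = system_of P'"
  show "\<forall>N\<ge>1. P N = P' N"
  proof (intro allI impI)
    fix N :: nat assume N: "1 \<le> N"
    show "P N = P' N"
      by (rule to_meas_inj[of _ N]) (use assms N fun_cong[OF eq, of N] in \<open>auto simp: supported_def system_of_nth\<close>)
  qed
next
  assume "\<forall>N\<ge>1. P N = P' N"
  then show "system_of P = system_of P'" by (auto simp: system_of_def)
qed

lemma coherent_family_supported: "coherent_family P \<Longrightarrow> supported P"
  by (simp add: coherent_family_def supported_def)

lemma measure_system_of: "1 \<le> N \<Longrightarrow> Y \<in> G N \<Longrightarrow> measure (system_of P N) {Y} = pmf (P N) Y"
  by (simp add: system_of_nth measure_to_meas_single)

lemma coherent_system_of:
  assumes P: "supported P"
  shows "system_of P \<in> coherent_systems q zm zp \<longleftrightarrow> coherent_family P"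
proof -
  have step: "(\<Sum>\<^sub>\<infinity>X\<in>G (Suc N). measure (system_of P (Suc N)) {X} * qlink q zm zp N X Y) = pmf (bind_pmf (P (Suc N)) (link N)) Y"
    if N: "1 \<le> N" and Y: "Y \<in> G N" for N Y
  proof -
    have "pmf (bind_pmf (P (Suc N)) (link N)) Y
        = (\<Sum>\<^sub>\<infinity>X\<in>G (Suc N). pmf (P (Suc N)) X * pmf (link N X) Y)"
      unfolding pmf_bind
      by (rule expectation_infsum[where B = 1]) (use P in \<open>auto simp: pmf_le_1 supported_def\<close>)
    also have "\<dots> = (\<Sum>\<^sub>\<infinity>X\<in>G (Suc N). measure (system_of P (Suc N)) {X} * qlink q zm zp N X Y)"
      by (rule infsum_cong) (use N Y in \<open>simp add: measure_system_of pmf_link\<close>)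
    finally show ?thesis by simp
  qed
  have out: "pmf (bind_pmf (P (Suc N)) (link N)) Y = 0 \<and> pmf (P N) Y = 0" if N: "1 \<le> N" and Y: "Y \<notin> G N" for N Y
  proof -
    have "Y \<notin> set_pmf (bind_pmf (P (Suc N)) (link N))"
    proof
      assume "Y \<in> set_pmf (bind_pmf (P (Suc N)) (link N))"
      then obtain X where X: "X \<in> set_pmf (P (Suc N))" "Y \<in> set_pmf (link N X)" by (auto simp: set_bind_pmf)
      then have "X \<in> G (Suc N)" using P by (auto simp: supported_def)
      from set_link_G[OF this X(2)] show False using Y by simp
    qed
    moreover have "Y \<notin> set_pmf (P N)" using P N Y by (auto simp: supported_def)
    ultimately show ?thesis by (simp only: set_pmf_iff not_not)
  qed
  have "coherent_family P \<longleftrightarrow> (\<forall>N\<ge>1. \<forall>Y. pmf (bind_pmf (P (Suc N)) (link N)) Y = pmf (P N) Y)"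
    using P unfolding coherent_family_def supported_def pmf_eq_iff by blast
  also have "\<dots> \<longleftrightarrow> (\<forall>N\<ge>1. \<forall>Y\<in>G N. pmf (bind_pmf (P (Suc N)) (link N)) Y = pmf (P N) Y)"
  proof
    assume *: "\<forall>N\<ge>1. \<forall>Y\<in>G N. pmf (bind_pmf (P (Suc N)) (link N)) Y = pmf (P N) Y"
    show "\<forall>N\<ge>1. \<forall>Y. pmf (bind_pmf (P (Suc N)) (link N)) Y = pmf (P N) Y"
    proof (intro allI impI)
      fix N :: nat and Y assume N: "1 \<le> N"
      show "pmf (bind_pmf (P (Suc N)) (link N)) Y = pmf (P N) Y"
        using * N out[OF N, of Y] by (cases "Y \<in> G N") auto
    qed
  qed blast
  also have "\<dots> \<longleftrightarrow> (\<forall>N\<ge>1. \<forall>Y\<in>G N.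
      (\<Sum>\<^sub>\<infinity>X\<in>G (Suc N). measure (system_of P (Suc N)) {X} * qlink q zm zp N X Y) = measure (system_of P N) {Y})"
    by (simp add: step measure_system_of)
  finally show ?thesis using system_of_prob_systems[OF P] by (simp add: coherent_systems_def)
qed

lemma coherent_systems_system_of:
  assumes "M \<in> coherent_systems q zm zp"
  obtains P where "coherent_family P" "M = system_of P"
proof -
  have "M \<in> space (prob_systems q zm zp)" using assms by (simp add: coherent_systems_def)
  from prob_systems_system_of[OF this] obtain P where P: "supported P" "M = system_of P" by blast
  then show thesis using that[of P] coherent_system_of[OF P(1)] assms by simp
qed

lemma mixture_system_of:
  assumes "supported P" "supported A" "supported B"
  shows "(\<forall>N\<ge>1. \<forall>Y\<in>G N. measure (system_of P N) {Y} = (1 - t) * measure (system_of A N) {Y} + t * measure (system_of B N) {Y})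
    \<longleftrightarrow> (\<forall>N\<ge>1. \<forall>Y. pmf (P N) Y = (1 - t) * pmf (A N) Y + t * pmf (B N) Y)"
proof -
  have out: "pmf (P N) Y = 0" if "supported P" "1 \<le> N" "Y \<notin> G N" for P N Y
  proof -
    have "Y \<notin> set_pmf (P N)" using that unfolding supported_def by blast
    then show ?thesis by (simp add: set_pmf_iff)
  qed
  have "(\<forall>Y\<in>G N. measure (system_of P N) {Y} = (1 - t) * measure (system_of A N) {Y} + t * measure (system_of B N) {Y})
    \<longleftrightarrow> (\<forall>Y. pmf (P N) Y = (1 - t) * pmf (A N) Y + t * pmf (B N) Y)" if N: "1 \<le> N" for N
  proof -
    have "pmf (P N) Y = (1 - t) * pmf (A N) Y + t * pmf (B N) Y" if "Y \<notin> G N" for Y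
      using out[OF assms(1) N that] out[OF assms(2) N that] out[OF assms(3) N that] by simp
    then show ?thesis using N by (auto simp: measure_system_of)
  qed
  then show ?thesis by blast
qed

lemma minimal_system_of:
  assumes P: "supported P"
  shows "system_of P \<in> minimal_boundary q zm zp \<longleftrightarrow> extreme_family P"
proof
  assume m: "system_of P \<in> minimal_boundary q zm zp"
  then have c: "coherent_family P" using coherent_system_of[OF P] by (simp add: minimal_boundary_def)
  show "extreme_family P"
    unfolding extreme_family_def
  proof (intro conjI allI impI c)
    fix A B t and N :: nat assume *: "coherent_family A \<and> coherent_family B \<and> 0 < t \<and> t < 1 \<and>
     (\<forall>N\<ge>1. \<forall>Y. pmf (P N) Y = (1 - t) * pmf (A N) Y + t * pmf (B N) Y)" and N: "1 \<le> N"
    note sA = coherent_family_supported[of A] and sB = coherent_family_supported[of B]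
    have "system_of A \<in> coherent_systems q zm zp" "system_of B \<in> coherent_systems q zm zp"
      using coherent_system_of sA sB * by blast+
    moreover have "0 < t \<and> t < 1 \<and> (\<forall>N\<ge>1. \<forall>Y\<in>G N.
        measure (system_of P N) {Y} = (1 - t) * measure (system_of A N) {Y} + t * measure (system_of B N) {Y})"
      using mixture_system_of[OF P sA sB] * by blast
    ultimately have "system_of A = system_of B" using m unfolding minimal_boundary_def by blast
    then show "A N = B N" using system_of_inj[OF sA sB] * N by blast
  qed
next
  assume e: "extreme_family P"
  have c: "system_of P \<in> coherent_systems q zm zp" using e coherent_system_of[OF P] by (simp add: extreme_family_def)
  show "system_of P \<in> minimal_boundary q zm zp"
    unfolding minimal_boundary_def mem_Collect_eq
  proof (intro conjI ballI allI impI c)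
    fix MA MB t assume M: "MA \<in> coherent_systems q zm zp" "MB \<in> coherent_systems q zm zp"
      and t: "0 < t \<and> t < 1 \<and> (\<forall>N\<ge>1. \<forall>Y\<in>G N.
        measure (system_of P N) {Y} = (1 - t) * measure (MA N) {Y} + t * measure (MB N) {Y})"
    obtain A where A: "coherent_family A" "MA = system_of A" using coherent_systems_system_of[OF M(1)] by blast
    obtain B where B: "coherent_family B" "MB = system_of B" using coherent_systems_system_of[OF M(2)] by blast
    note sA = coherent_family_supported[OF A(1)] and sB = coherent_family_supported[OF B(1)]
    have "coherent_family A \<and> coherent_family B \<and> 0 < t \<and> t < 1 \<and>
     (\<forall>N\<ge>1. \<forall>Y. pmf (P N) Y = (1 - t) * pmf (A N) Y + t * pmf (B N) Y)"
      using A(1) B(1) t mixture_system_of[OF P sA sB] unfolding A(2) B(2) by blast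
    then have "\<forall>N\<ge>1. A N = B N" using conjunct2[OF e[unfolded extreme_family_def]] by blast
    then show "MA = MB" unfolding A(2) B(2) using system_of_inj[OF sA sB] by blast
  qed
qed

definition boundary_system :: "real set \<Rightarrow> nat \<Rightarrow> real set measure" where
  "boundary_system X = system_of (limit_law X)"

lemma limit_law_supported: "X \<in> Ginf \<Longrightarrow> supported (limit_law X)"
  by (rule coherent_family_supported[OF limit_law_coherent])

text \<open>Extreme systems are those that concentrate on some infinite configuration.\<close>

lemma minimal_boundary_eq: "minimal_boundary q zm zp = boundary_system ` Ginf"
proof (intro equalityI subsetI)
  fix M assume M: "M \<in> minimal_boundary q zm zp"
  then have "M \<in> coherent_systems q zm zp" by (simp add: minimal_boundary_def)
  from coherent_systems_system_of[OF this] obtain P where P: "coherent_family P" "M = system_of P" by blast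
  note sP = coherent_family_supported[OF P(1)]
  have "extreme_family P" using M minimal_system_of[OF sP] P(2) by simp
  from extreme_limit_law[OF this] obtain X where X: "X \<in> Ginf" "\<And>K. 1 \<le> K \<Longrightarrow> P K = limit_law X K" by blast
  then have "M = boundary_system X" unfolding P(2) boundary_system_def using system_of_inj[OF sP limit_law_supported[OF X(1)]] by blast
  then show "M \<in> boundary_system ` Ginf" using X(1) by blast
next
  fix M assume "M \<in> boundary_system ` Ginf"
  then obtain X where "X \<in> Ginf" "M = boundary_system X" by blast
  then show "M \<in> minimal_boundary q zm zp"
    using minimal_system_of[OF limit_law_supported] limit_law_extreme by (simp add: boundary_system_def)
qed

lemma boundary_system_inj: "inj_on boundary_system Ginf"
proof (rule inj_onI)
  fix X Y assume X: "X \<in> Ginf" and Y: "Y \<in> Ginf" and eq: "boundary_system X = boundary_system Y"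
  have "\<forall>N\<ge>1. limit_law X N = limit_law Y N" using eq system_of_inj[OF limit_law_supported[OF X] limit_law_supported[OF Y]] by (simp add: boundary_system_def)
  then show "X = Y" using limit_law_inj[OF X Y] by blast
qed

subsection \<open>The Martin boundary\<close>

lemma qlinks_row_to_meas:
  assumes "K \<le> N" "X \<in> G N"
  shows "qlinks_row q zm zp K N X = to_meas K (links K N X)"
  unfolding qlinks_row_def to_meas_def point_measure_def
  by (rule density_cong) (auto simp: AE_count_space pmf_links[OF assms])

text \<open>On discrete spaces weak convergence to a probability measure is pointwise convergence of the
  weights. The links are stochastic only for \<open>N \<ge> K\<close>, but finitely many \<open>N\<close> do not matter.\<close>

lemma limit_system_iff:
  assumes Xs: "Xs \<in> conf_seqs q zm zp" and P: "supported P"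
  shows "limit_system q zm zp Xs (system_of P)
    \<longleftrightarrow> (\<forall>K\<ge>1. \<forall>U. (\<lambda>N. pmf (links K N (Xs N)) U) \<longlonglongrightarrow> pmf (P K) U)"
proof -
  have XN: "Xs N \<in> G N" if "1 \<le> N" for N
    using Xs that unfolding conf_seqs_def by (intro Pi_mem[of Xs "{1..}"]) simp_all
  have row: "(\<integral>x. f x \<partial>qlinks_row q zm zp K N (Xs N)) = measure_pmf.expectation (links K N (Xs N)) f"
    if KN: "1 \<le> K" "K \<le> N" for K N and f :: "real set \<Rightarrow> real"
  proof -
    have N1: "1 \<le> N" using KN by simp
    have "set_pmf (links K N (Xs N)) \<subseteq> G K" using set_links[OF KN(2) XN[OF N1]] by blast
    then show ?thesis unfolding qlinks_row_to_meas[OF KN(2) XN[OF N1]] by (rule integral_to_meas)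
  qed
  have int: "(\<integral>x. f x \<partial>system_of P K) = measure_pmf.expectation (P K) f" if K: "1 \<le> K" for K and f :: "real set \<Rightarrow> real"
    unfolding system_of_nth[OF K] by (rule integral_to_meas) (use P K in \<open>simp add: supported_def\<close>)
  have "weak_conv_discrete (\<lambda>N. qlinks_row q zm zp K N (Xs N)) (system_of P K)
      \<longleftrightarrow> (\<forall>U. (\<lambda>N. pmf (links K N (Xs N)) U) \<longlonglongrightarrow> pmf (P K) U)" if K: "1 \<le> K" for K
  proof
    assume w: "weak_conv_discrete (\<lambda>N. qlinks_row q zm zp K N (Xs N)) (system_of P K)"
    show "\<forall>U. (\<lambda>N. pmf (links K N (Xs N)) U) \<longlonglongrightarrow> pmf (P K) U"
    proof
      fix U
      let ?f = "indicator {U} :: real set \<Rightarrow> real"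
      have "bounded (?f ` space (system_of P K))"
        unfolding bounded_iff by (intro exI[of _ 1]) (auto simp: indicator_def)
      then have "(\<lambda>N. \<integral>x. ?f x \<partial>qlinks_row q zm zp K N (Xs N)) \<longlonglongrightarrow> (\<integral>x. ?f x \<partial>system_of P K)"
        using w unfolding weak_conv_discrete_def by blast
      moreover have "\<forall>\<^sub>F N in sequentially. (\<integral>x. ?f x \<partial>qlinks_row q zm zp K N (Xs N)) = pmf (links K N (Xs N)) U"
        using eventually_ge_at_top[of K]
      proof eventually_elim
        case (elim N)
        show ?case unfolding row[OF K elim] by (simp add: measure_pmf_single)
      qed
      ultimately have "(\<lambda>N. pmf (links K N (Xs N)) U) \<longlonglongrightarrow> (\<integral>x. ?f x \<partial>system_of P K)"
        by (rule Lim_transform_eventually)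
      then show "(\<lambda>N. pmf (links K N (Xs N)) U) \<longlonglongrightarrow> pmf (P K) U"
        unfolding int[OF K] by (simp add: measure_pmf_single)
    qed
  next
    assume l: "\<forall>U. (\<lambda>N. pmf (links K N (Xs N)) U) \<longlonglongrightarrow> pmf (P K) U"
    show "weak_conv_discrete (\<lambda>N. qlinks_row q zm zp K N (Xs N)) (system_of P K)"
      unfolding weak_conv_discrete_def
    proof (intro allI impI)
      fix f :: "real set \<Rightarrow> real" assume "bounded (f ` space (system_of P K))"
      then obtain B where B: "\<And>Y. Y \<in> G K \<Longrightarrow> \<bar>f Y\<bar> \<le> B"
        unfolding system_of_nth[OF K] space_to_meas bounded_iff by auto
      define g where "g Y = (if Y \<in> G K then f Y else 0)" for Y
      have g: "\<bar>g Y\<bar> \<le> \<bar>B\<bar>" for Y using B[of Y] by (auto simp: g_def)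
      have c1: "(\<lambda>N. measure_pmf.expectation (links K N (Xs N)) g) \<longlonglongrightarrow> measure_pmf.expectation (P K) g"
        by (rule pmf_tendsto_expectation[OF _ g]) (use l in blast)
      have c2: "measure_pmf.expectation (P K) g = (\<integral>x. f x \<partial>system_of P K)"
        unfolding int[OF K] by (rule expectation_cong) (use P K in \<open>auto simp: g_def supported_def\<close>)
      have c3: "\<forall>\<^sub>F N in sequentially. measure_pmf.expectation (links K N (Xs N)) g
          = (\<integral>x. f x \<partial>qlinks_row q zm zp K N (Xs N))"
        using eventually_ge_at_top[of K]
      proof eventually_elim
        case (elim N)
        have N1: "1 \<le> N" using K elim by simp
        have "measure_pmf.expectation (links K N (Xs N)) g = measure_pmf.expectation (links K N (Xs N)) f"
          by (rule expectation_cong) (use set_links[OF elim XN[OF N1]] in \<open>simp add: g_def\<close>)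
        then show ?case unfolding row[OF K elim] .
      qed
      from Lim_transform_eventually[OF c1 c3]
      show "(\<lambda>N. \<integral>x. f x \<partial>qlinks_row q zm zp K N (Xs N)) \<longlonglongrightarrow> (\<integral>x. f x \<partial>system_of P K)"
        unfolding c2 .
    qed
  qed
  then show ?thesis using system_of_prob_systems[OF P] by (auto simp: limit_system_def)
qed

lemma limit_system_stabilizes:
  assumes "X \<in> Ginf" "Xs \<in> conf_seqs q zm zp" "stabilizes Xs X"
  shows "limit_system q zm zp Xs (boundary_system X)"
  unfolding boundary_system_def limit_system_iff[OF assms(2) limit_law_supported[OF assms(1)]]
  using stabilizes_tendsto[OF assms] by blast

lemma limit_system_unique:
  assumes Xs: "Xs \<in> conf_seqs q zm zp" and l: "limit_system q zm zp Xs M" "limit_system q zm zp Xs M'"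
  shows "M = M'"
proof -
  have M: "M \<in> space (prob_systems q zm zp)" "M' \<in> space (prob_systems q zm zp)"
    using l by (simp_all add: limit_system_def)
  obtain P where P: "supported P" "M = system_of P" using prob_systems_system_of[OF M(1)] by blast
  obtain P' where P': "supported P'" "M' = system_of P'" using prob_systems_system_of[OF M(2)] by blast
  have "P K = P' K" if "1 \<le> K" for K
  proof (rule pmf_eqI)
    fix U
    have "(\<lambda>N. pmf (links K N (Xs N)) U) \<longlonglongrightarrow> pmf (P K) U"
      using l(1) that unfolding P(2) limit_system_iff[OF Xs P(1)] by blast
    moreover have "(\<lambda>N. pmf (links K N (Xs N)) U) \<longlonglongrightarrow> pmf (P' K) U"
      using l(2) that unfolding P'(2) limit_system_iff[OF Xs P'(1)] by blast
    ultimately show "pmf (P K) U = pmf (P' K) U" by (rule LIMSEQ_unique)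
  qed
  then show ?thesis unfolding P(2) P'(2) using system_of_inj[OF P(1) P'(1)] by blast
qed

lemma limit_system_boundary:
  assumes Xs: "Xs \<in> conf_seqs q zm zp" and l: "limit_system q zm zp Xs M"
  shows "M \<in> boundary_system ` Ginf"
proof -
  have "M \<in> space (prob_systems q zm zp)" using l by (simp add: limit_system_def)
  from prob_systems_system_of[OF this] obtain P where P: "supported P" "M = system_of P" by blast
  have lim: "(\<lambda>N. pmf (links K N (Xs N)) U) \<longlonglongrightarrow> pmf (P K) U" if "1 \<le> K" for K U
    using l that unfolding P(2) limit_system_iff[OF Xs P(1)] by blast
  obtain X where X: "X \<in> Ginf" "stabilizes Xs X" using regular_stabilizes[OF Xs lim] by blast
  have "M = boundary_system X" by (rule limit_system_unique[OF Xs l limit_system_stabilizes[OF X(1) Xs X(2)]])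
  then show ?thesis using X(1) by blast
qed

lemma stabilizing_sequence:
  assumes X: "X \<in> Ginf"
  obtains Xs where "Xs \<in> conf_seqs q zm zp" "stabilizes Xs X"
proof (rule that[of "\<lambda>N. variational X ` {..<N}"])
  show "(\<lambda>N. variational X ` {..<N}) \<in> conf_seqs q zm zp"
    unfolding conf_seqs_def by (rule Pi_I) (rule initial_segment(1)[OF X])
  show "stabilizes (\<lambda>N. variational X ` {..<N}) X"
    unfolding stabilizes_def
  proof
    fix k
    show "\<forall>\<^sub>F N in sequentially. variational (variational X ` {..<N}) k = variational X k"
      using eventually_ge_at_top[of "Suc k"]
    proof eventually_elim
      case (elim N)
      then show ?case using initial_segment(2)[OF X, of N] by (simp add: agree_def)
    qed
  qed
qed

lemma conf_system_eq:
  assumes X: "X \<in> Ginf"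
  shows "conf_system q zm zp X = boundary_system X"
  unfolding conf_system_def
proof (rule the_equality)
  show "\<forall>Xs\<in>conf_seqs q zm zp. stabilizes Xs X \<longrightarrow> limit_system q zm zp Xs (boundary_system X)"
    using limit_system_stabilizes[OF X] by blast
  fix M assume M: "\<forall>Xs\<in>conf_seqs q zm zp. stabilizes Xs X \<longrightarrow> limit_system q zm zp Xs M"
  obtain Xs where Xs: "Xs \<in> conf_seqs q zm zp" "stabilizes Xs X" using stabilizing_sequence[OF X] by blast
  show "M = boundary_system X"
    by (rule limit_system_unique[OF Xs(1) _ limit_system_stabilizes[OF X Xs]]) (use M Xs in blast)
qed

text \<open>Members of one class have a common limit system, and limit systems are unique.\<close>

lemma class_system_eq:
  assumes Xs: "Xs \<in> regular_seqs q zm zp" and M: "limit_system q zm zp Xs M"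
  shows "class_system q zm zp (martin_equiv q zm zp `` {Xs}) = M"
  unfolding class_system_def
proof (rule the_equality)
  have c: "Xs \<in> conf_seqs q zm zp" using Xs by (simp add: regular_seqs_def)
  show "\<forall>Xs\<in>martin_equiv q zm zp `` {Xs}. limit_system q zm zp Xs M"
  proof
    fix Xs' assume "Xs' \<in> martin_equiv q zm zp `` {Xs}"
    then obtain M' where "limit_system q zm zp Xs M'" "limit_system q zm zp Xs' M'"
      by (auto simp: martin_equiv_def)
    then show "limit_system q zm zp Xs' M" using limit_system_unique[OF c M] by blast
  qed
  fix M' assume "\<forall>Xs\<in>martin_equiv q zm zp `` {Xs}. limit_system q zm zp Xs M'"
  moreover have "Xs \<in> martin_equiv q zm zp `` {Xs}" using Xs M by (auto simp: martin_equiv_def)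
  ultimately show "M' = M" using limit_system_unique[OF c _ M] by blast
qed

lemma martin_boundary_eq: "martin_boundary q zm zp = boundary_system ` Ginf"
proof (intro equalityI subsetI)
  fix M assume "M \<in> martin_boundary q zm zp"
  then obtain Xs where Xs: "Xs \<in> regular_seqs q zm zp"
    "M = class_system q zm zp (martin_equiv q zm zp `` {Xs})"
    unfolding martin_boundary_def martin_classes_def quotient_def by blast
  have c: "Xs \<in> conf_seqs q zm zp" and "\<exists>M'. limit_system q zm zp Xs M'"
    using Xs(1) by (simp_all add: regular_seqs_def)
  then obtain M' where l: "limit_system q zm zp Xs M'" by blast
  show "M \<in> boundary_system ` Ginf"
    unfolding Xs(2) class_system_eq[OF Xs(1) l] by (rule limit_system_boundary[OF c l])
next
  fix M assume "M \<in> boundary_system ` Ginf"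
  then obtain X where X: "X \<in> Ginf" "M = boundary_system X" by blast
  obtain Xs where Xs: "Xs \<in> conf_seqs q zm zp" "stabilizes Xs X" using stabilizing_sequence[OF X(1)] by blast
  have l: "limit_system q zm zp Xs M" unfolding X(2) by (rule limit_system_stabilizes[OF X(1) Xs])
  then have r: "Xs \<in> regular_seqs q zm zp" using Xs(1) by (auto simp: regular_seqs_def)
  show "M \<in> martin_boundary q zm zp"
    unfolding martin_boundary_def martin_classes_def
  proof (rule image_eqI)
    show "M = class_system q zm zp (martin_equiv q zm zp `` {Xs})" by (rule class_system_eq[OF r l, symmetric])
    show "martin_equiv q zm zp `` {Xs} \<in> regular_seqs q zm zp // martin_equiv q zm zp"
      by (rule quotientI[OF r])
  qed
qed

end

section \<open>The Borel structures\<close>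

context qlattice
begin

abbreviation "Bor \<equiv> inf_confs_borel q zm zp"
abbreviation "Sys \<equiv> prob_systems q zm zp"

lemma Bor_sets: "{U. openin (inf_confs_topology q zm zp) U} \<subseteq> Pow Ginf"
  unfolding inf_confs_topology_def openin_pullback_topology by blast

lemma space_Bor: "space Bor = Ginf"
  unfolding inf_confs_borel_def using Bor_sets by (rule space_measure_of)

lemma sets_Bor: "sets Bor = sigma_sets Ginf {U. openin (inf_confs_topology q zm zp) U}"
  unfolding inf_confs_borel_def using Bor_sets by (rule sets_measure_of)

text \<open>Nonzero points of the grid are isolated, so fixing one term of the variational series
  defines an open set.\<close>

lemma open_point:
  assumes z: "z \<in> L"
  shows "openin (top_of_set (insert 0 L)) {z}"
proof -
  have z0: "0 < \<bar>z\<bar>" using L_nz[OF z] by simp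
  have "y = z" if y: "y \<in> insert 0 L" "y \<in> ball z ((1 - q) * \<bar>z\<bar>)" for y
  proof (rule ccontr)
    assume "y \<noteq> z"
    have "(1 - q) * \<bar>z\<bar> \<le> \<bar>y - z\<bar>"
    proof (cases "y = 0")
      case True
      then show ?thesis using q0 z0 by (simp add: mult_le_cancel_right1)
    next
      case False
      then show ?thesis using y(1) by (intro L_dist z \<open>y \<noteq> z\<close>) simp
    qed
    then show False using y(2) by (simp add: dist_real_def abs_minus_commute)
  qed
  moreover have "z \<in> ball z ((1 - q) * \<bar>z\<bar>)" using z0 q1 by simp
  ultimately have "{z} = insert 0 L \<inter> ball z ((1 - q) * \<bar>z\<bar>)" using z by blast
  then show ?thesis unfolding openin_open using open_ball by blast
qed

lemma term_measurable: "{X \<in> Ginf. variational X i = z} \<in> sets Bor"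
proof (cases "z \<in> L")
  case False
  have "{X \<in> Ginf. variational X i = z} = {}"
    using variational_in(1)[OF Ginf_bconf Ginf_valid] Ginf_bconf False unfolding bconf_def by blast
  then show ?thesis by (simp only: sets.empty_sets)
next
  case True
  let ?T = "product_topology (\<lambda>_::nat. top_of_set (insert 0 L)) UNIV"
  have vt: "variational X \<in> topspace ?T" if X: "X \<in> Ginf" for X
  proof -
    have "variational X j \<in> L" for j
      using variational_in(1)[OF Ginf_bconf[OF X] Ginf_valid[OF X]] Ginf_bconf[OF X] unfolding bconf_def by blast
    then show ?thesis by (simp add: topspace_product_topology PiE_UNIV_domain)
  qed
  have "continuous_map ?T (top_of_set (insert 0 L)) (\<lambda>x. x i)"
    by (rule continuous_map_product_projection[of i UNIV "\<lambda>_. top_of_set (insert 0 L)"]) simp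
  from openin_continuous_map_preimage[OF this open_point[OF True]]
  have "openin ?T {x \<in> topspace ?T. x i \<in> {z}}" .
  moreover have "{X \<in> Ginf. variational X i = z} = variational -` {x \<in> topspace ?T. x i \<in> {z}} \<inter> Ginf"
    using vt by auto
  ultimately have "openin (inf_confs_topology q zm zp) {X \<in> Ginf. variational X i = z}"
    unfolding inf_confs_topology_def openin_pullback_topology by blast
  then show ?thesis unfolding sets_Bor by (intro sigma_sets.Basic) simp
qed

text \<open>The initial segment takes countably many values, each of which is determined by finitely many
  terms of the variational series.\<close>

lemma segment_measurable: "(\<lambda>X. variational X ` {..<n}) \<in> Bor \<rightarrow>\<^sub>M count_space (G n)"
proof (subst measurable_count_space_eq_countable[OF countable_G], intro conjI ballI)
  show "(\<lambda>X. variational X ` {..<n}) \<in> space Bor \<rightarrow> G n"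
    unfolding space_Bor using initial_segment(1) by blast
  fix Z assume Z: "Z \<in> G n"
  have "(\<lambda>X. variational X ` {..<n}) -` {Z} \<inter> space Bor
      = {X \<in> Ginf. \<forall>i\<in>{..<n}. variational X i = variational Z i}"
  proof (intro equalityI subsetI)
    fix X assume "X \<in> (\<lambda>X. variational X ` {..<n}) -` {Z} \<inter> space Bor"
    then have X: "X \<in> Ginf" "variational X ` {..<n} = Z" by (auto simp: space_Bor)
    then show "X \<in> {X \<in> Ginf. \<forall>i\<in>{..<n}. variational X i = variational Z i}"
      using initial_segment(2)[OF X(1), of n] by (simp add: agree_def)
  next
    fix X assume X: "X \<in> {X \<in> Ginf. \<forall>i\<in>{..<n}. variational X i = variational Z i}"
    then have "variational X ` {..<n} = variational Z ` {..<n}" by (intro image_cong) auto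
    also have "\<dots> = Z" by (rule bij_betw_imp_surj_on[OF variational_bij[OF Z]])
    finally show "X \<in> (\<lambda>X. variational X ` {..<n}) -` {Z} \<inter> space Bor" using X by (simp add: space_Bor)
  qed
  also have "\<dots> \<in> sets Bor"
  proof -
    have "{X \<in> space Bor. \<forall>i\<in>{..<n}. variational X i = variational Z i} \<in> sets Bor"
      by (rule sets.sets_Collect_finite_All) (simp_all add: space_Bor term_measurable)
    then show ?thesis by (simp only: space_Bor)
  qed
  finally show "(\<lambda>X. variational X ` {..<n}) -` {Z} \<inter> space Bor \<in> sets Bor" .
qed

text \<open>A pointwise limit of functions of the initial segments, since these stabilize to \<open>X\<close>.\<close>

lemma limit_law_prob_measurable: "(\<lambda>X. measure_pmf.prob (limit_law X K) A) \<in> borel_measurable Bor"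
proof (rule borel_measurable_LIMSEQ_real)
  show "(\<lambda>n. measure_pmf.prob (links K n (variational X ` {..<n})) A) \<longlonglongrightarrow> measure_pmf.prob (limit_law X K) A"
    if "X \<in> space Bor" for X
  proof -
    have X: "X \<in> Ginf" using that by (simp add: space_Bor)
    have f: "filterlim (\<lambda>n. (n, variational X ` {..<n})) (stab_filter X) sequentially"
      unfolding filterlim_iff
    proof (intro allI impI)
      fix P assume "eventually P (stab_filter X)"
      then obtain k where k: "\<And>N Z. k \<le> N \<Longrightarrow> Z \<in> G N \<Longrightarrow> agree k Z X \<Longrightarrow> P (N, Z)"
        unfolding eventually_stab_filter by blast
      show "\<forall>\<^sub>F n in sequentially. P (n, variational X ` {..<n})"
        using eventually_ge_at_top[of k]
      proof eventually_elim
        case (elim n)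
        have "agree k (variational X ` {..<n}) X"
          using initial_segment(2)[OF X, of n] elim by (simp add: agree_def)
        then show ?case by (rule k[OF elim initial_segment(1)[OF X]])
      qed
    qed
    from filterlim_compose[OF pmf_tendsto_prob[OF limit_law_tendsto'[OF X]] f]
    show ?thesis by simp
  qed
  show "(\<lambda>X. measure_pmf.prob (links K n (variational X ` {..<n})) A) \<in> borel_measurable Bor" for n
    by (rule measurable_compose[OF segment_measurable]) simp
qed

lemma boundary_system_measurable: "boundary_system \<in> Bor \<rightarrow>\<^sub>M Sys"
proof -
  have "(\<lambda>X. to_meas N (limit_law X N)) \<in> Bor \<rightarrow>\<^sub>M prob_algebra (count_space (G N))" for N
  proof (rule measurable_prob_algebraI)
    have pr: "prob_space (to_meas N (limit_law X N))" if "X \<in> space Bor" for X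
      using to_meas_prob[OF limit_law_set] that by (simp add: space_Bor space_prob_algebra)
    then show "prob_space (to_meas N (limit_law X N))" if "X \<in> space Bor" for X using that .
    show "(\<lambda>X. to_meas N (limit_law X N)) \<in> Bor \<rightarrow>\<^sub>M subprob_algebra (count_space (G N))"
    proof (rule measurable_subprob_algebra)
      show "subprob_space (to_meas N (limit_law X N))" if "X \<in> space Bor" for X
        by (rule prob_space_imp_subprob_space[OF pr[OF that]])
      show "sets (to_meas N (limit_law X N)) = sets (count_space (G N))" for X by (simp add: sets_to_meas)
      fix A assume "A \<in> sets (count_space (G N))"
      then have A: "A \<subseteq> G N" by simp
      have "(\<lambda>X. ennreal (measure_pmf.prob (limit_law X N) A)) \<in> borel_measurable Bor"
        by (rule measurable_compose[OF limit_law_prob_measurable measurable_ennreal])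
      then show "(\<lambda>X. emeasure (to_meas N (limit_law X N)) A) \<in> borel_measurable Bor"
        by (simp only: emeasure_to_meas[OF A] measure_pmf.emeasure_eq_measure)
    qed
  qed
  then have "(\<lambda>X. \<lambda>N\<in>{1..}. to_meas N (limit_law X N)) \<in> Bor \<rightarrow>\<^sub>M Sys"
    unfolding prob_systems_def by (intro measurable_restrict)
  moreover have "(\<lambda>X. \<lambda>N\<in>{1..}. to_meas N (limit_law X N)) = boundary_system"
    by (simp add: boundary_system_def system_of_def fun_eq_iff)
  ultimately show ?thesis by simp
qed

text \<open>Conversely, a term of the variational series of \<open>X\<close> can be read off the system: it is the
  value that the same term takes with probability more than \<open>1/2\<close> on all high levels.\<close>

lemma term_from_system:
  assumes X: "X \<in> Ginf"
  shows "variational X i = z \<longleftrightarrow>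
    (\<exists>n. \<forall>j. 1 / 2 < measure (boundary_system X (Suc (n + j))) {Y \<in> G (Suc (n + j)). variational Y i = z})"
proof -
  let ?E = "\<lambda>z. {Y. variational Y i = z}"
  have eq: "measure (boundary_system X N) {Y \<in> G N. variational Y i = z} = measure_pmf.prob (limit_law X N) (?E z)"
    if "1 \<le> N" for N z
  proof -
    have "measure (boundary_system X N) {Y \<in> G N. variational Y i = z}
        = measure_pmf.prob (limit_law X N) {Y \<in> G N. variational Y i = z}"
      unfolding boundary_system_def system_of_nth[OF that] by (rule measure_to_meas) blast
    also have "\<dots> = measure_pmf.prob (limit_law X N) (?E z)"
      by (rule antisym; rule prob_mono_pmf) (use limit_law_set[OF X] in blast)+
    finally show ?thesis .
  qed
  have l: "(\<lambda>N. measure_pmf.prob (limit_law X N) (?E (variational X i))) \<longlonglongrightarrow> 1"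
    using limit_law_concentrates[OF X] unfolding concentrates_def by blast
  have "\<forall>\<^sub>F N in sequentially. 1 / 2 < measure_pmf.prob (limit_law X N) (?E (variational X i))"
    by (rule order_tendstoD(1)[OF l]) simp
  then obtain N0 where N0: "\<forall>N\<ge>N0. 1 / 2 < measure_pmf.prob (limit_law X N) (?E (variational X i))"
    unfolding eventually_sequentially ..
  show ?thesis
  proof
    assume "variational X i = z"
    then have "1 / 2 < measure_pmf.prob (limit_law X (Suc (N0 + j))) (?E z)" for j
      using N0[rule_format, of "Suc (N0 + j)"] by simp
    then show "\<exists>n. \<forall>j. 1 / 2 < measure (boundary_system X (Suc (n + j))) {Y \<in> G (Suc (n + j)). variational Y i = z}"
      using eq by (intro exI[of _ N0]) simp
  next
    assume "\<exists>n. \<forall>j. 1 / 2 < measure (boundary_system X (Suc (n + j))) {Y \<in> G (Suc (n + j)). variational Y i = z}"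
    then obtain n where n: "\<forall>j. 1 / 2 < measure (boundary_system X (Suc (n + j))) {Y \<in> G (Suc (n + j)). variational Y i = z}" ..
    let ?N = "Suc (n + N0)"
    have 1: "1 / 2 < measure_pmf.prob (limit_law X ?N) (?E z)"
      using n[rule_format, of N0] unfolding eq[of ?N z, simplified] .
    have 2: "1 / 2 < measure_pmf.prob (limit_law X ?N) (?E (variational X i))" by (rule N0[rule_format]) simp
    show "variational X i = z"
    proof (rule ccontr)
      assume "variational X i \<noteq> z"
      then have "measure_pmf.prob (limit_law X ?N) (?E z) \<le> measure_pmf.prob (limit_law X ?N) (- ?E (variational X i))"
        by (intro prob_mono_pmf) auto
      then show False using 1 2 unfolding prob_compl by linarith
    qed
  qed
qed

definition cylinder :: "nat \<Rightarrow> real set \<Rightarrow> real set set" where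
  "cylinder n Z = {X \<in> Ginf. \<forall>i\<in>{..<n}. variational X i = variational Z i}"

text \<open>The criterion by which a term is read off the system involves countably many probabilities.\<close>

lemma image_cylinder: "boundary_system ` cylinder n Z \<in> sets (restrict_space Sys (boundary_system ` Ginf))"
proof -
  let ?C = "\<lambda>i n' j. {M \<in> space Sys. 1 / 2 < measure (M (Suc (n' + j)))
    {Y \<in> G (Suc (n' + j)). variational Y i = variational Z i}}"
  have meas: "?C i n' j \<in> sets Sys" for i n' j
  proof -
    have "(\<lambda>M. M (Suc (n' + j))) \<in> Sys \<rightarrow>\<^sub>M prob_algebra (count_space (G (Suc (n' + j))))"
      unfolding prob_systems_def by (rule measurable_component_singleton) simp
    then have "(\<lambda>M. measure (M (Suc (n' + j))) {Y \<in> G (Suc (n' + j)). variational Y i = variational Z i})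
        \<in> borel_measurable Sys"
      by (rule measurable_compose) (rule measurable_measure_prob_algebra, simp)
    then show ?thesis by simp
  qed
  define D where "D = {M \<in> space Sys. \<forall>i\<in>{..<n}. \<exists>n'. \<forall>j. 1 / 2 < measure (M (Suc (n' + j)))
    {Y \<in> G (Suc (n' + j)). variational Y i = variational Z i}}"
  have "D \<in> sets Sys"
    unfolding D_def
    by (intro sets.sets_Collect_finite_All sets.sets_Collect_countable_Ex sets.sets_Collect_countable_All meas) simp
  moreover have "boundary_system ` cylinder n Z = boundary_system ` Ginf \<inter> D"
  proof (intro equalityI subsetI)
    fix M assume "M \<in> boundary_system ` cylinder n Z"
    then obtain X where X: "X \<in> Ginf" "\<forall>i\<in>{..<n}. variational X i = variational Z i" "M = boundary_system X"
      by (auto simp: cylinder_def)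
    have "boundary_system X \<in> space Sys" unfolding boundary_system_def by (rule system_of_prob_systems[OF limit_law_supported[OF X(1)]])
    then show "M \<in> boundary_system ` Ginf \<inter> D"
      using X(1,2) term_from_system[OF X(1)] unfolding X(3) D_def by simp
  next
    fix M assume "M \<in> boundary_system ` Ginf \<inter> D"
    then obtain X where X: "X \<in> Ginf" "M = boundary_system X" "boundary_system X \<in> D" by blast
    then have "X \<in> cylinder n Z" using term_from_system[OF X(1)] unfolding D_def cylinder_def by simp
    then show "M \<in> boundary_system ` cylinder n Z" unfolding X(2) by (rule imageI)
  qed
  ultimately show ?thesis unfolding sets_restrict_space by blast
qed

text \<open>Basic open sets of the product topology restrict finitely many coordinates only.\<close>

lemma open_cylinder:
  assumes U: "openin (inf_confs_topology q zm zp) U" and X: "X \<in> U"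
  obtains n where "cylinder n (variational X ` {..<n}) \<subseteq> U" "X \<in> cylinder n (variational X ` {..<n})"
proof -
  let ?T = "product_topology (\<lambda>_::nat. top_of_set (insert 0 L)) UNIV"
  obtain W where W: "openin ?T W" "U = variational -` W \<inter> Ginf"
    using U unfolding inf_confs_topology_def openin_pullback_topology by blast
  have XG: "X \<in> Ginf" and XW: "variational X \<in> W" using X W(2) by auto
  obtain B where B: "variational X \<in> PiE UNIV B" "finite {i. B i \<noteq> topspace (top_of_set (insert 0 L))}"
    "PiE UNIV B \<subseteq> W"
    using product_topology_open_contains_basis[OF W(1) XW] by blast
  obtain n where n: "\<forall>i\<in>{i. B i \<noteq> topspace (top_of_set (insert 0 L))}. i < n"
    using finite_nat_set_iff_bounded[THEN iffD1, OF B(2)] ..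
  have ag: "variational (variational X ` {..<n}) i = variational X i" if "i < n" for i
    using initial_segment(2)[OF XG, of n] that by (simp add: agree_def)
  show thesis
  proof (rule that[of n])
    show "X \<in> cylinder n (variational X ` {..<n})" using XG ag by (simp add: cylinder_def)
    show "cylinder n (variational X ` {..<n}) \<subseteq> U"
    proof
      fix X' assume "X' \<in> cylinder n (variational X ` {..<n})"
      then have X': "X' \<in> Ginf" "\<And>i. i < n \<Longrightarrow> variational X' i = variational X i"
        using ag by (auto simp: cylinder_def)
      have "variational X' i \<in> B i" for i
      proof (cases "i < n")
        case True
        then show ?thesis using PiE_mem[OF B(1), of i] X'(2)[OF True] by simp
      next
        case False
        then have "B i = insert 0 L" using n by auto
        moreover have "variational X' i \<in> L"
          using variational_in(1)[OF Ginf_bconf[OF X'(1)] Ginf_valid[OF X'(1)]] Ginf_bconf[OF X'(1)]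
          unfolding bconf_def by blast
        ultimately show ?thesis by simp
      qed
      then have "variational X' \<in> PiE UNIV B" by (simp add: PiE_UNIV_domain)
      then show "X' \<in> U" using B(3) X'(1) unfolding W(2) by blast
    qed
  qed
qed

text \<open>There are only countably many cylinders.\<close>

lemma image_open:
  assumes U: "openin (inf_confs_topology q zm zp) U"
  shows "boundary_system ` U \<in> sets (restrict_space Sys (boundary_system ` Ginf))"
proof -
  define I where "I = {p \<in> (SIGMA n:UNIV. G n). cylinder (fst p) (snd p) \<subseteq> U}"
  have "countable I"
    unfolding I_def by (rule countable_subset[of _ "SIGMA n:UNIV. G n"]) (auto intro!: countable_SIGMA countable_G)
  moreover have "U = (\<Union>p\<in>I. cylinder (fst p) (snd p))"
  proof (intro equalityI subsetI)
    fix X assume X: "X \<in> U"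
    then have XG: "X \<in> Ginf" using U Bor_sets by blast
    obtain n where n: "cylinder n (variational X ` {..<n}) \<subseteq> U" "X \<in> cylinder n (variational X ` {..<n})"
      using open_cylinder[OF U X] by blast
    have "(n, variational X ` {..<n}) \<in> I" using n(1) initial_segment(1)[OF XG] by (simp add: I_def)
    then show "X \<in> (\<Union>p\<in>I. cylinder (fst p) (snd p))" by (rule UN_I) (use n(2) in simp)
  qed (auto simp: I_def)
  then have "boundary_system ` U = (\<Union>p\<in>I. boundary_system ` cylinder (fst p) (snd p))" by (simp only: image_UN)
  ultimately show ?thesis
    by (simp only:) (rule sets.countable_UN'[OF _ image_subsetI[OF image_cylinder]])
qed

lemma image_Bor:
  assumes "S \<in> sets Bor"
  shows "boundary_system ` S \<in> sets (restrict_space Sys (boundary_system ` Ginf))"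
  using assms unfolding sets_Bor
proof (induction rule: sigma_sets.induct)
  case (Basic a)
  then show ?case using image_open by simp
next
  case Empty
  show ?case by simp
next
  case (Compl a)
  \<comment> \<open>Injectivity lets images commute with complements.\<close>
  have "a \<subseteq> Ginf" using sigma_sets_into_sp[OF Bor_sets Compl.hyps] .
  then have "boundary_system ` (Ginf - a) = boundary_system ` Ginf - boundary_system ` a"
    using boundary_system_inj by (intro inj_on_image_set_diff) auto
  moreover have "boundary_system ` Ginf \<in> sets (restrict_space Sys (boundary_system ` Ginf))"
  proof -
    have "boundary_system X \<in> space Sys" if "X \<in> Ginf" for X
      unfolding boundary_system_def by (rule system_of_prob_systems[OF limit_law_supported[OF that]])
    then have "space (restrict_space Sys (boundary_system ` Ginf)) = boundary_system ` Ginf" by (auto simp: space_restrict_space)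
    then show ?thesis using sets.top[of "restrict_space Sys (boundary_system ` Ginf)"] by simp
  qed
  ultimately show ?case using Compl.IH by (simp add: sets.Diff)
next
  case (Union a)
  have "boundary_system ` (\<Union>i. a i) = (\<Union>i. boundary_system ` a i)" by (rule image_UN)
  then show ?case using Union.IH by (simp only:) (rule sets.countable_UN, blast)
qed

lemma Borel_structures_agree:
  "(\<lambda>S. conf_system q zm zp ` S) ` sets Bor = sets (restrict_space Sys (minimal_boundary q zm zp))"
proof -
  have im: "conf_system q zm zp ` S = boundary_system ` S" if "S \<in> sets Bor" for S
  proof (rule image_cong)
    fix X assume "X \<in> S"
    then have "X \<in> Ginf" using sets.sets_into_space[OF that] unfolding space_Bor by blast
    then show "conf_system q zm zp X = boundary_system X" by (rule conf_system_eq)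
  qed simp
  have "(\<lambda>S. conf_system q zm zp ` S) ` sets Bor = (\<lambda>S. boundary_system ` S) ` sets Bor"
    by (rule image_cong) (simp_all add: im)
  also have "\<dots> = sets (restrict_space Sys (boundary_system ` Ginf))"
  proof (intro equalityI subsetI)
    fix A assume "A \<in> sets (restrict_space Sys (boundary_system ` Ginf))"
    then obtain A' where A': "A' \<in> sets Sys" "A = boundary_system ` Ginf \<inter> A'" unfolding sets_restrict_space by blast
    have "boundary_system -` A' \<inter> space Bor \<in> sets Bor" by (rule measurable_sets[OF boundary_system_measurable A'(1)])
    moreover have "A = boundary_system ` (boundary_system -` A' \<inter> space Bor)" unfolding A'(2) space_Bor by blast
    ultimately show "A \<in> (\<lambda>S. boundary_system ` S) ` sets Bor" by blast
  qed (use image_Bor in blast)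
  finally show ?thesis unfolding minimal_boundary_eq .
qed

end

theorem theorem3p12:
  fixes q zm zp :: real
  assumes "0 < q" and "q < 1" and "zm < 0" and "0 < zp"
  shows "minimal_boundary q zm zp = martin_boundary q zm zp
    \<and> bij_betw (conf_system q zm zp) (inf_confs q zm zp) (minimal_boundary q zm zp)
    \<and> (\<lambda>S. conf_system q zm zp ` S) ` sets (inf_confs_borel q zm zp)
        = sets (restrict_space (prob_systems q zm zp) (minimal_boundary q zm zp))"
proof -
  interpret qlattice q zm zp using assms by unfold_locales
  have "bij_betw boundary_system (inf_confs q zm zp) (minimal_boundary q zm zp)"
    unfolding minimal_boundary_eq using boundary_system_inj by (rule inj_on_imp_bij_betw)
  moreover have "bij_betw (conf_system q zm zp) Ginf (minimal_boundary q zm zp)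
      = bij_betw boundary_system Ginf (minimal_boundary q zm zp)"
    by (rule bij_betw_cong) (rule conf_system_eq)
  ultimately have "bij_betw (conf_system q zm zp) (inf_confs q zm zp) (minimal_boundary q zm zp)"
    by simp
  then show ?thesis
    using minimal_boundary_eq martin_boundary_eq Borel_structures_agree by simp
qed

end
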